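(* Let $a>0$ and $\psi(x)=\operatorname{sech}(ax)=\frac{2}{e^{ax}+e^{-ax}}$. Let $\Lambda\subseteq\mathbb{R}$ be a separated set and $m_\Lambda:\Lambda\to\mathbb{N}$ a multiplicity function with $\sup_{\lambda\in\Lambda}m_\Lambda(\lambda)<\infty$. (i) If $D^-(\Lambda,m_\Lambda)>1$, then $(\Lambda,m_\Lambda)$ is a sampling set for $V^p(\psi)$ for every $1\le p\le\infty$. (ii) Conversely, if $(\Lambda,m_\Lambda)$ is a sampling set for $V^2(\psi)$, then $D^-(\Lambda,m_\Lambda)\ge1$.
   Context: For $1\le p\le\infty$, $V^p(\psi)=\{f\in L^p(\mathbb{R}): f=\sum_{k\in\mathbb{Z}}c_k \psi(\cdot-k),\ c\in\ell^p(\mathbb{Z})\}$. A set $\Lambda\subseteq\mathbb{R}$ is separated if $\inf\{|\lambda-\lambda'|:\lambda\ne\lambda'\in\Lambda\}>0$. $(\Lambda,m_\Lambda)$ is a sampling set for $V^p(\psi)$, $1\le p<\infty$, if there are $A,B>0$ with $A\|f\|_p^p\le\sum_{\lambda\in\Lambda}\sum_{j=0}^{m_\Lambda(\lambda)-1}|f^{(j)}(\lambda)|^p\le B\|f\|_p^p$ for all $f\in V^p(\psi)$; for $p=\infty$: $A\|f\|_\infty\le\sup_{\lambda\in\Lambda}\max_{0\le j\le m_\Lambda(\lambda)-1}|f^{(j)}(\lambda)|\le B\|f\|_\infty$ for all $f\in V^\infty(\psi)$. $D^-(\Lambda,m_\Lambda)=\liminf_{r\to\infty}\inf_{x\in\mathbb{R}}\frac{1}{2r}\sum_{\lambda\in\Lambda\cap[x-r,x+r]}m_\Lambda(\lambda)$.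 *)

theory Defs
  imports "HOL-Analysis.Analysis" "HOL-Probability.Essential_Supremum"
begin

definition sech_a :: "real \<Rightarrow> real \<Rightarrow> real" where
  "sech_a a x = 2 / (exp (a * x) + exp (- (a * x)))"

definition lp_seq :: "real \<Rightarrow> (int \<Rightarrow> complex) \<Rightarrow> bool" where
  "lp_seq p c \<longleftrightarrow> (\<lambda>k. norm (c k) powr p) summable_on UNIV"

definition linf_seq :: "(int \<Rightarrow> complex) \<Rightarrow> bool" where
  "linf_seq c \<longleftrightarrow> bounded (range c)"

definition Lp_fun :: "real \<Rightarrow> (real \<Rightarrow> complex) \<Rightarrow> bool" where
  "Lp_fun p f \<longleftrightarrow> f \<in> borel_measurable lborel \<and> integrable lborel (\<lambda>x. norm (f x) powr p)"

definition Lp_norm :: "real \<Rightarrow> (real \<Rightarrow> complex) \<Rightarrow> real" where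
  "Lp_norm p f = (\<integral>x. norm (f x) powr p \<partial>lborel) powr (1 / p)"

definition Linf_norm :: "(real \<Rightarrow> complex) \<Rightarrow> ereal" where
  "Linf_norm f = esssup lborel (\<lambda>x. ereal (norm (f x)))"

definition Linf_fun :: "(real \<Rightarrow> complex) \<Rightarrow> bool" where
  "Linf_fun f \<longleftrightarrow> f \<in> borel_measurable lborel \<and> Linf_norm f < \<infinity>"

definition generated_by :: "(real \<Rightarrow> real) \<Rightarrow> (int \<Rightarrow> complex) \<Rightarrow> (real \<Rightarrow> complex) \<Rightarrow> bool" where
  "generated_by \<psi> c f \<longleftrightarrow>
     (\<forall>x. ((\<lambda>k. c k * complex_of_real (\<psi> (x - real_of_int k))) has_sum f x) UNIV)"

definition Vp :: "real \<Rightarrow> (real \<Rightarrow> real) \<Rightarrow> (real \<Rightarrow> complex) set" where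
  "Vp p \<psi> = {f. Lp_fun p f \<and> (\<exists>c. lp_seq p c \<and> generated_by \<psi> c f)}"

definition Vinf :: "(real \<Rightarrow> real) \<Rightarrow> (real \<Rightarrow> complex) set" where
  "Vinf \<psi> = {f. Linf_fun f \<and> (\<exists>c. linf_seq c \<and> generated_by \<psi> c f)}"

definition hderiv :: "nat \<Rightarrow> (real \<Rightarrow> complex) \<Rightarrow> real \<Rightarrow> complex" where
  "hderiv j f = ((\<lambda>g x. vector_derivative g (at x)) ^^ j) f"

definition separated :: "real set \<Rightarrow> bool" where
  "separated \<Lambda> \<longleftrightarrow> (\<exists>\<delta>>0. \<forall>l\<in>\<Lambda>. \<forall>l'\<in>\<Lambda>. l \<noteq> l' \<longrightarrow> \<delta> \<le> \<bar>l - l'\<bar>)"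

definition sampling_set_p :: "real \<Rightarrow> (real \<Rightarrow> real) \<Rightarrow> real set \<Rightarrow> (real \<Rightarrow> nat) \<Rightarrow> bool" where
  "sampling_set_p p \<psi> \<Lambda> m \<longleftrightarrow>
     (\<exists>A>0. \<exists>B>0. \<forall>f\<in>Vp p \<psi>.
        (\<lambda>l. \<Sum>j<m l. norm (hderiv j f l) powr p) summable_on \<Lambda> \<and>
        A * Lp_norm p f powr p \<le> (\<Sum>\<^sub>\<infinity>l\<in>\<Lambda>. \<Sum>j<m l. norm (hderiv j f l) powr p) \<and>
        (\<Sum>\<^sub>\<infinity>l\<in>\<Lambda>. \<Sum>j<m l. norm (hderiv j f l) powr p) \<le> B * Lp_norm p f powr p)"

definition sampling_set_inf :: "(real \<Rightarrow> real) \<Rightarrow> real set \<Rightarrow> (real \<Rightarrow> nat) \<Rightarrow> bool" where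
  "sampling_set_inf \<psi> \<Lambda> m \<longleftrightarrow>
     (\<exists>A>0. \<exists>B>0. \<forall>f\<in>Vinf \<psi>.
        ereal A * Linf_norm f \<le> (SUP l\<in>\<Lambda>. SUP j\<in>{..<m l}. ereal (norm (hderiv j f l))) \<and>
        (SUP l\<in>\<Lambda>. SUP j\<in>{..<m l}. ereal (norm (hderiv j f l))) \<le> ereal B * Linf_norm f)"

definition lower_density :: "real set \<Rightarrow> (real \<Rightarrow> nat) \<Rightarrow> ereal" where
  "lower_density \<Lambda> m =
     Liminf at_top (\<lambda>r::real. INF x. ereal ((\<Sum>l\<in>\<Lambda> \<inter> {x - r..x + r}. real (m l)) / (2 * r)))"

end

theory Submission
  imports Defs "HOL-Complex_Analysis.Complex_Analysis"
begin

text \<open>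
  Write \<open>f = (\<Sum>l. c l * sech (a (x - l)))\<close>. For an integer \<open>k\<close> let \<open>K\<close> be the quotient of a product over the
  integers \<open>l \<noteq> k\<close> near \<open>k\<close>, with simple zeros at the poles \<open>l + \<i> \<pi> / (2 a)\<close> of \<open>f\<close>, by a product over the
  nodes near \<open>k\<close>, with zeros of order \<open>m\<close>. Since \<open>f K\<close> is \<open>\<i> \<pi> / a\<close>-periodic and decays, its residues over one
  period add up to 0; the residue at the pole \<open>k + \<i> \<pi> / (2 a)\<close> is a multiple of \<open>c k\<close>, and the residues at the
  nodes are combinations of the derivatives of \<open>f\<close>. Density above 1 makes the denominator of \<open>K\<close> outgrow the numerator,
  so the coefficients of this formula decay exponentially in the distance to \<open>k\<close>, uniformly in \<open>k\<close>. Schur's test then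
  bounds the coefficient sequence by the samples for every \<open>p\<close>.

  Conversely, if some long interval contains few nodes, a dimension count gives \<open>c \<noteq> 0\<close>, supported in a slightly
  shorter interval, whose \<open>f\<close> vanishes at all these nodes to the prescribed order. By exponential decay its remaining
  samples are negligible compared with its norm.
\<close>

section \<open>Separated sets and weighted sums\<close>

text \<open>All products are finite: integers and nodes are taken within distance
  \<open>J * L\<close> of \<open>k\<close>. The poles of \<open>f\<close> beyond this range are not
  cancelled, so the residue identity gives \<open>c k\<close> only up to an error of order
  \<open>exp (- real (J * L) / 2)\<close> times a bound on the coefficients, and \<open>J\<close> is
  sent to infinity. The obstacle is therefore uniformity: no constant may depend on
  \<open>J\<close>, on \<open>k\<close> or on the chosen nodes, but only on \<open>a\<close>, the
  separation, the maximal multiplicity and a block length \<open>L\<close>.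

  Density above 1 enters through this \<open>L\<close>: every closed interval of length
  \<open>L - 1\<close> has weight at least \<open>L + 1\<close>. The unknown position of the nodes
  inside the blocks costs the kernel growth of slope \<open>L\<close>, but each block contributes a
  surplus of one factor in the denominator. A number of blocks fixed in advance thus outweighs both
  this loss and the factor \<open>exp (a * z)\<close>, which is needed for periodicity.\<close>

definition separated_by :: "real \<Rightarrow> real set \<Rightarrow> bool" where
  "separated_by \<delta> A \<longleftrightarrow> (\<forall>l\<in>A. \<forall>l'\<in>A. l \<noteq> l' \<longrightarrow> \<delta> \<le> \<bar>l - l'\<bar>)"

lemma separated_byD: "separated_by \<delta> A \<Longrightarrow> x \<in> A \<Longrightarrow> y \<in> A \<Longrightarrow> x \<noteq> y \<Longrightarrow> \<delta> \<le> \<bar>x - y\<bar>"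
  unfolding separated_by_def by blast

lemma separated_by_subset: "separated_by \<delta> A \<Longrightarrow> B \<subseteq> A \<Longrightarrow> separated_by \<delta> B"
  unfolding separated_by_def by blast

lemma separated_by_mono: "separated_by \<delta> A \<Longrightarrow> \<delta>' \<le> \<delta> \<Longrightarrow> separated_by \<delta>' A"
  unfolding separated_by_def by force

lemma separated_by_of_int: "separated_by 1 (range real_of_int)"
  unfolding separated_by_def by (auto simp flip: of_int_diff of_int_abs)

lemma sum_power_nat_abs_le:
  fixes q :: real
  assumes "0 \<le> q" "q < 1" "finite F"
  shows "(\<Sum>n\<in>F. q ^ nat \<bar>n\<bar>) \<le> 2 / (1 - q)"
proof -
  have geo: "(\<Sum>n\<in>N. q ^ n) \<le> 1 / (1 - q)" if "finite N" for N :: "nat set"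
    using sum_le_suminf[OF summable_geometric[of q] that] suminf_geometric[of q] assms by simp
  have half: "(\<Sum>n\<in>G. q ^ nat \<bar>n\<bar>) \<le> 1 / (1 - q)"
    if "finite G" "inj_on (\<lambda>n. nat \<bar>n\<bar>) G" for G :: "int set"
    using geo[of "(\<lambda>n. nat \<bar>n\<bar>) ` G"] that by (simp add: sum.reindex)
  have "(\<Sum>n\<in>F. q ^ nat \<bar>n\<bar>) = (\<Sum>n\<in>F \<inter> {0..}. q ^ nat \<bar>n\<bar>) + (\<Sum>n\<in>F - {0..}. q ^ nat \<bar>n\<bar>)"
    using sum.Int_Diff[OF assms(3)] by blast
  also have "\<dots> \<le> 1 / (1 - q) + 1 / (1 - q)"
    using assms by (intro add_mono half) (auto simp: inj_on_def)
  finally show ?thesis by simp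
qed

text \<open>The map \<open>n\<close>, which rounds \<open>(l - x) / \<delta>\<close> down, is
  injective on a separated set, so the sum is dominated by a two-sided geometric series. The bound
  is the same for all \<open>x\<close> and all \<open>F\<close>, which is what makes the later
  constants uniform.\<close>

lemma separated_exp_sum_bounded:
  fixes \<epsilon> \<delta> :: real
  assumes "\<epsilon> > 0" "\<delta> > 0"
  obtains E where "E > 0"
    "\<And>F x. finite F \<Longrightarrow> separated_by \<delta> F \<Longrightarrow> (\<Sum>l\<in>F. exp (- \<epsilon> * \<bar>x - l\<bar>)) \<le> E"
proof
  define q where "q = exp (- (\<epsilon> * \<delta>))"
  have q: "0 \<le> q" "q < 1" using assms by (auto simp: q_def)
  show "exp (\<epsilon> * \<delta>) * (2 / (1 - q)) > 0" using q by simp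
  fix F :: "real set" and x assume F: "finite F" "separated_by \<delta> F"
  define n where "n l = \<lfloor>(l - x) / \<delta>\<rfloor>" for l
  have inj: "inj_on n F"
  proof (rule inj_onI, rule ccontr)
    fix l l' assume l: "l \<in> F" "l' \<in> F" "n l = n l'" "l \<noteq> l'"
    have "\<delta> \<le> \<bar>l - l'\<bar>" using F l unfolding separated_by_def by blast
    moreover have "\<bar>(l - x) / \<delta> - (l' - x) / \<delta>\<bar> < 1" using l(3) unfolding n_def by linarith
    then have "\<bar>(l - l') / \<delta>\<bar> < 1" by (simp add: diff_divide_distrib)
    then have "\<bar>l - l'\<bar> < \<delta>" using assms by (simp add: field_simps)
    ultimately show False by simp
  qed
  \<comment> \<open>Rounding changes \<open>(l - x) / \<delta>\<close> by at most 1, which costs the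
    factor \<open>exp (\<epsilon> * \<delta>)\<close>.\<close>
  have bd: "exp (- \<epsilon> * \<bar>x - l\<bar>) \<le> exp (\<epsilon> * \<delta>) * q ^ nat \<bar>n l\<bar>" for l
  proof -
    have "real_of_int \<bar>n l\<bar> \<le> \<bar>(l - x) / \<delta>\<bar> + 1" unfolding n_def by linarith
    then have "\<delta> * real_of_int \<bar>n l\<bar> \<le> \<delta> * (\<bar>(l - x) / \<delta>\<bar> + 1)" using assms by simp
    also have "\<dots> = \<bar>x - l\<bar> + \<delta>" using assms by (simp add: abs_divide abs_minus_commute field_simps)
    finally have "\<epsilon> * (\<delta> * real_of_int \<bar>n l\<bar>) \<le> \<epsilon> * (\<bar>x - l\<bar> + \<delta>)" using assms by simp
    then have "- \<epsilon> * \<bar>x - l\<bar> \<le> \<epsilon> * \<delta> + real (nat \<bar>n l\<bar>) * (- (\<epsilon> * \<delta>))"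
      by (simp add: algebra_simps)
    then have "exp (- \<epsilon> * \<bar>x - l\<bar>) \<le> exp (\<epsilon> * \<delta> + real (nat \<bar>n l\<bar>) * (- (\<epsilon> * \<delta>)))" by simp
    also have "\<dots> = exp (\<epsilon> * \<delta>) * q ^ nat \<bar>n l\<bar>"
      unfolding q_def exp_add exp_of_nat_mult ..
    finally show ?thesis .
  qed
  have "(\<Sum>l\<in>F. exp (- \<epsilon> * \<bar>x - l\<bar>)) \<le> (\<Sum>l\<in>F. exp (\<epsilon> * \<delta>) * q ^ nat \<bar>n l\<bar>)"
    by (intro sum_mono bd)
  also have "\<dots> = exp (\<epsilon> * \<delta>) * (\<Sum>k\<in>n ` F. q ^ nat \<bar>k\<bar>)"
    by (simp add: sum_distrib_left sum.reindex[OF inj])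
  also have "\<dots> \<le> exp (\<epsilon> * \<delta>) * (2 / (1 - q))"
    using sum_power_nat_abs_le[OF q, of "n ` F"] F by (intro mult_left_mono) simp_all
  finally show "(\<Sum>l\<in>F. exp (- \<epsilon> * \<bar>x - l\<bar>)) \<le> exp (\<epsilon> * \<delta>) * (2 / (1 - q))" .
qed

lemma finite_separated_Int_Icc:
  assumes "\<delta> > 0" "separated_by \<delta> A"
  shows "finite (A \<inter> {x..y})"
proof -
  define n where "n l = \<lfloor>l / \<delta>\<rfloor>" for l
  have "inj_on n (A \<inter> {x..y})"
  proof (rule inj_onI, rule ccontr)
    fix l l' assume l: "l \<in> A \<inter> {x..y}" "l' \<in> A \<inter> {x..y}" "n l = n l'" "l \<noteq> l'"
    have "\<delta> \<le> \<bar>l - l'\<bar>" using assms l unfolding separated_by_def by blast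
    moreover have "\<bar>l / \<delta> - l' / \<delta>\<bar> < 1" using l(3) unfolding n_def by linarith
    then have "\<bar>(l - l') / \<delta>\<bar> < 1" by (simp add: diff_divide_distrib)
    then have "\<bar>l - l'\<bar> < \<delta>" using assms by (simp add: field_simps)
    ultimately show False by simp
  qed
  moreover have "n ` (A \<inter> {x..y}) \<subseteq> {\<lfloor>x / \<delta>\<rfloor>..\<lfloor>y / \<delta>\<rfloor>}"
    using assms by (auto simp: n_def intro!: floor_mono divide_right_mono)
  ultimately show ?thesis by (meson finite_atLeastAtMost_int finite_imageD finite_subset)
qed

section \<open>Convexity of powers and Schur's test\<close>

lemma powr_tangent_le:
  fixes s t p :: real
  assumes "p \<ge> 1" "s \<ge> 0" "t > 0"
  shows "t powr p + p * t powr (p - 1) * (s - t) \<le> s powr p"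
proof (cases "s = 0")
  case True
  have "t powr p = t powr (p - 1) * t" using assms by (simp add: powr_diff)
  then have "t powr p + p * t powr (p - 1) * (s - t) = t powr (p-1) * t * (1 - p)"
    using True by (simp add: algebra_simps)
  also have "\<dots> \<le> 0" using assms by (simp add: mult_nonneg_nonpos)
  finally show ?thesis using True by simp
next
  case False
  then have s: "s > 0" using assms by simp
  \<comment> \<open>By homogeneity the tangent at 1 suffices once \<open>s\<close> is
    positive.\<close>
  have "p * (s / t - 1) \<le> (s / t) powr p - 1"
  proof -
    have d: "((\<lambda>x. x powr p) has_real_derivative p * x powr (p - 1)) (at x)" if "x > 0" for x
      using that by (rule has_real_derivative_powr)
    have "(s / t) powr p - 1 powr p \<ge> p * 1 powr (p - 1) * (s / t - 1)"
      by (rule convex_on_imp_above_tangent[OF powr_convex[OF assms(1)] _ _ _ has_field_derivative_at_within[OF d]])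
         (use s assms in \<open>auto simp: interior_open\<close>)
    then show ?thesis by simp
  qed
  then have "t powr p * (p * (s / t - 1)) \<le> t powr p * ((s / t) powr p - 1)"
    by (intro mult_left_mono) simp_all
  also have "\<dots> = s powr p - t powr p" using s assms by (simp add: powr_divide field_simps)
  also have "t powr p * (p * (s / t - 1)) = p * t powr (p - 1) * (s - t)"
    using assms by (simp add: powr_diff field_simps)
  finally show ?thesis by simp
qed

text \<open>Jensen's inequality for weights of total mass at most \<open>E\<close>: the tangent
  inequality at the weighted mean \<open>t\<close> is summed with the weights, and the linear terms
  cancel. A vanishing weighted sum is treated apart, which also disposes of total mass 0.\<close>

lemma powr_weighted_sum_le:
  fixes w y :: "'a \<Rightarrow> real"
  assumes "p \<ge> 1" "finite F" "\<And>i. i \<in> F \<Longrightarrow> w i \<ge> 0" "\<And>i. i \<in> F \<Longrightarrow> y i \<ge> 0"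
    and E: "(\<Sum>i\<in>F. w i) \<le> E"
  shows "(\<Sum>i\<in>F. w i * y i) powr p \<le> E powr (p - 1) * (\<Sum>i\<in>F. w i * y i powr p)"
proof -
  define W where "W = (\<Sum>i\<in>F. w i)"
  define t where "t = (\<Sum>i\<in>F. w i * y i) / W"
  have W0: "W \<ge> 0" unfolding W_def using assms by (intro sum_nonneg) auto
  have R0: "(\<Sum>i\<in>F. w i * y i powr p) \<ge> 0" using assms by (intro sum_nonneg) auto
  have S0: "(\<Sum>i\<in>F. w i * y i) \<ge> 0" using assms by (intro sum_nonneg) auto
  show ?thesis
  proof (cases "(\<Sum>i\<in>F. w i * y i) = 0")
    case True then show ?thesis using R0 by simp
  next
    case False
    then have "W \<noteq> 0"
      using assms by (auto simp: W_def sum_nonneg_eq_0_iff)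
    then have W: "W > 0" using W0 by simp
    have t: "t > 0" using W S0 False by (simp add: t_def)
    have "(\<Sum>i\<in>F. w i * (t powr p + p * t powr (p - 1) * (y i - t))) \<le> (\<Sum>i\<in>F. w i * y i powr p)"
      using assms t by (intro sum_mono mult_left_mono powr_tangent_le) auto
    also have "(\<Sum>i\<in>F. w i * (t powr p + p * t powr (p - 1) * (y i - t)))
        = W * t powr p + p * t powr (p - 1) * ((\<Sum>i\<in>F. w i * y i) - W * t)"
      unfolding W_def sum_distrib_left sum_distrib_right sum_subtractf[symmetric] sum.distrib[symmetric]
      by (intro sum.cong refl) (simp add: algebra_simps)
    also have "(\<Sum>i\<in>F. w i * y i) - W * t = 0" using W by (simp add: t_def)
    finally have J: "W * t powr p \<le> (\<Sum>i\<in>F. w i * y i powr p)" by simp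
    have "(\<Sum>i\<in>F. w i * y i) powr p = (W * t) powr p" using W by (simp add: t_def)
    also have "\<dots> = W powr (p - 1) * (W * t powr p)"
      using W t by (simp add: powr_mult powr_diff)
    also have "\<dots> \<le> E powr (p - 1) * (\<Sum>i\<in>F. w i * y i powr p)"
      using J W t R0 assms E by (intro mult_mono powr_mono2) (auto simp: W_def)
    finally show ?thesis .
  qed
qed

text \<open>Jensen's inequality in every row uses the row bound; after exchanging the two sums the
  column bound finishes.\<close>

lemma schur_test_finite:
  fixes g :: "'a \<Rightarrow> 'b \<Rightarrow> real"
  assumes "p \<ge> 1" "finite K" "finite F"
    and g0: "\<And>k i. k \<in> K \<Longrightarrow> i \<in> F \<Longrightarrow> g k i \<ge> 0" and y0: "\<And>i. i \<in> F \<Longrightarrow> y i \<ge> 0"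
    and row: "\<And>k. k \<in> K \<Longrightarrow> (\<Sum>i\<in>F. g k i) \<le> E"
    and col: "\<And>i. i \<in> F \<Longrightarrow> (\<Sum>k\<in>K. g k i) \<le> E'"
  shows "(\<Sum>k\<in>K. (\<Sum>i\<in>F. g k i * y i) powr p) \<le> E powr (p - 1) * E' * (\<Sum>i\<in>F. y i powr p)"
proof -
  have "(\<Sum>k\<in>K. (\<Sum>i\<in>F. g k i * y i) powr p) \<le> (\<Sum>k\<in>K. E powr (p - 1) * (\<Sum>i\<in>F. g k i * y i powr p))"
    using assms by (intro sum_mono powr_weighted_sum_le) auto
  also have "\<dots> = E powr (p - 1) * (\<Sum>i\<in>F. (\<Sum>k\<in>K. g k i) * y i powr p)"
    unfolding sum_distrib_left[symmetric] sum_distrib_right by (subst sum.swap) simp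
  also have "\<dots> \<le> E powr (p - 1) * (\<Sum>i\<in>F. E' * y i powr p)"
    by (intro mult_left_mono sum_mono mult_right_mono col) auto
  also have "\<dots> = E powr (p - 1) * E' * (\<Sum>i\<in>F. y i powr p)"
    by (simp add: sum_distrib_left mult.assoc)
  finally show ?thesis .
qed

text \<open>For a fixed finite set of rows the finite version passes to the limit over finite sets
  of columns. The resulting bound \<open>C\<close> on all finite row sums gives both summability and
  the estimate.\<close>

lemma schur_test:
  fixes g :: "'a \<Rightarrow> 'b \<Rightarrow> real"
  assumes p: "p \<ge> 1"
    and g0: "\<And>k i. k \<in> A \<Longrightarrow> i \<in> B \<Longrightarrow> g k i \<ge> 0" and y0: "\<And>i. i \<in> B \<Longrightarrow> y i \<ge> 0"
    and row: "\<And>k F. k \<in> A \<Longrightarrow> finite F \<Longrightarrow> F \<subseteq> B \<Longrightarrow> (\<Sum>i\<in>F. g k i) \<le> E"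
    and col: "\<And>i F. i \<in> B \<Longrightarrow> finite F \<Longrightarrow> F \<subseteq> A \<Longrightarrow> (\<Sum>k\<in>F. g k i) \<le> E'"
    and b: "\<And>k. k \<in> A \<Longrightarrow> ((\<lambda>i. g k i * y i) has_sum b k) B"
    and y: "(\<lambda>i. y i powr p) summable_on B" and E': "E' \<ge> 0"
  shows "(\<lambda>k. b k powr p) summable_on A"
    and "(\<Sum>\<^sub>\<infinity>k\<in>A. b k powr p) \<le> E powr (p - 1) * E' * (\<Sum>\<^sub>\<infinity>i\<in>B. y i powr p)"
proof -
  define C where "C = E powr (p - 1) * E' * (\<Sum>\<^sub>\<infinity>i\<in>B. y i powr p)"
  have fin: "(\<Sum>k\<in>K. b k powr p) \<le> C" if K: "finite K" "K \<subseteq> A" for K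
  proof (rule tendsto_upperbound)
    show "((\<lambda>F. \<Sum>k\<in>K. (\<Sum>i\<in>F. g k i * y i) powr p) \<longlongrightarrow> (\<Sum>k\<in>K. b k powr p)) (finite_subsets_at_top B)"
    proof (intro tendsto_sum tendsto_powr')
      fix k assume "k \<in> K"
      then show "((\<lambda>F. \<Sum>i\<in>F. g k i * y i) \<longlongrightarrow> b k) (finite_subsets_at_top B)"
        using b[of k] K by (auto simp: has_sum_def)
      \<comment> \<open>\<open>b k\<close> may be 0, where continuity of the power needs a positive
        exponent and nonnegative approximants.\<close>
      show "b k \<noteq> 0 \<or> p > 0 \<and> (\<forall>\<^sub>F F in finite_subsets_at_top B. 0 \<le> (\<Sum>i\<in>F. g k i * y i))"
        using p K \<open>k \<in> K\<close>
        by (intro disjI2 conjI eventually_finite_subsets_at_top_weakI sum_nonneg mult_nonneg_nonneg g0 y0) auto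
    qed simp
    show "\<forall>\<^sub>F F in finite_subsets_at_top B. (\<Sum>k\<in>K. (\<Sum>i\<in>F. g k i * y i) powr p) \<le> C"
    proof (rule eventually_finite_subsets_at_top_weakI)
      fix F assume F: "finite F" "F \<subseteq> B"
      have "(\<Sum>k\<in>K. (\<Sum>i\<in>F. g k i * y i) powr p) \<le> E powr (p - 1) * E' * (\<Sum>i\<in>F. y i powr p)"
        using F K by (intro schur_test_finite p g0 y0 row col) auto
      also have "\<dots> \<le> C" unfolding C_def using F E' y
        by (intro mult_left_mono finite_sum_le_infsum) auto
      finally show "(\<Sum>k\<in>K. (\<Sum>i\<in>F. g k i * y i) powr p) \<le> C" .
    qed
  qed simp
  show sm: "(\<lambda>k. b k powr p) summable_on A"
    by (rule nonneg_bdd_above_summable_on) (auto intro!: bdd_aboveI[of _ C] fin)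
  then show "(\<Sum>\<^sub>\<infinity>k\<in>A. b k powr p) \<le> E powr (p - 1) * E' * (\<Sum>\<^sub>\<infinity>i\<in>B. y i powr p)"
    unfolding C_def[symmetric] by (rule infsum_le_finite_sums) (use fin in auto)
qed

text \<open>Gaussian elimination by induction on the equations: an equation with zero coefficients
  on \<open>I\<close> is dropped, any other one is solved for a pivot unknown \<open>i0\<close>,
  which lowers both cardinalities by one.\<close>

lemma nontrivial_kernel:
  fixes A :: "'j \<Rightarrow> 'i \<Rightarrow> complex"
  assumes "finite J" "finite I" "card J < card I"
  shows "\<exists>c. (\<forall>i. i \<notin> I \<longrightarrow> c i = 0) \<and> (\<exists>i. c i \<noteq> 0) \<and> (\<forall>j\<in>J. (\<Sum>i\<in>I. A j i * c i) = 0)"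
  using assms
proof (induction J arbitrary: A I rule: finite_induct)
  case empty
  then obtain i0 where "i0 \<in> I" by fastforce
  then show ?case by (intro exI[of _ "\<lambda>i. if i = i0 then 1 else 0"]) auto
next
  case (insert j J)
  show ?case
  proof (cases "\<forall>i\<in>I. A j i = 0")
    case True
    obtain c where "\<forall>i. i \<notin> I \<longrightarrow> c i = 0" "\<exists>i. c i \<noteq> 0" "\<forall>j\<in>J. (\<Sum>i\<in>I. A j i * c i) = 0"
      using insert.IH[of I A] insert.prems insert.hyps by auto
    then show ?thesis using True by (intro exI[of _ c]) auto
  next
    case False
    then obtain i0 where i0: "i0 \<in> I" "A j i0 \<noteq> 0" by blast
    \<comment> \<open>The system that remains after eliminating \<open>i0\<close> by means of
      equation \<open>j\<close>.\<close>
    define A' where "A' j' i = A j' i - A j' i0 * A j i / A j i0" for j' i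
    obtain c where c: "\<forall>i. i \<notin> I - {i0} \<longrightarrow> c i = 0" "\<exists>i. c i \<noteq> 0"
        "\<forall>j\<in>J. (\<Sum>i\<in>I - {i0}. A' j i * c i) = 0"
    proof -
      have "card J < card (I - {i0})" using insert.prems insert.hyps i0 by simp
      then show ?thesis using that insert.IH[of "I - {i0}" A'] insert.prems by blast
    qed
    define s where "s = (\<Sum>i\<in>I - {i0}. A j i * c i)"
    \<comment> \<open>Back substitution: the value at \<open>i0\<close> solves equation
      \<open>j\<close>, the others come from the reduced system.\<close>
    define d where "d = c(i0 := - s / A j i0)"
    have sum_d: "(\<Sum>i\<in>I. A j' i * d i) = A j' i0 * (- s / A j i0) + (\<Sum>i\<in>I - {i0}. A j' i * c i)" for j'
      using insert.prems i0 by (subst sum.remove[of I i0]) (auto simp: d_def intro!: sum.cong)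
    have "(\<Sum>i\<in>I. A j' i * d i) = 0" if "j' \<in> insert j J" for j'
    proof (cases "j' = j")
      case True then show ?thesis using i0 by (simp add: sum_d s_def)
    next
      case False
      then have "(\<Sum>i\<in>I - {i0}. A' j' i * c i) = 0" using c that by auto
      moreover have "(\<Sum>i\<in>I - {i0}. A' j' i * c i) = (\<Sum>i\<in>I - {i0}. A j' i * c i) - A j' i0 / A j i0 * s"
        unfolding A'_def s_def sum_distrib_left sum_subtractf[symmetric]
        by (intro sum.cong) (auto simp: algebra_simps)
      ultimately show ?thesis by (simp add: sum_d)
    qed
    moreover have "\<forall>i. i \<notin> I \<longrightarrow> d i = 0" using c i0 by (auto simp: d_def)
    moreover have "\<exists>i. d i \<noteq> 0" using c by (metis d_def fun_upd_other Diff_iff insertCI)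
    ultimately show ?thesis by blast
  qed
qed

text \<open>
  Both sums run over blocks of length \<open>L\<close>: a block carries \<open>L\<close> integers but weight at least \<open>L + 1\<close>.
  The terms with factor \<open>L\<close> telescope, and the surplus weight of each block survives on the right.
\<close>

lemma sum_positive_parts_le:
  fixes w :: "real \<Rightarrow> real" and L J :: nat
  assumes P: "finite P" and w: "\<And>l. l \<in> P \<Longrightarrow> w l \<ge> 0"
    and blk: "\<And>j. j < J \<Longrightarrow> real L + 1 \<le> (\<Sum>l\<in>P \<inter> {real (j * L)<..real ((j + 1) * L)}. w l)"
  shows "(\<Sum>k=1..J * L. max 0 (x - real k)) - (\<Sum>l\<in>P \<inter> {0<..real (J * L)}. w l * max 0 (x - l))
    \<le> real L * max 0 x - real L * max 0 (x - real (J * L)) - (\<Sum>j<J. max 0 (x - real ((j + 1) * L)))"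
  using blk
proof (induction J)
  case 0 then show ?case by simp
next
  case (Suc J)
  let ?B = "{real (J * L)<..real ((J + 1) * L)}"
  define X where "X = max 0 (x - real ((J + 1) * L))"
  have IH: "(\<Sum>k=1..J * L. max 0 (x - real k)) - (\<Sum>l\<in>P \<inter> {0<..real (J * L)}. w l * max 0 (x - l))
    \<le> real L * max 0 x - real L * max 0 (x - real (J * L)) - (\<Sum>j<J. max 0 (x - real ((j + 1) * L)))"
    using Suc by simp
  have "{1..Suc J * L} = {1..J * L} \<union> {J * L + 1..J * L + L}" by auto
  then have "(\<Sum>k=1..Suc J * L. max 0 (x - real k))
      = (\<Sum>k=1..J * L. max 0 (x - real k)) + (\<Sum>k=J * L + 1..J * L + L. max 0 (x - real k))"
    by (simp, subst sum.union_disjoint) auto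
  \<comment> \<open>Every integer of the block is moved to the left end \<open>J * L\<close> and,
    below, every node to the right end \<open>(J + 1) * L\<close>; both moves can only raise the
    difference of the two sums.\<close>
  moreover have "(\<Sum>k=J * L + 1..J * L + L. max 0 (x - real k)) \<le> (\<Sum>k=J * L + 1..J * L + L. max 0 (x - real (J * L)))"
    by (intro sum_mono) (auto simp: max_def simp flip: of_nat_mult)
  moreover have "P \<inter> {0<..real (Suc J * L)} = (P \<inter> {0<..real (J * L)}) \<union> (P \<inter> ?B)"
    by (auto simp: algebra_simps) (smt (verit) mult_nonneg_nonneg of_nat_0_le_iff)+
  then have "(\<Sum>l\<in>P \<inter> {0<..real (Suc J * L)}. w l * max 0 (x - l))
      = (\<Sum>l\<in>P \<inter> {0<..real (J * L)}. w l * max 0 (x - l)) + (\<Sum>l\<in>P \<inter> ?B. w l * max 0 (x - l))"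
    using P by (simp, subst sum.union_disjoint) auto
  moreover have "(real L + 1) * X \<le> (\<Sum>l\<in>P \<inter> ?B. w l * max 0 (x - l))"
  proof -
    have "(real L + 1) * X \<le> (\<Sum>l\<in>P \<inter> ?B. w l) * X"
      using Suc.prems[of J] by (intro mult_right_mono) (auto simp: X_def)
    also have "\<dots> \<le> (\<Sum>l\<in>P \<inter> ?B. w l * max 0 (x - l))"
      unfolding sum_distrib_right X_def using w
      by (intro sum_mono mult_left_mono) (auto simp del: of_nat_mult)
    finally show ?thesis .
  qed
  moreover have "X = max 0 (x - real (Suc J * L))" by (simp add: X_def)
  moreover have "(\<Sum>j<Suc J. max 0 (x - real ((j + 1) * L))) = (\<Sum>j<J. max 0 (x - real ((j + 1) * L))) + X"
    by (simp add: X_def)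
  ultimately show ?case using IH by (simp del: of_nat_mult add: algebra_simps)
qed

section \<open>Derivatives of functions in the shift-invariant space\<close>

lemma int_exp_sum_bounded:
  fixes \<epsilon> :: real
  assumes "\<epsilon> > 0"
  obtains E where "E > 0"
    "\<And>F x. finite F \<Longrightarrow> (\<Sum>l\<in>F. exp (- \<epsilon> * \<bar>x - real_of_int l\<bar>)) \<le> E"
proof -
  obtain E where E: "E > 0"
    "\<And>F x. finite F \<Longrightarrow> separated_by 1 F \<Longrightarrow> (\<Sum>l\<in>F. exp (- \<epsilon> * \<bar>x - l\<bar>)) \<le> E"
    using separated_exp_sum_bounded[OF assms zero_less_one] by blast
  show thesis
  proof (rule that[OF E(1)])
    fix F :: "int set" and x assume "finite F"
    then show "(\<Sum>l\<in>F. exp (- \<epsilon> * \<bar>x - real_of_int l\<bar>)) \<le> E"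
      using E(2)[of "real_of_int ` F" x] separated_by_subset[OF separated_by_of_int]
      by (simp add: sum.reindex inj_on_def image_subset_iff)
  qed
qed

lemma int_exp_summable:
  fixes \<epsilon> x :: real
  assumes "\<epsilon> > 0"
  shows "(\<lambda>l. exp (- \<epsilon> * \<bar>x - real_of_int l\<bar>)) summable_on UNIV"
proof -
  obtain E where "\<And>F x. finite F \<Longrightarrow> (\<Sum>l\<in>F. exp (- \<epsilon> * \<bar>x - real_of_int l\<bar>)) \<le> E"
    using int_exp_sum_bounded[OF assms] by blast
  then show ?thesis
    by (intro nonneg_bdd_above_summable_on) (auto intro!: bdd_aboveI[of _ E])
qed

section \<open>Holomorphy and decay of the hyperbolic secant\<close>

definition csech :: "real \<Rightarrow> complex \<Rightarrow> complex" where
  "csech a z = 1 / cosh (of_real a * z)"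

definition dsech :: "real \<Rightarrow> nat \<Rightarrow> real \<Rightarrow> complex" where
  "dsech a j x = (deriv ^^ j) (csech a) (of_real x)"

lemma csech_of_real: "csech a (of_real x) = of_real (sech_a a x)"
  by (simp add: csech_def sech_a_def cosh_field_def exp_of_real flip: of_real_mult of_real_minus)

lemma open_strip: "open {z. \<bar>Im z\<bar> < r}"
  by (intro open_Collect_less continuous_intros)

lemma norm_cosh_ge_cos: "cosh (Re w) * cos (Im w) \<le> norm (cosh w)"
proof -
  have "cosh (Re w) * cos (Im w) = Re (cosh w)"
    by (simp add: cosh_field_def Re_exp algebra_simps add_divide_distrib)
  also have "\<dots> \<le> norm (cosh w)" by (rule complex_Re_le_cmod)
  finally show ?thesis .
qed

lemma cosh_nonzero_strip:
  assumes "a > 0" "\<bar>Im z\<bar> < pi / (2 * a)"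
  shows "cosh (of_real a * z) \<noteq> 0"
proof -
  have "\<bar>a * Im z\<bar> < pi / 2" using assms by (simp add: abs_mult field_simps)
  then have "cos (a * Im z) > 0" by (intro cos_gt_zero_pi) auto
  then have "cosh (a * Re z) * cos (a * Im z) > 0" by simp
  then show ?thesis using norm_cosh_ge_cos[of "of_real a * z"] by auto
qed

lemma csech_holomorphic: 
  assumes "a > 0"
  shows "csech a holomorphic_on {z. \<bar>Im z\<bar> < pi / (2 * a)}"
  unfolding csech_def[abs_def] using cosh_nonzero_strip[OF assms] unfolding cosh_field_def
  by (intro holomorphic_intros) auto

text \<open>The strip corresponds to the angle \<open>pi / 3\<close>, strictly below
  \<open>pi / 2\<close>, so that the cosine is at least 1/2. Together with the lower bound
  \<open>exp |t| / 2\<close> for \<open>cosh t\<close> this gives the constant 4.\<close>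

lemma norm_csech_le:
  assumes "a > 0" "\<bar>Im z\<bar> \<le> pi / (3 * a)"
  shows "norm (csech a z) \<le> 4 * exp (- a * \<bar>Re z\<bar>)"
proof -
  have "\<bar>a * Im z\<bar> \<le> pi / 3" using assms by (simp add: abs_mult field_simps)
  then have "cos (pi / 3) \<le> cos \<bar>a * Im z\<bar>" by (intro cos_monotone_0_pi_le) auto
  then have c: "cos (a * Im z) \<ge> 1 / 2" by (simp add: cos_60)
  have "exp \<bar>a * Re z\<bar> / 2 \<le> cosh (a * Re z)"
    by (auto simp: cosh_field_def abs_if)
  then have "exp \<bar>a * Re z\<bar> / 2 * (1 / 2) \<le> cosh (a * Re z) * cos (a * Im z)"
    using c by (intro mult_mono) auto
  also have "\<dots> \<le> norm (cosh (of_real a * z))" using norm_cosh_ge_cos[of "of_real a * z"] by simp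
  finally have "exp (a * \<bar>Re z\<bar>) / 4 \<le> norm (cosh (of_real a * z))"
    using assms by (simp add: abs_mult)
  then have "1 / norm (cosh (of_real a * z)) \<le> 1 / (exp (a * \<bar>Re z\<bar>) / 4)"
    by (intro divide_left_mono) (auto intro!: mult_pos_pos intro: less_le_trans[of 0 "exp (a * \<bar>Re z\<bar>) / 4"])
  also have "\<dots> = 4 * exp (- a * \<bar>Re z\<bar>)" by (simp add: exp_minus field_simps)
  finally show ?thesis by (simp add: csech_def norm_divide)
qed

text \<open>Moving from \<open>x\<close> to a point of the disc changes the real part by at most
  \<open>pi / (3 * a)\<close>, which costs the factor \<open>exp (pi / 3)\<close>.\<close>

lemma norm_csech_ball_le:
  assumes "a > 0" "norm (z - of_real x) \<le> pi / (3 * a)"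
  shows "norm (csech a (z - of_real y)) \<le> 4 * exp (pi / 3) * exp (- a * \<bar>x - y\<bar>)"
proof -
  have "\<bar>Re z - x\<bar> \<le> pi / (3 * a)" "\<bar>Im z\<bar> \<le> pi / (3 * a)"
    using assms abs_Re_le_cmod[of "z - of_real x"] abs_Im_le_cmod[of "z - of_real x"] by auto
  then have "norm (csech a (z - of_real y)) \<le> 4 * exp (- a * \<bar>Re z - y\<bar>)"
    using norm_csech_le[OF assms(1), of "z - of_real y"] by simp
  also have "\<dots> \<le> 4 * exp (a * (pi / (3 * a)) + - a * \<bar>x - y\<bar>)"
  proof -
    have "a * \<bar>x - y\<bar> \<le> a * (\<bar>Re z - y\<bar> + pi / (3 * a))"
      using assms \<open>\<bar>Re z - x\<bar> \<le> _\<close> by (intro mult_left_mono) auto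
    then show ?thesis by (simp add: algebra_simps)
  qed
  also have "\<dots> = 4 * exp (pi / 3) * exp (- a * \<bar>x - y\<bar>)" using assms unfolding exp_add by simp
  finally show ?thesis .
qed

lemma cball_subset_strip:
  assumes "a > 0"
  shows "cball (of_real x) (pi / (3 * a)) \<subseteq> {z. \<bar>Im z\<bar> < pi / (2 * a)}"
proof
  fix z assume "z \<in> cball (complex_of_real x) (pi / (3 * a))"
  then have "norm (z - of_real x) \<le> pi / (3 * a)" by (simp add: dist_norm norm_minus_commute)
  then have "\<bar>Im z\<bar> \<le> pi / (3 * a)" using abs_Im_le_cmod[of "z - of_real x"] by auto
  also have "\<dots> < pi / (2 * a)" using assms by (simp add: field_simps)
  finally show "z \<in> {z. \<bar>Im z\<bar> < pi / (2 * a)}" by simp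
qed

text \<open>Cauchy's inequality on the circle of radius \<open>pi / (3 * a)\<close> about
  \<open>x\<close>, where sech decays like \<open>exp (- a * |x|)\<close>. The constants for all
  \<open>j < M\<close> are added up; the extra 1 keeps the result positive for
  \<open>M = 0\<close>.\<close>

lemma dsech_bounded:
  assumes "a > 0"
  obtains C where "C > 0" "\<And>j x. j < M \<Longrightarrow> norm (dsech a j x) \<le> C * exp (- a * \<bar>x\<bar>)"
proof -
  define r where "r = pi / (3 * a)"
  have r: "r > 0" using assms by (simp add: r_def)
  define C where "C j = fact j * (4 * exp (pi / 3)) / r ^ j" for j
  have C: "C j > 0" for j unfolding C_def using r by (intro divide_pos_pos mult_pos_pos) auto
  have b: "norm (dsech a j x) \<le> C j * exp (- a * \<bar>x\<bar>)" for j x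
  proof -
    have hol: "csech a holomorphic_on cball (of_real x) r"
      using csech_holomorphic[OF assms] cball_subset_strip[OF assms] unfolding r_def
      by (rule holomorphic_on_subset)
    have "norm ((deriv ^^ j) (csech a) (of_real x))
        \<le> fact j * (4 * exp (pi / 3) * exp (- a * \<bar>x\<bar>)) / r ^ j"
    proof (rule Cauchy_inequality)
      fix z :: complex assume "norm (of_real x - z) = r"
      then show "norm (csech a z) \<le> 4 * exp (pi / 3) * exp (- a * \<bar>x\<bar>)"
        using norm_csech_ball_le[OF assms, of z x 0] by (simp add: r_def norm_minus_commute)
    qed (use hol r in \<open>auto intro: holomorphic_on_imp_continuous_on holomorphic_on_subset\<close>)
    then show ?thesis by (simp add: dsech_def C_def)
  qed
  show thesis
  proof (rule that[of "1 + (\<Sum>j<M. C j)"])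
    show "1 + (\<Sum>j<M. C j) > 0" using C by (intro add_pos_nonneg sum_nonneg) (auto intro: less_imp_le)
    fix j x assume "j < M"
    then have "C j \<le> (\<Sum>j<M. C j)" using C by (intro member_le_sum) (auto intro: less_imp_le)
    then have "C j \<le> 1 + (\<Sum>j<M. C j)" by simp
    then have "C j * exp (- a * \<bar>x\<bar>) \<le> (1 + (\<Sum>j<M. C j)) * exp (- a * \<bar>x\<bar>)"
      by (rule mult_right_mono) simp
    then show "norm (dsech a j x) \<le> (1 + (\<Sum>j<M. C j)) * exp (- a * \<bar>x\<bar>)"
      using b[of j x] by linarith
  qed
qed

section \<open>Termwise differentiation of the series\<close>

lemma higher_deriv_sum:
  assumes "\<And>i. i \<in> I \<Longrightarrow> f i holomorphic_on A" "open A" "z \<in> A"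
  shows "(deriv ^^ n) (\<lambda>w. \<Sum>i\<in>I. f i w) z = (\<Sum>i\<in>I. (deriv ^^ n) (f i) z)"
  using assms(1)
proof (induction I rule: infinite_finite_induct)
  case (insert i I)
  then have "(deriv ^^ n) (\<lambda>w. f i w + (\<Sum>i\<in>I. f i w)) z
      = (deriv ^^ n) (f i) z + (deriv ^^ n) (\<lambda>w. \<Sum>i\<in>I. f i w) z"
    using assms by (intro higher_deriv_add) (auto intro!: holomorphic_intros)
  then show ?case using insert by simp
qed simp_all

text \<open>The majorant \<open>B\<close> makes the finite partial sums converge uniformly, and a
  uniform limit of holomorphic functions is holomorphic with convergence of all derivatives. The
  limit is taken along finite subsets of the index set, which matches the unordered sums of
  \<open>has_sum\<close>.\<close>

lemma higher_deriv_has_sum: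
  fixes g :: "'i \<Rightarrow> complex \<Rightarrow> complex"
  assumes g: "\<And>i. g i holomorphic_on A" and A: "open A"
    and le: "\<And>i z. z \<in> A \<Longrightarrow> norm (g i z) \<le> B i" and B: "B summable_on UNIV"
    and F: "\<And>z. z \<in> A \<Longrightarrow> ((\<lambda>i. g i z) has_sum F z) UNIV"
  shows "F holomorphic_on A"
    and "z \<in> A \<Longrightarrow> ((\<lambda>i. (deriv ^^ j) (g i) z) has_sum (deriv ^^ j) F z) UNIV"
proof -
  have ul: "uniform_limit A (\<lambda>X z. \<Sum>i\<in>X. g i z) F (finite_subsets_at_top UNIV)"
    using le F B by (intro Weierstrass_m_test_general'[where M = B]) auto
  have hol: "(\<lambda>z. \<Sum>i\<in>X. g i z) holomorphic_on A" for X
    using g by (intro holomorphic_intros)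
  show "F holomorphic_on A"
  proof (rule holomorphic_onI)
    fix z assume "z \<in> A"
    then obtain r where r: "r > 0" "cball z r \<subseteq> A" using A open_contains_cball by blast
    have "F holomorphic_on ball z r"
    proof (rule holomorphic_uniform_limit)
      show "\<forall>\<^sub>F X in finite_subsets_at_top UNIV. continuous_on (cball z r) (\<lambda>z. \<Sum>i\<in>X. g i z) \<and>
            (\<lambda>z. \<Sum>i\<in>X. g i z) holomorphic_on ball z r"
        using r hol by (intro always_eventually allI conjI)
          (auto intro!: holomorphic_on_imp_continuous_on holomorphic_on_subset[OF hol])
      show "uniform_limit (cball z r) (\<lambda>X z. \<Sum>i\<in>X. g i z) F (finite_subsets_at_top UNIV)"
        using ul r(2) by (rule uniform_limit_on_subset)
    qed auto
    then show "F field_differentiable at z within A"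
      using r holomorphic_on_imp_differentiable_at[of F "ball z r" z]
      by (auto intro: field_differentiable_at_within)
  qed
  assume z: "z \<in> A"
  have "((\<lambda>X. (deriv ^^ j) (\<lambda>z. \<Sum>i\<in>X. g i z) z) \<longlongrightarrow> (deriv ^^ j) F z) (finite_subsets_at_top UNIV)"
    by (rule higher_deriv_complex_uniform_limit[OF ul _ _ A z]) (auto simp: hol)
  then show "((\<lambda>i. (deriv ^^ j) (g i) z) has_sum (deriv ^^ j) F z) UNIV"
    unfolding has_sum_def using higher_deriv_sum[of _ g A z j, OF g A z] by simp
qed

text \<open>Connects the two notions of derivative: along the real axis the complex derivative is
  the vector derivative of the restriction, and induction carries this through the
  iteration.\<close>

lemma hderiv_of_holomorphic:
  assumes "F holomorphic_on A" "open A" "\<And>x. of_real x \<in> A"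
  shows "hderiv j (\<lambda>x. F (of_real x)) x = (deriv ^^ j) F (of_real x)"
proof (induction j arbitrary: x)
  case 0 then show ?case by (simp add: hderiv_def)
next
  case (Suc j)
  have "((\<lambda>x. (deriv ^^ j) F (of_real x)) has_vector_derivative (deriv ^^ Suc j) F (of_real x)) (at x)"
    using has_field_derivative_higher_deriv[OF assms(1,2) assms(3)]
    by (intro has_vector_derivative_real_field) auto
  moreover have "hderiv j (\<lambda>x. F (of_real x)) = (\<lambda>x. (deriv ^^ j) F (of_real x))"
    using Suc by blast
  ultimately show ?case by (simp add: hderiv_def vector_derivative_at)
qed

lemma dsech_translate:
  assumes "a > 0"
  shows "(deriv ^^ j) (\<lambda>z. csech a (z - of_int l)) (of_real x) = dsech a j (x - real_of_int l)"
  using higher_deriv_compose_linear'[OF csech_holomorphic[OF assms] open_strip[of "pi / (2 * a)"] open_strip[of "pi / (2 * a)"],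
      of "of_real x" 1 "- of_int l" j] assms
  by (simp add: dsech_def)

lemma csech_translate_holomorphic:
  assumes "a > 0"
  shows "(\<lambda>z. csech a (z - of_int l)) holomorphic_on {z. \<bar>Im z\<bar> < pi / (2 * a)}"
proof -
  have "(csech a \<circ> (\<lambda>z. z - of_int l)) holomorphic_on {z. \<bar>Im z\<bar> < pi / (2 * a)}"
    by (rule holomorphic_on_compose_gen[OF _ csech_holomorphic[OF assms]]) (auto intro!: holomorphic_intros)
  then show ?thesis by (simp add: o_def)
qed

text \<open>The majorant \<open>b x\<close> is attached to a disc about the real point
  \<open>x\<close>, so holomorphy is proved disc by disc; together the discs form a strip about the
  real axis. Differentiability of all orders, the termwise derivatives and continuity of
  \<open>f\<close> all come from this extension.\<close>

lemma generated_by_extension: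
  assumes a: "a > 0" and c: "bounded (range c)" and f: "generated_by (sech_a a) c f"
  obtains F U where "open U" "\<And>x. complex_of_real x \<in> U" "F holomorphic_on U" "f = (\<lambda>x. F (of_real x))"
    "\<And>j x. ((\<lambda>l. c l * dsech a j (x - real_of_int l)) has_sum (deriv ^^ j) F (of_real x)) UNIV"
proof -
  define r where "r = pi / (3 * a)"
  have r: "r > 0" using a by (simp add: r_def)
  obtain B where B: "\<And>l. norm (c l) \<le> B" using c by (auto simp: bounded_iff)
  have B0: "B \<ge> 0" using B[of 0] norm_ge_zero order_trans by blast
  define g where "g l z = c l * csech a (z - of_int l)" for l z
  define F where "F z = (\<Sum>\<^sub>\<infinity>l. g l z)" for z
  define b where "b x l = B * (4 * exp (pi / 3)) * exp (- a * \<bar>x - real_of_int l\<bar>)" for x l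
  define S where "S = {z. \<bar>Im z\<bar> < pi / (2 * a)}"
  have S: "csech a holomorphic_on S" "open S"
    unfolding S_def using csech_holomorphic[OF a] open_strip by auto
  have h: "(\<lambda>z. csech a (z - of_int l)) holomorphic_on S" for l
    unfolding S_def by (rule csech_translate_holomorphic[OF a])
  have gS: "g l holomorphic_on S" for l
    unfolding g_def[abs_def] by (rule holomorphic_on_mult[OF holomorphic_on_const h])
  have ball: "ball (of_real x) r \<subseteq> S" for x
    using cball_subset_strip[OF a, of x] ball_subset_cball unfolding S_def r_def by blast
  have le: "norm (g l z) \<le> b x l" if "z \<in> ball (of_real x) r" for l x z
  proof -
    have "norm (csech a (z - of_real (real_of_int l))) \<le> 4 * exp (pi / 3) * exp (- a * \<bar>x - real_of_int l\<bar>)"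
      using that by (intro norm_csech_ball_le[OF a]) (auto simp: dist_norm r_def norm_minus_commute)
    then have "norm (c l) * norm (csech a (z - of_real (real_of_int l))) \<le> B * (4 * exp (pi / 3) * exp (- a * \<bar>x - real_of_int l\<bar>))"
      using B0 B by (intro mult_mono) auto
    then show ?thesis by (simp add: g_def b_def norm_mult)
  qed
  have b: "b x summable_on UNIV" for x unfolding b_def
    by (intro summable_on_cmult_right int_exp_summable a)
  have gF: "((\<lambda>l. g l z) has_sum F z) UNIV" if "z \<in> ball (of_real x) r" for x z
  proof -
    have "(\<lambda>l. norm (g l z)) summable_on UNIV"
      by (rule summable_on_comparison_test[OF b[of x]]) (use le[OF that] in auto)
    then show ?thesis unfolding F_def by (rule has_sum_infsum[OF abs_summable_summable])
  qed
  have Fx: "F holomorphic_on ball (of_real x) r"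
      "((\<lambda>i. (deriv ^^ j) (g i) (of_real x)) has_sum (deriv ^^ j) F (of_real x)) UNIV" for x j
  proof -
    have hol: "g l holomorphic_on ball (of_real x) r" for l
      by (rule holomorphic_on_subset[OF gS ball])
    note * = higher_deriv_has_sum[of g "ball (of_real x) r" "b x" F, OF hol open_ball le[of _ x] b gF[of _ x]]
    show "F holomorphic_on ball (of_real x) r" by (rule *(1))
    show "((\<lambda>i. (deriv ^^ j) (g i) (of_real x)) has_sum (deriv ^^ j) F (of_real x)) UNIV"
      by (rule *(2)) (use r in auto)
  qed
  have fF: "f = (\<lambda>x. F (of_real x))"
  proof
    fix x
    have "((\<lambda>l. g l (of_real x)) has_sum f x) UNIV"
    proof -
      have "csech a (of_real x - of_int l) = of_real (sech_a a (x - real_of_int l))" for l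
        using csech_of_real[of a "x - real_of_int l"] by simp
      then show ?thesis using f unfolding generated_by_def g_def by simp
    qed
    moreover have "((\<lambda>l. g l (of_real x)) has_sum F (of_real x)) UNIV"
      using r by (intro gF[of _ x]) auto
    ultimately show "f x = F (of_real x)" using has_sum_unique by blast
  qed
  have "F holomorphic_on (\<Union>x. ball (of_real x) r)"
    using Fx(1) by (intro holomorphic_on_UN_open) auto
  moreover have "(deriv ^^ j) (g l) (of_real x) = c l * dsech a j (x - real_of_int l)" for l j x
  proof -
    have "(deriv ^^ j) (g l) (of_real x) = c l * (deriv ^^ j) (\<lambda>z. csech a (z - of_int l)) (of_real x)"
      unfolding g_def[abs_def]
      using a by (intro higher_deriv_cmult[OF h _ S(2)]) (auto simp: S_def)
    also have "(deriv ^^ j) (\<lambda>z. csech a (z - of_int l)) (of_real x) = dsech a j (x - real_of_int l)"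
      by (rule dsech_translate[OF a])
    finally show ?thesis .
  qed
  then have "((\<lambda>l. c l * dsech a j (x - real_of_int l)) has_sum (deriv ^^ j) F (of_real x)) UNIV" for j x
    using Fx(2)[of j x] by simp
  moreover have "complex_of_real x \<in> (\<Union>x. ball (of_real x) r)" for x
    using r by (intro UN_I[of x]) auto
  moreover have "open (\<Union>x. ball (complex_of_real x) r)" by blast
  ultimately show thesis using that fF by blast
qed

lemma hderiv_has_sum:
  assumes a: "a > 0" and c: "bounded (range c)" and f: "generated_by (sech_a a) c f"
  shows "((\<lambda>l. c l * dsech a j (x - real_of_int l)) has_sum hderiv j f x) UNIV"
proof (rule generated_by_extension[OF a c f])
  fix F U
  assume FU: "open U" "\<And>x. complex_of_real x \<in> U" "F holomorphic_on U" "f = (\<lambda>x. F (of_real x))"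
    and hs: "\<And>j x. ((\<lambda>l. c l * dsech a j (x - real_of_int l)) has_sum (deriv ^^ j) F (of_real x)) UNIV"
  have "hderiv j f x = (deriv ^^ j) F (of_real x)"
    unfolding FU(4) by (rule hderiv_of_holomorphic[OF FU(3,1,2)])
  then show ?thesis using hs by simp
qed

lemma generated_by_continuous:
  assumes a: "a > 0" and c: "bounded (range c)" and f: "generated_by (sech_a a) c f"
  shows "continuous_on UNIV f"
proof (rule generated_by_extension[OF a c f])
  fix F U
  assume FU: "open U" "\<And>x. complex_of_real x \<in> U" "F holomorphic_on U" "f = (\<lambda>x. F (of_real x))"
  have "continuous_on U F" by (rule holomorphic_on_imp_continuous_on[OF FU(3)])
  then have "continuous_on UNIV (\<lambda>x. F (complex_of_real x))"
    by (rule continuous_on_compose2) (use FU(2) in \<open>auto intro!: continuous_intros\<close>)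
  then show ?thesis by (simp add: FU(4))
qed

section \<open>Growth of the generating function\<close>

text \<open>The factors of the Weierstrass-type products, normalised to be close to 1 on the side away from growth.\<close>

definition phi :: "real \<Rightarrow> real \<Rightarrow> complex \<Rightarrow> complex" where
  "phi a s w = 1 - exp (of_real (2 * a * s) * w)"

text \<open>Factoring out the larger of 1 and \<open>exp y\<close> leaves
  \<open>1 + exp (- |y|)\<close>. The exponent thus splits into the true growth
  \<open>max 0 y\<close> and an exponentially small correction that can be summed over separated
  centres.\<close>

lemma one_plus_exp_le: "1 + exp y \<le> exp (max 0 y + exp (- \<bar>y\<bar>))" for y :: real
proof (cases "y \<ge> 0")
  case True
  have "1 + exp y = exp y * (1 + exp (- y))" by (simp add: distrib_left flip: exp_add)
  also have "\<dots> \<le> exp y * exp (exp (- y))" by (intro mult_left_mono exp_ge_add_one_self) auto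
  finally show ?thesis using True by (simp add: exp_add)
next
  case False
  then show ?thesis using exp_ge_add_one_self[of "exp y"] by (simp add: max_def)
qed

lemma exp_minus_quotient_le:
  fixes t :: real
  assumes "0 \<le> t" "t \<le> q" "q < 1"
  shows "exp (- (t / (1 - q))) \<le> 1 - t"
proof -
  have "1 / (1 - t) = 1 + t / (1 - t)" using assms by (simp add: field_simps)
  also have "\<dots> \<le> exp (t / (1 - t))" by (rule exp_ge_add_one_self)
  also have "\<dots> \<le> exp (t / (1 - q))" using assms by (auto intro!: divide_left_mono)
  finally show ?thesis using assms by (simp add: exp_minus field_simps)
qed

text \<open>Lower counterpart with the same main term. At the zero \<open>y = 0\<close> no such
  bound can hold, hence the distance \<open>y0\<close>, which enters only the constant of the
  correction.\<close>

lemma abs_one_minus_exp_ge: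
  fixes y y0 :: real
  assumes "y0 > 0" "y0 \<le> \<bar>y\<bar>"
  shows "exp (max 0 y - exp (- \<bar>y\<bar>) / (1 - exp (- y0))) \<le> \<bar>1 - exp y\<bar>"
proof -
  have q: "exp (- (exp (- \<bar>y\<bar>) / (1 - exp (- y0)))) \<le> 1 - exp (- \<bar>y\<bar>)"
    using assms by (intro exp_minus_quotient_le) auto
  show ?thesis
  proof (cases "y \<ge> 0")
    case True
    have "exp y * exp (- (exp (- \<bar>y\<bar>) / (1 - exp (- y0)))) \<le> exp y * (1 - exp (- \<bar>y\<bar>))"
      using q by (intro mult_left_mono) auto
    also have "\<dots> = \<bar>1 - exp y\<bar>" using True by (simp add: right_diff_distrib flip: exp_add)
    finally show ?thesis using True by (simp add: max_def exp_diff exp_minus divide_inverse)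
  next
    case False then show ?thesis using q by (simp add: max_def)
  qed
qed

lemma norm_phi_le:
  assumes "a > 0" "\<bar>s\<bar> = 1"
  shows "norm (phi a s w) \<le> exp (2 * a * max 0 (s * Re w) + exp (- 2 * a * \<bar>Re w\<bar>))"
proof -
  have "norm (phi a s w) \<le> 1 + exp (2 * a * s * Re w)"
    unfolding phi_def using norm_triangle_ineq4[of 1 "exp (of_real (2 * a * s) * w)"] by simp
  also have "\<dots> \<le> exp (max 0 (2 * a * s * Re w) + exp (- \<bar>2 * a * s * Re w\<bar>))" by (rule one_plus_exp_le)
  also have "max 0 (2 * a * s * Re w) = 2 * a * max 0 (s * Re w)"
    using assms by (simp add: max_mult_distrib_left mult.assoc)
  also have "\<bar>2 * a * s * Re w\<bar> = 2 * a * \<bar>Re w\<bar>" using assms by (simp add: abs_mult)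
  finally show ?thesis by simp
qed

text \<open>The places where a factor has to be bounded from below, with \<open>w\<close> the
  position relative to its zero: horizontally away from the zero, on the small circle used in
  Cauchy's inequality at a node, and on the horizontal line that carries the poles of
  \<open>f\<close>.\<close>

definition regular_point :: "real \<Rightarrow> real \<Rightarrow> real \<Rightarrow> complex \<Rightarrow> bool" where
  "regular_point a \<delta> \<rho> w \<longleftrightarrow> \<delta> \<le> \<bar>Re w\<bar> \<or> norm w = \<rho> \<or> Im w = pi / (2 * a)"

text \<open>Away from the zero the real estimate applies. On the circle, compactness gives a
  positive minimum, because \<open>2 * a * \<rho> < 2 * pi\<close> keeps the circle off the other
  zeros. On the line \<open>Im w = pi / (2 * a)\<close> the exponential is a negative real number,
  so nothing cancels.\<close>

lemma norm_phi_ge: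
  assumes a: "a > 0" and "\<delta> > 0" "\<rho> > 0" "\<rho> < pi / a"
  obtains \<kappa> where "\<kappa> \<ge> 0" "\<And>s w. \<bar>s\<bar> = 1 \<Longrightarrow> regular_point a \<delta> \<rho> w \<Longrightarrow>
    exp (2 * a * max 0 (s * Re w) - \<kappa> * exp (- 2 * a * \<bar>Re w\<bar>)) \<le> norm (phi a s w)"
proof -
  have "\<exists>x\<in>sphere (0::complex) (2 * a * \<rho>). \<forall>y\<in>sphere (0::complex) (2 * a * \<rho>). norm (1 - exp x) \<le> norm (1 - exp y)"
    using mult_pos_pos[OF a assms(3)] mult_pos_pos[OF assms(3) a]
    by (intro continuous_attains_inf) (auto intro!: continuous_intros simp: mult.assoc)
  then obtain v :: complex where v: "norm v = 2 * a * \<rho>"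
    and vmin: "\<And>y::complex. norm y = 2 * a * \<rho> \<Longrightarrow> norm (1 - exp v) \<le> norm (1 - exp y)" by auto
  define c where "c = norm (1 - exp v)"
  have "exp v \<noteq> 1"
  proof
    assume "exp v = 1"
    then obtain n :: int where n: "Re v = 0" "Im v = of_int (2 * n) * pi" by (auto simp: exp_eq_1)
    then have "norm v = \<bar>of_int (2 * n) * pi\<bar>" by (simp add: cmod_def)
    then have e: "2 * a * \<rho> = \<bar>real_of_int (2 * n)\<bar> * pi" using v by (simp add: abs_mult)
    have "2 * a * \<rho> < 2 * pi" using assms by (simp add: field_simps)
    with e have "\<bar>real_of_int (2 * n)\<bar> * pi < 2 * pi" by simp
    then have "\<bar>real_of_int (2 * n)\<bar> < 2" by simp
    then have "n = 0" by (simp flip: of_int_abs)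
    with e a assms show False by simp
  qed
  then have c: "c > 0" by (simp add: c_def)
  \<comment> \<open>The first entry is the constant of the real estimate for
    \<open>y0 = 2 * a * \<delta>\<close>; the second is chosen so that \<open>2 * a * \<rho> -
    \<kappa> * exp (- (2 * a * \<rho>)) \<le> ln c\<close>.\<close>
  define \<kappa> where "\<kappa> = max (1 / (1 - exp (- (2 * a * \<delta>)))) (exp (2 * a * \<rho>) * (2 * a * \<rho> - ln c))"
  have k0: "\<kappa> \<ge> 0" unfolding \<kappa>_def using a assms by (simp add: le_max_iff_disj)
  show thesis
  proof (rule that[OF k0])
    fix s :: real and w assume s: "\<bar>s\<bar> = 1" and g: "regular_point a \<delta> \<rho> w"
    have m: "max 0 (2 * a * s * Re w) = 2 * a * max 0 (s * Re w)"
      using a by (simp add: max_mult_distrib_left mult.assoc)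
    have ab: "\<bar>2 * a * s * Re w\<bar> = 2 * a * \<bar>Re w\<bar>" using a s by (simp add: abs_mult)
    consider "\<delta> \<le> \<bar>Re w\<bar>" | "norm w = \<rho>" | "Im w = pi / (2 * a)" using g unfolding regular_point_def by blast
    then show "exp (2 * a * max 0 (s * Re w) - \<kappa> * exp (- 2 * a * \<bar>Re w\<bar>)) \<le> norm (phi a s w)"
    proof cases
      case 1
      have "exp (2 * a * max 0 (s * Re w) - \<kappa> * exp (- 2 * a * \<bar>Re w\<bar>))
          \<le> exp (2 * a * max 0 (s * Re w) - 1 / (1 - exp (- (2 * a * \<delta>))) * exp (- 2 * a * \<bar>Re w\<bar>))"
        by (simp only: exp_le_cancel_iff, intro diff_left_mono mult_right_mono) (auto simp: \<kappa>_def)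
      also have "\<dots> \<le> \<bar>1 - exp (2 * a * s * Re w)\<bar>"
        using abs_one_minus_exp_ge[of "2 * a * \<delta>" "2 * a * s * Re w"] 1 a assms unfolding m ab by simp
      also have "\<dots> \<le> norm (phi a s w)"
        unfolding phi_def using norm_triangle_ineq3[of 1 "exp (of_real (2 * a * s) * w)"] by simp
      finally show ?thesis .
    next
      case 2
      have re: "\<bar>Re w\<bar> \<le> \<rho>" using 2 abs_Re_le_cmod by metis
      then have "s * Re w \<le> \<rho>" "- s * Re w \<le> \<rho>" using s by (auto simp: abs_if split: if_splits)
      then have m1: "2 * a * max 0 (s * Re w) \<le> 2 * a * \<rho>" using a assms by simp
      have "2 * a * \<rho> - ln c \<le> \<kappa> * exp (- (2 * a * \<rho>))"
      proof -
        have "exp (2 * a * \<rho>) * (2 * a * \<rho> - ln c) \<le> \<kappa>" by (simp add: \<kappa>_def)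
        then have "exp (- (2 * a * \<rho>)) * (exp (2 * a * \<rho>) * (2 * a * \<rho> - ln c)) \<le> exp (- (2 * a * \<rho>)) * \<kappa>"
          by (intro mult_left_mono) auto
        moreover have "exp (- t) * (exp t * u) = u" for t u :: real by (simp add: exp_minus)
        ultimately show ?thesis by (simp only: mult.commute[of _ \<kappa>])
      qed
      also have "\<dots> \<le> \<kappa> * exp (- 2 * a * \<bar>Re w\<bar>)"
        using k0 a re by (intro mult_left_mono) auto
      finally have "exp (2 * a * max 0 (s * Re w) - \<kappa> * exp (- 2 * a * \<bar>Re w\<bar>)) \<le> exp (ln c)"
        using m1 by simp
      also have "\<dots> = c" using c by simp
      also have "c \<le> norm (phi a s w)" unfolding phi_def c_def using a s 2
        by (intro vmin) (simp add: norm_mult)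
      finally show ?thesis .
    next
      case 3
      have "s = 1 \<or> s = -1" using s by linarith
      then have "exp (of_real (2 * a * s) * w) = - of_real (exp (2 * a * s * Re w))"
        using 3 a by (auto simp: complex_eq_iff Re_exp Im_exp)
      then have "phi a s w = of_real (1 + exp (2 * a * s * Re w))" by (simp add: phi_def)
      then have "norm (phi a s w) = 1 + exp (2 * a * s * Re w)" by (simp add: norm_of_real del: of_real_add)
      moreover have "exp (2 * a * max 0 (s * Re w)) \<le> 1 + exp (2 * a * s * Re w)"
        unfolding m[symmetric] by (auto simp: max_def)
      moreover have "exp (2 * a * max 0 (s * Re w) - \<kappa> * exp (- 2 * a * \<bar>Re w\<bar>)) \<le> exp (2 * a * max 0 (s * Re w))"
        using k0 by simp
      ultimately show ?thesis by linarith
    qed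
  qed
qed

text \<open>A sign with value 1 at 0, so that no factor \<open>phi a (side l)\<close> degenerates.
  With this orientation the factor centred at \<open>l\<close> grows only beyond \<open>l\<close> as
  seen from 0.\<close>

definition side :: "real \<Rightarrow> real" where
  "side x = (if x \<ge> 0 then 1 else - 1)"

lemma abs_side [simp]: "\<bar>side x\<bar> = 1" by (simp add: side_def)

lemma sum_nonzero_ints:
  fixes g :: "int \<Rightarrow> 'a::comm_monoid_add"
  shows "(\<Sum>l\<in>{- int N..int N} - {0}. g l) = (\<Sum>k=1..N. g (int k)) + (\<Sum>k=1..N. g (- int k))"
proof -
  have "{- int N..int N} - {0} = {1..int N} \<union> uminus ` {1..int N}"
    by auto
  also have "\<dots> = int ` {1..N} \<union> (\<lambda>k. - int k) ` {1..N}"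
    by (simp add: image_image[of uminus int, symmetric] image_int_atLeastAtMost del: image_image)
  also have "(\<Sum>l\<in>\<dots>. g l) = (\<Sum>k=1..N. g (int k)) + (\<Sum>k=1..N. g (- int k))"
    by (subst sum.union_disjoint) (auto simp: sum.reindex inj_on_def)
  finally show ?thesis .
qed

text \<open>The blocks start from 0 in both directions and are open at the end nearer to 0. So they
  are disjoint, each holds exactly \<open>L\<close> integers, and the integer 0, whose pole is to
  survive, lies in none of them.\<close>

definition dense_blocks :: "nat \<Rightarrow> nat \<Rightarrow> real set \<Rightarrow> (real \<Rightarrow> nat) \<Rightarrow> bool" where
  "dense_blocks L J P m \<longleftrightarrow> (\<forall>j<J.
     real L + 1 \<le> (\<Sum>l\<in>P \<inter> {real (j * L)<..real ((j + 1) * L)}. real (m l)) \<and>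
     real L + 1 \<le> (\<Sum>l\<in>P \<inter> {- real ((j + 1) * L)..<- real (j * L)}. real (m l)))"

text \<open>Up to the factor \<open>2 * a\<close> and bounded corrections, the left side is the
  logarithm of the quotient of the two products. For \<open>x \<ge> 0\<close> the negative integers
  contribute nothing, and nodes outside the positive blocks may be dropped because they only lower
  the difference. Negative \<open>x\<close> is reduced to this by reflecting the nodes.\<close>

lemma growth_exponent_le:
  assumes P: "finite P" and blk: "dense_blocks L J P m"
  shows "(\<Sum>l\<in>{- int (J * L)..int (J * L)} - {0}. max 0 (side (real_of_int l) * (x - real_of_int l)))
     - (\<Sum>l\<in>P. real (m l) * max 0 (side l * (x - l)))
    \<le> real L * \<bar>x\<bar> - (\<Sum>j<J. max 0 (\<bar>x\<bar> - real ((j + 1) * L)))"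
proof (cases "x \<ge> 0")
  case True
  have "(\<Sum>l\<in>{- int (J * L)..int (J * L)} - {0}. max 0 (side (real_of_int l) * (x - real_of_int l)))
      = (\<Sum>k=1..J * L. max 0 (x - real k))"
  proof -
    have "(\<Sum>k=1..J * L. max 0 (side (real_of_int (- int k)) * (x - real_of_int (- int k)))) = 0"
      using True by (intro sum.neutral) (auto simp: side_def)
    then show ?thesis unfolding sum_nonzero_ints by (simp add: side_def)
  qed
  moreover have "(\<Sum>l\<in>P \<inter> {0<..real (J * L)}. real (m l) * max 0 (x - l))
      \<le> (\<Sum>l\<in>P. real (m l) * max 0 (side l * (x - l)))"
  proof -
    have "(\<Sum>l\<in>P \<inter> {0<..real (J * L)}. real (m l) * max 0 (x - l))
        = (\<Sum>l\<in>P \<inter> {0<..real (J * L)}. real (m l) * max 0 (side l * (x - l)))"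
      by (intro sum.cong) (auto simp: side_def)
    also have "\<dots> \<le> (\<Sum>l\<in>P. real (m l) * max 0 (side l * (x - l)))"
      using P by (intro sum_mono2) auto
    finally show ?thesis .
  qed
  moreover have "(\<Sum>k=1..J * L. max 0 (x - real k)) - (\<Sum>l\<in>P \<inter> {0<..real (J * L)}. real (m l) * max 0 (x - l))
    \<le> real L * max 0 x - real L * max 0 (x - real (J * L)) - (\<Sum>j<J. max 0 (x - real ((j + 1) * L)))"
    using P blk by (intro sum_positive_parts_le) (auto simp: dense_blocks_def)
  moreover have "real L * max 0 (x - real (J * L)) \<ge> 0" by simp
  moreover have "max 0 x = x" "\<bar>x\<bar> = x" using True by auto
  ultimately show ?thesis by (simp only: diff_le_eq)
next
  case False
  define Q where "Q = uminus ` P"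
  have Q: "finite Q" using P by (simp add: Q_def)
  have re: "(\<Sum>l\<in>P \<inter> uminus ` B. h l) = (\<Sum>l\<in>Q \<inter> B. h (- l))" for B and h :: "real \<Rightarrow> real"
    by (rule sum.reindex_bij_witness[of _ uminus uminus]) (auto simp: Q_def)
  have img: "uminus ` {0<..u} = {- u..<0}" "uminus ` {u<..v} = {-v..<-u}" for u v :: real by auto
  have "(\<Sum>l\<in>{- int (J * L)..int (J * L)} - {0}. max 0 (side (real_of_int l) * (x - real_of_int l)))
      = (\<Sum>k=1..J * L. max 0 (- x - real k))"
  proof -
    have "(\<Sum>k=1..J * L. max 0 (side (real_of_int (int k)) * (x - real_of_int (int k)))) = 0"
      using False by (intro sum.neutral) (auto simp: side_def)
    moreover have "(\<Sum>k=1..J * L. max 0 (side (real_of_int (- int k)) * (x - real_of_int (- int k))))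
        = (\<Sum>k=1..J * L. max 0 (- x - real k))"
      by (intro sum.cong) (auto simp: side_def algebra_simps)
    ultimately show ?thesis unfolding sum_nonzero_ints by simp
  qed
  moreover have "(\<Sum>l\<in>Q \<inter> {0<..real (J * L)}. real (m (- l)) * max 0 (- x - l))
      \<le> (\<Sum>l\<in>P. real (m l) * max 0 (side l * (x - l)))"
  proof -
    have "(\<Sum>l\<in>Q \<inter> {0<..real (J * L)}. real (m (- l)) * max 0 (- x - l))
        = (\<Sum>l\<in>P \<inter> uminus ` {0<..real (J * L)}. real (m l) * max 0 (- x + l))"
      unfolding re by simp
    also have "\<dots> = (\<Sum>l\<in>P \<inter> uminus ` {0<..real (J * L)}. real (m l) * max 0 (side l * (x - l)))"
      by (intro sum.cong) (auto simp: side_def algebra_simps)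
    also have "\<dots> \<le> (\<Sum>l\<in>P. real (m l) * max 0 (side l * (x - l)))"
      using P by (intro sum_mono2) auto
    finally show ?thesis .
  qed
  moreover have "(\<Sum>k=1..J * L. max 0 (- x - real k)) - (\<Sum>l\<in>Q \<inter> {0<..real (J * L)}. real (m (- l)) * max 0 (- x - l))
    \<le> real L * max 0 (- x) - real L * max 0 (- x - real (J * L)) - (\<Sum>j<J. max 0 (- x - real ((j + 1) * L)))"
  proof (rule sum_positive_parts_le[OF Q])
    fix j assume "j < J"
    then show "real L + 1 \<le> (\<Sum>l\<in>Q \<inter> {real (j * L)<..real ((j + 1) * L)}. real (m (- l)))"
      using blk re[where B = "{real (j * L)<..real ((j + 1) * L)}" and h = "\<lambda>l. real (m l)"]
      unfolding dense_blocks_def img by metis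
  qed simp
  moreover have "real L * max 0 (- x - real (J * L)) \<ge> 0" by simp
  moreover have "max 0 (- x) = - x" "\<bar>x\<bar> = - x" using False by auto
  ultimately show ?thesis by (simp only: diff_le_eq)
qed

text \<open>Keeping only \<open>n\<close> blocks and dropping the truncation at 0 turns the surplus
  into a linear gain of slope \<open>n\<close>, at the price of a constant.\<close>

lemma block_sum_ge:
  fixes x :: real
  assumes "n \<le> J"
  shows "real n * x - real n * real n * real L \<le> (\<Sum>j<J. max 0 (x - real ((j + 1) * L)))"
proof -
  have "real n * x - real n * real n * real L = (\<Sum>j<n. x - real n * real L)"
    by (simp add: algebra_simps)
  also have "\<dots> \<le> (\<Sum>j<n. max 0 (x - real ((j + 1) * L)))"
  proof (rule sum_mono)
    fix j assume "j \<in> {..<n}"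
    then have "(j + 1) * L \<le> n * L" by (intro mult_right_mono) auto
    then have "real ((j + 1) * L) \<le> real n * real L" by (metis of_nat_le_iff of_nat_mult)
    then show "x - real n * real L \<le> max 0 (x - real ((j + 1) * L))" by linarith
  qed
  also have "\<dots> \<le> (\<Sum>j<J. max 0 (x - real ((j + 1) * L)))"
    using assms by (intro sum_mono2) auto
  finally show ?thesis .
qed

text \<open>
  The generating function centred at 0: its poles are the nodes (with multiplicity), and its zeros
  \<open>l + \<i> \<pi> / (2 a)\<close>, \<open>l \<noteq> 0\<close>, cancel the poles of the shifts of \<open>sech\<close>.
\<close>

definition kern :: "real \<Rightarrow> (real \<Rightarrow> nat) \<Rightarrow> real set \<Rightarrow> nat \<Rightarrow> complex \<Rightarrow> complex" where
  "kern a m P N z = exp (of_real a * z) *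
     (\<Prod>l\<in>{- int N..int N} - {0}. phi a (side (real_of_int l)) (z - of_int l - Complex 0 (pi / (2 * a)))) /
     (\<Prod>l\<in>P. phi a (side l) (z - of_real l) ^ m l)"

lemma kern_bounds:
  fixes a \<delta> \<rho> :: real and M L :: nat
  assumes a: "a > 0" and \<delta>: "0 < \<delta>" "\<delta> \<le> 1" and \<rho>: "\<rho> > 0" "\<rho> < pi / a"
  obtains C J0 where "C > 0"
    "\<And>P m J z. finite P \<Longrightarrow> separated_by \<delta> P \<Longrightarrow> (\<forall>l\<in>P. m l \<le> M) \<Longrightarrow> dense_blocks L J P m \<Longrightarrow> J0 \<le> J \<Longrightarrow>
       (\<forall>l\<in>P. regular_point a (\<delta> / 2) \<rho> (z - of_real l)) \<Longrightarrow> norm (kern a m P (J * L) z) \<le> C * exp (- \<bar>Re z\<bar>)"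
    "\<And>P m J. finite P \<Longrightarrow> separated_by \<delta> P \<Longrightarrow> (\<forall>l\<in>P. m l \<le> M) \<Longrightarrow>
       1 / C \<le> norm (kern a m P (J * L) (Complex 0 (pi / (2 * a))))"
proof -
  obtain \<kappa> where k0: "\<kappa> \<ge> 0" and phi_ge: "\<And>s w. \<bar>s\<bar> = 1 \<Longrightarrow> regular_point a (\<delta> / 2) \<rho> w \<Longrightarrow>
    exp (2 * a * max 0 (s * Re w) - \<kappa> * exp (- 2 * a * \<bar>Re w\<bar>)) \<le> norm (phi a s w)"
    using norm_phi_ge[of a "\<delta> / 2" \<rho>] assms by auto
  obtain E where E0: "E > 0" and E: "\<And>F x. finite F \<Longrightarrow> separated_by \<delta> F \<Longrightarrow>
      (\<Sum>l\<in>F. exp (- (2 * a) * \<bar>x - l\<bar>)) \<le> E"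
    using separated_exp_sum_bounded[OF mult_pos_pos[OF zero_less_numeral a] \<delta>(1)] by blast
  have EI: "(\<Sum>l\<in>F. exp (- 2 * a * \<bar>x - real_of_int l\<bar>)) \<le> E" if "finite F" for F x
  proof -
    have "separated_by \<delta> (real_of_int ` F)"
      by (rule separated_by_mono[OF separated_by_subset[OF separated_by_of_int]]) (use \<delta> in auto)
    then show ?thesis using E[of "real_of_int ` F" x] that by (simp add: sum.reindex inj_on_def)
  qed
  have EP: "(\<Sum>l\<in>P. real (m l) * exp (- 2 * a * \<bar>x - l\<bar>)) \<le> real M * E"
    if "finite P" "separated_by \<delta> P" "\<forall>l\<in>P. m l \<le> M" for P m x
  proof -
    have "(\<Sum>l\<in>P. real (m l) * exp (- 2 * a * \<bar>x - l\<bar>)) \<le> (\<Sum>l\<in>P. real M * exp (- (2 * a) * \<bar>x - l\<bar>))"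
      using that by (intro sum_mono mult_mono) auto
    also have "\<dots> \<le> real M * E" using E[OF that(1,2)] 
      by (simp add: sum_distrib_left[symmetric] mult_left_mono)
    finally show ?thesis .
  qed
  \<comment> \<open>A slope of \<open>- s\<close>, multiplied by \<open>2 * a\<close>, has to absorb
    the slope \<open>a\<close> of \<open>exp (a * z)\<close> and still leave decay of rate
    1.\<close>
  obtain s :: nat where s: "real s \<ge> (a + 1) / (2 * a)" using real_arch_simple by blast
  have s': "a + 1 \<le> 2 * a * real s" using s a by (simp add: field_simps)
  \<comment> \<open>\<open>L\<close> blocks make up for the loss \<open>L * |x|\<close>, the other
    \<open>s\<close> provide the decay; this is the threshold for \<open>J\<close>.\<close>
  define n where "n = L + s"
  define C1 where "C1 = exp (E + \<kappa> * (real M * E) + 2 * a * (real n * real n * real L))"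
  define C2 where "C2 = exp (\<kappa> * E + real M * E)"
  show thesis
  proof (rule that[of "max C1 C2" n])
    show "max C1 C2 > 0" by (simp add: C1_def less_max_iff_disj)
  next
    fix P m J z
    assume P: "finite P" "separated_by \<delta> P" "\<forall>l\<in>P. m l \<le> M" "dense_blocks L J P m" "n \<le> J"
      and g: "\<forall>l\<in>P. regular_point a (\<delta> / 2) \<rho> (z - of_real l)"
    let ?I = "{- int (J * L)..int (J * L)} - {0::int}"
    define x where "x = Re z"
    define S1 where "S1 = (\<Sum>l\<in>?I. max 0 (side (real_of_int l) * (x - real_of_int l)))"
    define S2 where "S2 = (\<Sum>l\<in>P. real (m l) * max 0 (side l * (x - l)))"
    have num: "norm (\<Prod>l\<in>?I. phi a (side (real_of_int l)) (z - of_int l - Complex 0 (pi / (2 * a)))) \<le> exp (2 * a * S1 + E)"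
    proof -
      have "norm (\<Prod>l\<in>?I. phi a (side (real_of_int l)) (z - of_int l - Complex 0 (pi / (2 * a))))
        \<le> (\<Prod>l\<in>?I. exp (2 * a * max 0 (side (real_of_int l) * (x - real_of_int l)) + exp (- 2 * a * \<bar>x - real_of_int l\<bar>)))"
        unfolding prod_norm[symmetric]
      proof (intro prod_mono conjI norm_ge_zero)
        fix l
        show "norm (phi a (side (real_of_int l)) (z - of_int l - Complex 0 (pi / (2 * a))))
          \<le> exp (2 * a * max 0 (side (real_of_int l) * (x - real_of_int l)) + exp (- 2 * a * \<bar>x - real_of_int l\<bar>))"
          using norm_phi_le[OF a abs_side, of "real_of_int l" "z - of_int l - Complex 0 (pi / (2 * a))"]
          by (simp add: x_def)
      qed
      also have "\<dots> = exp (2 * a * S1 + (\<Sum>l\<in>?I. exp (- 2 * a * \<bar>x - real_of_int l\<bar>)))"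
        unfolding S1_def sum_distrib_left sum.distrib[symmetric] by (simp add: exp_sum)
      also have "\<dots> \<le> exp (2 * a * S1 + E)" using EI[of ?I x] by simp
      finally show ?thesis .
    qed
    have den: "exp (2 * a * S2 - \<kappa> * (real M * E)) \<le> norm (\<Prod>l\<in>P. phi a (side l) (z - of_real l) ^ m l)"
    proof -
      have "exp (2 * a * S2 - \<kappa> * (real M * E)) \<le> exp (2 * a * S2 - \<kappa> * (\<Sum>l\<in>P. real (m l) * exp (- 2 * a * \<bar>x - l\<bar>)))"
        using EP[OF P(1-3), of x] k0 by (simp add: mult_left_mono)
      also have "\<dots> = (\<Prod>l\<in>P. exp (2 * a * max 0 (side l * (x - l)) - \<kappa> * exp (- 2 * a * \<bar>x - l\<bar>)) ^ m l)"
        unfolding S2_def sum_distrib_left sum_subtractf[symmetric] exp_of_nat_mult[symmetric]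
        by (simp add: exp_sum[OF P(1)] algebra_simps)
      also have "\<dots> \<le> (\<Prod>l\<in>P. norm (phi a (side l) (z - of_real l)) ^ m l)"
      proof (intro prod_mono conjI power_mono)
        fix l assume "l \<in> P"
        then show "exp (2 * a * max 0 (side l * (x - l)) - \<kappa> * exp (- 2 * a * \<bar>x - l\<bar>)) \<le> norm (phi a (side l) (z - of_real l))"
          using phi_ge[OF abs_side, of "z - of_real l" l] g by (simp add: x_def)
      qed auto
      also have "\<dots> = norm (\<Prod>l\<in>P. phi a (side l) (z - of_real l) ^ m l)"
        by (simp add: prod_norm[symmetric] norm_power)
      finally show ?thesis .
    qed
    have ex: "S1 - S2 \<le> real n * real n * real L - real s * \<bar>x\<bar>"
      using growth_exponent_le[OF P(1,4), of x] block_sum_ge[OF P(5), of "\<bar>x\<bar>" L]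
      unfolding S1_def S2_def by (simp add: n_def algebra_simps)
    have "norm (kern a m P (J * L) z) = exp (a * x)
        * norm (\<Prod>l\<in>?I. phi a (side (real_of_int l)) (z - of_int l - Complex 0 (pi / (2 * a))))
        / norm (\<Prod>l\<in>P. phi a (side l) (z - of_real l) ^ m l)"
      by (simp add: kern_def norm_mult norm_divide x_def)
    also have "\<dots> \<le> exp (a * x) * exp (2 * a * S1 + E) / exp (2 * a * S2 - \<kappa> * (real M * E))"
      using num den by (intro frac_le mult_left_mono) auto
    also have "\<dots> = exp (a * x + (2 * a * (S1 - S2) + E + \<kappa> * (real M * E)))"
      by (simp add: exp_add[symmetric] exp_diff[symmetric] algebra_simps)
    also have "\<dots> \<le> exp (E + \<kappa> * (real M * E) + 2 * a * (real n * real n * real L) + - \<bar>x\<bar>)"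
    proof -
      have "2 * a * (S1 - S2) \<le> 2 * a * (real n * real n * real L - real s * \<bar>x\<bar>)"
        using ex a by (intro mult_left_mono) auto
      moreover have "(a + 1) * \<bar>x\<bar> \<le> 2 * a * real s * \<bar>x\<bar>" using s' by (intro mult_right_mono) auto
      moreover have "a * x \<le> a * \<bar>x\<bar>" using a by simp
      ultimately show ?thesis by (simp add: algebra_simps)
    qed
    also have "\<dots> = C1 * exp (- \<bar>x\<bar>)" unfolding C1_def exp_add ..
    also have "\<dots> \<le> max C1 C2 * exp (- \<bar>Re z\<bar>)" unfolding x_def by (intro mult_right_mono) auto
    finally show "norm (kern a m P (J * L) z) \<le> max C1 C2 * exp (- \<bar>Re z\<bar>)" .
  next
    fix P m J
    assume P: "finite P" "separated_by \<delta> P" "\<forall>l\<in>P. m l \<le> M"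
    let ?I = "{- int (J * L)..int (J * L)} - {0::int}"
    let ?z = "Complex 0 (pi / (2 * a))"
    have num: "exp (- (\<kappa> * E)) \<le> norm (\<Prod>l\<in>?I. phi a (side (real_of_int l)) (?z - of_int l - ?z))"
    proof -
      have "exp (- (\<kappa> * E)) \<le> exp (\<Sum>l\<in>?I. - (\<kappa> * exp (- 2 * a * \<bar>0 - real_of_int l\<bar>)))"
        using EI[of ?I 0] k0 by (simp add: sum_negf sum_distrib_left[symmetric] mult_left_mono)
      also have "\<dots> = (\<Prod>l\<in>?I. exp (- (\<kappa> * exp (- 2 * a * \<bar>0 - real_of_int l\<bar>))))"
        by (simp add: exp_sum)
      also have "\<dots> \<le> (\<Prod>l\<in>?I. norm (phi a (side (real_of_int l)) (?z - of_int l - ?z)))"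
      proof (intro prod_mono conjI)
        fix l assume l: "l \<in> ?I"
        then have "1 \<le> \<bar>l\<bar>" by force
        then have "\<bar>real_of_int l\<bar> \<ge> 1" by linarith
        then have "regular_point a (\<delta> / 2) \<rho> (?z - of_int l - ?z)"
          using \<delta> by (simp add: regular_point_def)
        from phi_ge[OF abs_side this, of "real_of_int l"]
        show "exp (- (\<kappa> * exp (- 2 * a * \<bar>0 - real_of_int l\<bar>))) \<le> norm (phi a (side (real_of_int l)) (?z - of_int l - ?z))"
          by (auto simp: side_def split: if_splits)
      qed auto
      finally show ?thesis by (simp add: prod_norm)
    qed
    have den: "norm (\<Prod>l\<in>P. phi a (side l) (?z - of_real l) ^ m l) \<le> exp (real M * E)"
    proof -
      have "norm (\<Prod>l\<in>P. phi a (side l) (?z - of_real l) ^ m l) = (\<Prod>l\<in>P. norm (phi a (side l) (?z - of_real l)) ^ m l)"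
        by (simp add: prod_norm[symmetric] norm_power)
      also have "\<dots> \<le> (\<Prod>l\<in>P. exp (exp (- 2 * a * \<bar>0 - l\<bar>)) ^ m l)"
      proof (intro prod_mono conjI power_mono)
        fix l
        show "norm (phi a (side l) (?z - of_real l)) \<le> exp (exp (- 2 * a * \<bar>0 - l\<bar>))"
          using norm_phi_le[OF a abs_side, of l "?z - of_real l"] by (auto simp: side_def split: if_splits)
      qed auto
      also have "\<dots> = exp (\<Sum>l\<in>P. real (m l) * exp (- 2 * a * \<bar>0 - l\<bar>))"
        by (simp add: exp_sum[OF P(1)] exp_of_nat_mult)
      also have "\<dots> \<le> exp (real M * E)" using EP[OF P, of 0] by simp
      finally show ?thesis .
    qed
    have den0: "norm (\<Prod>l\<in>P. phi a (side l) (?z - of_real l) ^ m l) > 0"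
    proof -
      have "norm (phi a (side l) (?z - of_real l)) > 0" for l
        using phi_ge[OF abs_side, of "?z - of_real l" l] by (auto simp: regular_point_def intro: less_le_trans[OF exp_gt_zero])
      then show ?thesis by (simp add: P(1))
    qed
    have "1 / max C1 C2 \<le> 1 / C2" by (intro divide_left_mono) (auto simp: C1_def C2_def less_max_iff_disj)
    also have "\<dots> = exp (- (\<kappa> * E)) / exp (real M * E)" by (simp add: C2_def exp_add exp_minus field_simps)
    also have "\<dots> \<le> norm (\<Prod>l\<in>?I. phi a (side (real_of_int l)) (?z - of_int l - ?z))
        / norm (\<Prod>l\<in>P. phi a (side l) (?z - of_real l) ^ m l)"
      using num den den0 by (intro frac_le) auto
    also have "\<dots> = norm (kern a m P (J * L) ?z)"
      by (simp add: kern_def norm_mult norm_divide)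
    finally show "1 / max C1 C2 \<le> norm (kern a m P (J * L) ?z)" .
  qed
qed

section \<open>Residues of the generating function\<close>

lemma contour_integral_linepath_translate:
  assumes "\<And>z. z \<in> closed_segment u v \<Longrightarrow> f (z + c) = f z"
  shows "contour_integral (linepath (u + c) (v + c)) f = contour_integral (linepath u v) f"
proof -
  have "linepath (u + c) (v + c) t = linepath u v t + c" for t
    by (simp add: linepath_def algebra_simps)
  then have "f (linepath (u + c) (v + c) t) = f (linepath u v t)" if "t \<in> {0..1}" for t
    using assms[of "linepath u v t"] that linepath_in_path by auto
  then show ?thesis
    unfolding contour_integral_integral by (intro integral_cong) simp
qed

text \<open>On a rectangle whose height is one period the horizontal sides cancel and the vertical
  ones tend to 0. It reaches from \<open>- h / 4\<close> to \<open>3 * h / 4\<close> so that in the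
  application the two lines carrying poles, at heights 0 and \<open>h / 2\<close>, lie strictly
  inside.\<close>

lemma sum_residues_periodic:
  fixes H :: "complex \<Rightarrow> complex" and h :: real
  assumes h: "h > 0" and fin: "finite pts"
    and hol: "H holomorphic_on {z. - h / 2 < Im z \<and> Im z < h} - pts"
    and pts: "\<And>p. p \<in> pts \<Longrightarrow> - h / 4 < Im p \<and> Im p < 3 * h / 4"
    and per: "\<And>z. H (z + Complex 0 h) = H z"
    and dec: "\<And>z. \<bar>Re z\<bar> \<ge> X \<Longrightarrow> norm (H z) \<le> C * exp (- \<bar>Re z\<bar>)"
  shows "(\<Sum>p\<in>pts. residue H p) = 0"
proof -
  define S where "S = {z. - h / 2 < Im z \<and> Im z < h}"
  have oS: "open S" unfolding S_def by (intro open_Collect_conj open_Collect_less continuous_intros)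
  have cS: "connected S"
  proof (rule convex_connected)
    have "S = {z. - h / 2 < Im z} \<inter> {z. Im z < h}" by (auto simp: S_def)
    then show "convex S" by (simp add: convex_Int convex_halfspace_Im_gt convex_halfspace_Im_lt)
  qed
  obtain X1 where X1: "\<And>p. p \<in> pts \<Longrightarrow> \<bar>Re p\<bar> \<le> X1"
  proof -
    have "bdd_above ((\<lambda>p. \<bar>Re p\<bar>) ` pts)" using fin by simp
    then show ?thesis using that by (auto simp: bdd_above_def)
  qed
  \<comment> \<open>Two vertical sides of length \<open>h\<close>; the absolute value is taken
    because the sign of \<open>C\<close> is not prescribed.\<close>
  have bound: "norm (2 * pi * \<i> * (\<Sum>p\<in>pts. residue H p)) \<le> 2 * h * \<bar>C\<bar> * exp (- T)"
    if T: "T > X" "T > X1" "T > 0" for T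
  proof -
    define A where "A = Complex (- T) (- h / 4)"
    define B where "B = Complex T (3 * h / 4)"
    define a2 where "a2 = Complex T (- h / 4)"
    define a4 where "a4 = Complex (- T) (3 * h / 4)"
    have le: "Re A \<le> Re B" "Im A \<le> Im B" using T h by (auto simp: A_def B_def)
    have img: "path_image (rectpath A B) \<subseteq> S - pts"
    proof
      fix z assume z: "z \<in> path_image (rectpath A B)"
      then have "z \<in> cbox A B" "z \<notin> box A B" using path_image_rectpath_cbox_minus_box[OF le] by auto
      moreover have "p \<in> box A B" if "p \<in> pts" for p
        using pts[OF that] X1[OF that] T by (auto simp: in_box_complex_iff A_def B_def)
      ultimately show "z \<in> S - pts"
        using h by (auto simp: in_cbox_complex_iff A_def B_def S_def)
    qed
    have "contour_integral (rectpath A B) H = 2 * pi * \<i> * (\<Sum>p\<in>pts. winding_number (rectpath A B) p * residue H p)"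
    proof (rule Residue_theorem[OF oS cS fin])
      show "H holomorphic_on S - pts" using hol by (simp add: S_def)
      show "\<forall>z. z \<notin> S \<longrightarrow> winding_number (rectpath A B) z = 0"
      proof (intro allI impI winding_number_rectpath_outside[OF le])
        fix z assume "z \<notin> S"
        then show "z \<notin> cbox A B" using h by (auto simp: in_cbox_complex_iff A_def B_def S_def)
      qed
    qed (use img in auto)
    also have "(\<Sum>p\<in>pts. winding_number (rectpath A B) p * residue H p) = (\<Sum>p\<in>pts. residue H p)"
    proof (rule sum.cong[OF refl])
      fix p assume p: "p \<in> pts"
      then have "p \<in> box A B"
        using pts[OF p] X1[OF p] T by (auto simp: in_box_complex_iff A_def B_def)
      then show "winding_number (rectpath A B) p * residue H p = residue H p"
        by (simp add: winding_number_rectpath)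
    qed
    finally have res: "contour_integral (rectpath A B) H = 2 * pi * \<i> * (\<Sum>p\<in>pts. residue H p)" .
    have rp: "rectpath A B = linepath A a2 +++ linepath a2 B +++ linepath B a4 +++ linepath a4 A"
      by (simp add: rectpath_def Let_def A_def B_def a2_def a4_def)
    have "path_image (rectpath A B) = closed_segment A a2 \<union> closed_segment a2 B \<union> closed_segment B a4 \<union> closed_segment a4 A"
      by (simp add: rp path_image_join Un_assoc)
    then have seg: "closed_segment A a2 \<subseteq> S - pts" "closed_segment a2 B \<subseteq> S - pts"
        "closed_segment B a4 \<subseteq> S - pts" "closed_segment a4 A \<subseteq> S - pts"
      using img by auto
    have cont: "continuous_on D H" if "D \<subseteq> S - pts" for D
      using hol that unfolding S_def[symmetric] by (meson continuous_on_subset holomorphic_on_imp_continuous_on)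
    note ci = contour_integrable_continuous_linepath[OF cont]
    have "contour_integral (rectpath A B) H = contour_integral (linepath A a2) H
        + (contour_integral (linepath a2 B) H + (contour_integral (linepath B a4) H + contour_integral (linepath a4 A) H))"
      unfolding rp using ci[OF seg(1)] ci[OF seg(2)] ci[OF seg(3)] ci[OF seg(4)]
      by (simp add: contour_integrable_joinI)
    moreover have "contour_integral (linepath B a4) H = - contour_integral (linepath A a2) H"
    proof -
      have "contour_integral (linepath B a4) H = - contour_integral (linepath a4 B) H"
        by (rule contour_integral_reverse_linepath[OF cont[OF seg(3)]])
      moreover have "a4 = A + Complex 0 h" "B = a2 + Complex 0 h"
        by (auto simp: a4_def A_def B_def a2_def complex_eq_iff)
      ultimately show ?thesis using contour_integral_linepath_translate[of A a2 H "Complex 0 h"] per by simp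
    qed
    ultimately have "contour_integral (rectpath A B) H = contour_integral (linepath a2 B) H + contour_integral (linepath a4 A) H"
      by simp
    moreover have side_bound: "norm (contour_integral (linepath u v) H) \<le> \<bar>C\<bar> * exp (- T) * h"
      if uv: "Re u = Re v" "\<bar>Re u\<bar> = T" "norm (v - u) = h" and s: "closed_segment u v \<subseteq> S - pts" for u v
    proof -
      have "norm (contour_integral (linepath u v) H) \<le> \<bar>C\<bar> * exp (- T) * norm (v - u)"
      proof (rule has_contour_integral_bound_linepath[OF has_contour_integral_integral[OF ci[OF s]]])
        fix z assume "z \<in> closed_segment u v"
        then have "\<bar>Re z\<bar> = T" using uv by (simp add: closed_segment_same_Re)
        then have "norm (H z) \<le> C * exp (- T)" using dec[of z] T by simp
        also have "\<dots> \<le> \<bar>C\<bar> * exp (- T)" by (intro mult_right_mono) auto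
        finally show "norm (H z) \<le> \<bar>C\<bar> * exp (- T)" .
      qed simp
      then show ?thesis using uv by simp
    qed
    have "norm (contour_integral (linepath a2 B) H) \<le> \<bar>C\<bar> * exp (- T) * h"
      by (rule side_bound[OF _ _ _ seg(2)]) (use T h in \<open>auto simp: a2_def B_def cmod_def\<close>)
    moreover have "norm (contour_integral (linepath a4 A) H) \<le> \<bar>C\<bar> * exp (- T) * h"
      by (rule side_bound[OF _ _ _ seg(4)]) (use T h in \<open>auto simp: a4_def A_def cmod_def\<close>)
    ultimately have "norm (contour_integral (rectpath A B) H) \<le> \<bar>C\<bar> * exp (- T) * h + \<bar>C\<bar> * exp (- T) * h"
      by (metis norm_triangle_mono)
    then show ?thesis unfolding res by (simp add: algebra_simps)
  qed
  have "norm (2 * pi * \<i> * (\<Sum>p\<in>pts. residue H p)) \<le> 0"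
  proof (rule tendsto_lowerbound)
    show "((\<lambda>T. 2 * h * \<bar>C\<bar> * exp (- T)) \<longlongrightarrow> 0) at_top"
      by (intro tendsto_mult_right_zero filterlim_compose[OF exp_at_bot] filterlim_uminus_at_bot_at_top)
    show "\<forall>\<^sub>F T in at_top. norm (2 * pi * \<i> * (\<Sum>p\<in>pts. residue H p)) \<le> 2 * h * \<bar>C\<bar> * exp (- T)"
      using eventually_gt_at_top[of "max X (max X1 0)"] by eventually_elim (rule bound, auto)
  qed simp
  then show ?thesis by simp
qed

section \<open>Zeros and periodicity of the factors\<close>

lemma phi_eq_0_imp:
  assumes "a > 0" "\<bar>s\<bar> = 1" "\<bar>Im w\<bar> < pi / a" "phi a s w = 0"
  shows "w = 0"
proof -
  have "exp (of_real (2 * a * s) * w) = 1" using assms by (simp add: phi_def)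
  then obtain n :: int where n: "2 * a * s * Re w = 0" "2 * a * s * Im w = of_int (2 * n) * pi"
    by (auto simp: exp_eq_1)
  have "\<bar>2 * a * s * Im w\<bar> = 2 * (a * \<bar>Im w\<bar>)" using assms by (simp add: abs_mult)
  also have "\<dots> < 2 * pi" using assms by (simp add: field_simps)
  finally have "\<bar>real_of_int (2 * n)\<bar> * pi < 2 * pi" using n by (simp add: abs_mult)
  then have "\<bar>real_of_int (2 * n)\<bar> < 2" by simp
  then have "n = 0" by (simp flip: of_int_abs)
  then show ?thesis using n assms by (auto simp: complex_eq_iff)
qed

lemma exp_i_pi_shift: 
  assumes "a > 0"
  shows "exp (of_real a * (z + Complex 0 (pi / a))) = - exp (of_real a * z)"
proof -
  have "of_real a * (z + Complex 0 (pi / a)) = of_real a * z + \<i> * of_real pi"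
    using assms by (simp add: complex_eq_iff algebra_simps)
  then show ?thesis by (simp add: exp_add mult.commute)
qed

lemma phi_periodic:
  assumes "a > 0" "\<bar>s\<bar> = 1"
  shows "phi a s (w + Complex 0 (pi / a)) = phi a s w"
proof -
  have "of_real (2 * a * s) * (w + Complex 0 (pi / a)) = of_real (2 * a * s) * w + of_real (2 * s * pi) * \<i>"
    using assms by (simp add: complex_eq_iff algebra_simps)
  moreover have "s = 1 \<or> s = - 1" using assms by linarith
  then have "exp (of_real (2 * s * pi) * \<i>) = 1"
    by (auto simp: exp_eq_1 intro: exI[of _ "- 1 :: int"])
  ultimately show ?thesis by (simp add: phi_def exp_add)
qed

text \<open>With \<open>u = a * w\<close>, sech is \<open>2 * exp u / (1 + exp (2 * u))\<close>, and
  the shift by \<open>pi / (2 * a)\<close> turns the plus into the minus of \<open>phi\<close>. The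
  poles of sech thus become zeros of the kind of factor that forms the numerator of
  \<open>kern\<close>.\<close>

lemma csech_phi:
  assumes "a > 0"
  shows "csech a w = 2 * exp (of_real a * w) / phi a 1 (w - Complex 0 (pi / (2 * a)))"
proof -
  have "of_real (2 * a * 1) * (w - Complex 0 (pi / (2 * a))) = of_real a * w + of_real a * w - \<i> * of_real pi"
    using assms by (simp add: complex_eq_iff algebra_simps)
  then have "exp (of_real (2 * a * 1) * (w - Complex 0 (pi / (2 * a))))
      = exp (of_real a * w) * exp (of_real a * w) / exp (\<i> * of_real pi)"
    by (simp only: exp_diff exp_add)
  then have "phi a 1 (w - Complex 0 (pi / (2 * a))) = 1 + exp (of_real a * w) * exp (of_real a * w)"
    by (simp add: phi_def)
  then show ?thesis
    by (simp add: csech_def cosh_field_def exp_minus field_simps)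
qed

text \<open>\<open>phi\<close> with its zero at the origin divided out. The value at 0 is the
  derivative of \<open>phi\<close> there, which makes the function entire.\<close>

definition chi :: "real \<Rightarrow> real \<Rightarrow> complex \<Rightarrow> complex" where
  "chi a s w = (if w = 0 then - of_real (2 * a * s) else phi a s w / w)"

lemma phi_chi: "phi a s w = w * chi a s w"
  by (simp add: chi_def phi_def)

lemma phi_holomorphic [holomorphic_intros]:
  "f holomorphic_on A \<Longrightarrow> (\<lambda>z. phi a s (f z)) holomorphic_on A"
  unfolding phi_def by (intro holomorphic_intros)

lemma chi_holomorphic_UNIV: "chi a s holomorphic_on UNIV"
proof (rule pole_theorem_open_0[where g = "phi a s" and a = 0])
  show "phi a s holomorphic_on UNIV" using phi_holomorphic[of "\<lambda>z. z"] by simp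
  have "(phi a s has_field_derivative - of_real (2 * a * s)) (at 0)"
    unfolding phi_def[abs_def] by (auto intro!: derivative_eq_intros)
  then show "chi a s 0 = deriv (phi a s) 0" by (simp add: chi_def DERIV_imp_deriv)
qed (auto simp: phi_chi phi_def)

lemma chi_holomorphic [holomorphic_intros]:
  "f holomorphic_on A \<Longrightarrow> (\<lambda>z. chi a s (f z)) holomorphic_on A"
  using holomorphic_on_compose_gen[of f A "chi a s" UNIV] chi_holomorphic_UNIV by (simp add: o_def)

lemma chi_nonzero:
  assumes "a > 0" "\<bar>s\<bar> = 1" "\<bar>Im w\<bar> < pi / a"
  shows "chi a s w \<noteq> 0"
  using phi_eq_0_imp[OF assms] assms by (auto simp: chi_def)

text \<open>The factors \<open>phi\<close> are periodic, so the sign comes from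
  \<open>exp (a * z)\<close>. It matches the sign change of sech and makes the product of the two
  periodic, which is why the exponential is part of the kernel.\<close>

lemma kern_periodic:
  assumes "a > 0"
  shows "kern a m P N (z + Complex 0 (pi / a)) = - kern a m P N z"
proof -
  have *: "z + Complex 0 (pi / a) - u = (z - u) + Complex 0 (pi / a)" for u by simp
  have "phi a (side x) (z + Complex 0 (pi / a) - u) = phi a (side x) (z - u)" for x u
    unfolding * by (rule phi_periodic[OF assms abs_side])
  moreover have "phi a (side x) (z + Complex 0 (pi / a) - u - v) = phi a (side x) (z - u - v)" for x u v
    using phi_periodic[OF assms abs_side, of x "z - u - v"] by (simp add: algebra_simps)
  ultimately show ?thesis by (simp add: kern_def exp_i_pi_shift[OF assms])
qed

lemma residue_kern_pole:
  fixes l :: int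
  assumes a: "a > 0" and P: "finite P"
  defines "p \<equiv> of_int l + Complex 0 (pi / (2 * a))"
  shows "residue (\<lambda>z. csech a (z - of_int l) * kern a m P N z) p = - \<i> / of_real a * kern a m P N p"
proof -
  define U where "U = {z. 0 < Im z \<and> Im z < pi / a}"
  have U: "open U" unfolding U_def by (intro open_Collect_conj open_Collect_less continuous_intros)
  have pU: "p \<in> U" using a by (simp add: U_def p_def field_simps)
  define q where "q z = 2 * exp (of_real a * (z - of_int l)) * kern a m P N z / chi a 1 (z - p)" for z
  have nz: "phi a (side x) (z - of_real x) \<noteq> 0" if "z \<in> U" for x z
    using phi_eq_0_imp[OF a abs_side, of "z - of_real x" x] that by (auto simp: U_def complex_eq_iff)
  have nzc: "chi a 1 (z - p) \<noteq> 0" if "z \<in> U" for z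
  proof (rule chi_nonzero[OF a])
    have "\<bar>Im z - pi / (2 * a)\<bar> < pi / (2 * a)" using that by (auto simp: U_def field_simps abs_less_iff)
    also have "\<dots> < pi / a" using a by (simp add: field_simps)
    finally show "\<bar>Im (z - p)\<bar> < pi / a" by (simp add: p_def)
  qed simp
  have hol: "q holomorphic_on U" unfolding q_def[abs_def] kern_def
    using nz nzc P by (intro holomorphic_intros) auto
  have "csech a (z - of_int l) * kern a m P N z = q z / (z - p)" for z
  proof -
    have "z - of_int l - Complex 0 (pi / (2 * a)) = z - p" by (simp add: p_def)
    then have "csech a (z - of_int l) = 2 * exp (of_real a * (z - of_int l)) / ((z - p) * chi a 1 (z - p))"
      by (simp only: csech_phi[OF a] phi_chi)
    then show ?thesis by (simp add: q_def)
  qed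
  then have "residue (\<lambda>z. csech a (z - of_int l) * kern a m P N z) p = residue (\<lambda>z. q z / (z - p)) p"
    by simp
  also have "\<dots> = q p" by (rule residue_simple[OF U pU hol])
  also have "exp (of_real a * (p - of_int l)) = \<i>"
  proof -
    have "of_real a * (p - of_int l) = \<i> * of_real (pi / 2)" using a by (simp add: p_def complex_eq_iff)
    moreover have "exp (\<i> * of_real (pi / 2)) = \<i>" by (simp add: complex_eq_iff Re_exp Im_exp)
    ultimately show ?thesis by (simp only:)
  qed
  \<comment> \<open>\<open>chi a 1 0 = - 2 * a\<close>, so the factor in front is
    \<open>2 * \<i> / (- 2 * a)\<close>.\<close>
  then have "q p = - \<i> / of_real a * kern a m P N p" using a by (simp add: q_def chi_def field_simps)
  finally show ?thesis .
qed

text \<open>The kernel with its pole of order \<open>m x\<close> at the node \<open>x\<close> removed.\<close>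

definition hermite_factor :: "real \<Rightarrow> (real \<Rightarrow> nat) \<Rightarrow> real set \<Rightarrow> nat \<Rightarrow> real \<Rightarrow> complex \<Rightarrow> complex" where
  "hermite_factor a m P N x z = exp (of_real a * z) *
     (\<Prod>l\<in>{- int N..int N} - {0}. phi a (side (real_of_int l)) (z - of_int l - Complex 0 (pi / (2 * a)))) /
     ((\<Prod>l\<in>P - {x}. phi a (side l) (z - of_real l) ^ m l) * chi a (side x) (z - of_real x) ^ m x)"

lemma kern_hermite_factor:
  assumes "finite P" "x \<in> P"
  shows "kern a m P N z = hermite_factor a m P N x z / (z - of_real x) ^ m x"
  unfolding kern_def hermite_factor_def
  by (subst prod.remove[OF assms]) (simp add: phi_chi power_mult_distrib mult_ac)

lemma hermite_factor_holomorphic: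
  assumes a: "a > 0" and P: "finite P"
  shows "hermite_factor a m P N x holomorphic_on {z. \<bar>Im z\<bar> < pi / (2 * a)} - of_real ` (P - {x})"
proof -
  have im: "\<bar>Im (z - of_real l)\<bar> < pi / a" if "\<bar>Im z\<bar> < pi / (2 * a)" for z l
  proof -
    have "pi / (2 * a) < pi / a" using a by (simp add: field_simps)
    then show ?thesis using that by simp
  qed
  have "phi a (side l) (z - of_real l) \<noteq> 0"
    if "z \<in> {z. \<bar>Im z\<bar> < pi / (2 * a)} - of_real ` (P - {x})" "l \<in> P - {x}" for z l
    using phi_eq_0_imp[OF a abs_side im, of z l l] that by auto
  moreover have "chi a (side x) (z - of_real x) \<noteq> 0" if "\<bar>Im z\<bar> < pi / (2 * a)" for z
    by (rule chi_nonzero[OF a abs_side im[OF that]])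
  ultimately show ?thesis
    unfolding hermite_factor_def using P by (intro holomorphic_intros) auto
qed

text \<open>At a pole of order \<open>m x\<close> the residue is a Taylor coefficient of order
  \<open>m x - 1\<close>, and Leibniz' rule separates sech from the kernel. The resulting
  coefficients do not depend on \<open>l\<close>, so by superposition the same combination of
  derivatives can be applied to \<open>f\<close>.\<close>

lemma residue_kern_node:
  assumes a: "a > 0" and P: "finite P" and x: "x \<in> P" "m x \<ge> 1"
  shows "residue (\<lambda>z. csech a (z - of_int l) * kern a m P N z) (of_real x)
    = (\<Sum>j<m x. (of_nat ((m x - 1) choose j) * (deriv ^^ (m x - 1 - j)) (hermite_factor a m P N x) (of_real x) / fact (m x - 1))
        * dsech a j (x - real_of_int l))"
proof -
  define U where "U = {z. \<bar>Im z\<bar> < pi / (2 * a)} - of_real ` (P - {x})"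
  have U: "open U" unfolding U_def using P
    by (intro open_Diff open_strip finite_imp_closed finite_imageI finite_Diff)
  have xU: "of_real x \<in> U" using a by (auto simp: U_def)
  have h1: "(\<lambda>z. csech a (z - of_int l)) holomorphic_on U"
    using csech_translate_holomorphic[OF a] by (rule holomorphic_on_subset) (auto simp: U_def)
  have h2: "hermite_factor a m P N x holomorphic_on U"
    unfolding U_def by (rule hermite_factor_holomorphic[OF a P])
  obtain n where n: "m x = Suc n" using x by (cases "m x") auto
  have "(\<lambda>z. csech a (z - of_int l) * kern a m P N z)
      = (\<lambda>z. (csech a (z - of_int l) * hermite_factor a m P N x z) / (z - of_real x) ^ Suc n)"
    by (simp add: kern_hermite_factor[OF P x(1)] n)
  then have "residue (\<lambda>z. csech a (z - of_int l) * kern a m P N z) (of_real x)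
      = (deriv ^^ n) (\<lambda>z. csech a (z - of_int l) * hermite_factor a m P N x z) (of_real x) / fact n"
    using residue_holomorphic_over_power[OF U xU holomorphic_on_mult[OF h1 h2], of n] by simp
  also have "(deriv ^^ n) (\<lambda>z. csech a (z - of_int l) * hermite_factor a m P N x z) (of_real x)
     = (\<Sum>j = 0..n. of_nat (n choose j) * (deriv ^^ j) (\<lambda>z. csech a (z - of_int l)) (of_real x)
         * (deriv ^^ (n - j)) (hermite_factor a m P N x) (of_real x))"
    by (rule higher_deriv_mult[OF h1 h2 U xU])
  also have "\<dots> / fact n = (\<Sum>j<m x. (of_nat ((m x - 1) choose j) * (deriv ^^ (m x - 1 - j)) (hermite_factor a m P N x) (of_real x) / fact (m x - 1))
        * dsech a j (x - real_of_int l))"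
    unfolding sum_divide_distrib
    by (intro sum.cong) (auto simp: n dsech_translate[OF a])
  finally show ?thesis .
qed

text \<open>In one period the possible poles are the nodes and the single pole \<open>p\<close> of
  the shifted sech, so the residues at the nodes add up to minus the residue at
  \<open>p\<close>.\<close>

lemma sum_residues_kern:
  fixes l :: int
  assumes a: "a > 0" and P: "finite P"
    and dec: "\<And>z. \<bar>Re z\<bar> \<ge> X \<Longrightarrow> norm (kern a m P N z) \<le> C * exp (- \<bar>Re z\<bar>)"
  shows "(\<Sum>x\<in>P. residue (\<lambda>z. csech a (z - of_int l) * kern a m P N z) (of_real x))
    = \<i> / of_real a * kern a m P N (of_int l + Complex 0 (pi / (2 * a)))"
proof -
  define p where "p = of_int l + Complex 0 (pi / (2 * a))"
  define H where "H z = csech a (z - of_int l) * kern a m P N z" for z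
  define pts where "pts = insert p (of_real ` P)"
  have pP: "p \<notin> of_real ` P" using a by (auto simp: p_def complex_eq_iff)
  have "(\<Sum>q\<in>pts. residue H q) = 0"
  proof (rule sum_residues_periodic[of "pi / a"])
    show "pi / a > 0" using a by simp
    show "finite pts" using P by (simp add: pts_def)
    show "H holomorphic_on {z. - (pi / a) / 2 < Im z \<and> Im z < pi / a} - pts"
    proof -
      have nz: "phi a (side x) (z - of_real x) \<noteq> 0"
        if "z \<in> {z. - (pi / a) / 2 < Im z \<and> Im z < pi / a} - pts" "x \<in> P" for x z
      proof
        assume "phi a (side x) (z - of_real x) = 0"
        moreover have "- (pi / a) < - (pi / a) / 2" using a by (simp add: field_simps)
        then have "\<bar>Im (z - of_real x)\<bar> < pi / a" using that by auto
        ultimately have "z - of_real x = 0" using phi_eq_0_imp[OF a abs_side] by blast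
        then show False using that by (auto simp: pts_def)
      qed
      have nzp: "phi a 1 (z - of_int l - Complex 0 (pi / (2 * a))) \<noteq> 0"
        if "z \<in> {z. - (pi / a) / 2 < Im z \<and> Im z < pi / a} - pts" for z
      proof
        assume "phi a 1 (z - of_int l - Complex 0 (pi / (2 * a))) = 0"
        moreover have "\<bar>Im (z - of_int l - Complex 0 (pi / (2 * a)))\<bar> < pi / a"
          using that a by (auto simp: abs_less_iff field_simps)
        ultimately have "z - of_int l - Complex 0 (pi / (2 * a)) = 0" using phi_eq_0_imp[OF a abs_one] by blast
        then have "z = p" by (simp add: p_def algebra_simps)
        then show False using that by (simp add: pts_def)
      qed
      show ?thesis unfolding H_def[abs_def] csech_phi[OF a] kern_def
        using nz nzp P by (intro holomorphic_intros) auto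
    qed
    show "- (pi / a) / 4 < Im q \<and> Im q < 3 * (pi / a) / 4" if "q \<in> pts" for q
      using that a by (auto simp: pts_def p_def field_simps)
    show "H (z + Complex 0 (pi / a)) = H z" for z
    proof -
      have "csech a (z + Complex 0 (pi / a) - of_int l) = - csech a (z - of_int l)"
        using exp_i_pi_shift[OF a, of "z - of_int l"]
          phi_periodic[OF a, of 1 "z - of_int l - Complex 0 (pi / (2 * a))"]
        by (simp add: csech_phi[OF a] algebra_simps)
      then show ?thesis by (simp add: H_def kern_periodic[OF a])
    qed
    \<comment> \<open>For \<open>|Re u| \<ge> 1\<close> the modulus of
      \<open>exp u + exp (- u)\<close> is at least \<open>exp |Re u| - exp (- |Re u|)\<close>, hence
      at least 1. So sech is at most 2 there, and the decay of the kernel carries over to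
      \<open>H\<close>.\<close>
    show "norm (H z) \<le> 2 * C * exp (- \<bar>Re z\<bar>)" if "\<bar>Re z\<bar> \<ge> max X (\<bar>real_of_int l\<bar> + 1 / a)" for z
    proof -
      define u where "u = of_real a * (z - of_int l)"
      have "1 / a \<le> \<bar>Re z - real_of_int l\<bar>" using that by auto
      moreover have "\<bar>Re u\<bar> = a * \<bar>Re z - real_of_int l\<bar>"
        using a by (simp add: u_def abs_mult flip: right_diff_distrib)
      ultimately have u1: "\<bar>Re u\<bar> \<ge> 1" using a by (simp add: field_simps)
      have "1 \<le> exp \<bar>Re u\<bar> - exp (- \<bar>Re u\<bar>)"
      proof -
        have "exp (- \<bar>Re u\<bar>) \<le> 1" by simp
        then show ?thesis using u1 exp_ge_add_one_self[of "\<bar>Re u\<bar>"] by linarith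
      qed
      also have "\<dots> \<le> norm (exp u + exp (- u))"
        using norm_diff_ineq[of "exp u" "exp (- u)"] norm_diff_ineq[of "exp (- u)" "exp u"]
        by (cases "Re u \<ge> 0") (auto simp: add.commute)
      also have "\<dots> = 2 * norm (cosh u)" by (simp add: cosh_field_def norm_divide)
      finally have "norm (csech a (z - of_int l)) \<le> 2"
        by (simp add: csech_def u_def[symmetric] norm_divide divide_le_eq)
      moreover have "norm (kern a m P N z) \<le> C * exp (- \<bar>Re z\<bar>)" using dec that by simp
      ultimately have "norm (csech a (z - of_int l)) * norm (kern a m P N z) \<le> 2 * (C * exp (- \<bar>Re z\<bar>))"
        by (intro mult_mono) auto
      then show ?thesis by (simp add: H_def norm_mult)
    qed
  qed
  moreover have "(\<Sum>q\<in>pts. residue H q) = residue H p + (\<Sum>x\<in>P. residue H (of_real x))"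
    unfolding pts_def using pP P by (subst sum.insert) (auto simp: sum.reindex inj_on_def)
  moreover have "residue H p = - \<i> / of_real a * kern a m P N p"
    unfolding H_def[abs_def] p_def by (rule residue_kern_pole[OF a P])
  ultimately show ?thesis unfolding H_def p_def by (simp add: add_eq_0_iff)
qed

section \<open>Reconstruction of the coefficients\<close>

lemma choose_fact_le: "real (n choose j) * fact (n - j) \<le> fact n"
proof (cases "j \<le> n")
  case True
  have "fact j * fact (n - j) * (n choose j) = (fact n :: nat)" by (rule binomial_fact_lemma[OF True])
  moreover have "fact (n - j) * (n choose j) \<le> fact j * (fact (n - j) * (n choose j))"
    by (simp add: fact_ge_1)
  ultimately have "(n choose j) * fact (n - j) \<le> fact n" by (simp add: mult_ac)
  then have "real ((n choose j) * fact (n - j)) \<le> real (fact n)" by (rule of_nat_mono)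
  then show ?thesis by simp
qed (simp add: binomial_eq_0)

text \<open>Cauchy's inequality on the circle of radius \<open>\<rho>\<close> about
  \<open>x\<close>, whose points are regular for every node: for \<open>x\<close> by the radius, for
  the others by separation. With \<open>m x = n + 1\<close>, removing the pole gains
  \<open>\<rho> ^ (n + 1)\<close> and differentiating \<open>n - j\<close> times loses
  \<open>\<rho> ^ (n - j)\<close>, so a positive power of \<open>\<rho> \<le> 1\<close> remains. The
  factor \<open>exp 1\<close> pays for the distance of \<open>z\<close> from
  \<open>x\<close>.\<close>

lemma hermite_coefficient_bound:
  assumes a: "a > 0" and P: "finite P" "separated_by \<delta> P" and \<delta>: "0 < \<delta>"
    and \<rho>: "0 < \<rho>" "\<rho> \<le> 1" "\<rho> \<le> \<delta> / 2" "\<rho> \<le> pi / (3 * a)" and x: "x \<in> P" "m x \<ge> 1" "j < m x"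
    and K: "\<And>z. (\<forall>l\<in>P. regular_point a (\<delta> / 2) \<rho> (z - of_real l)) \<Longrightarrow> norm (kern a m P N z) \<le> C * exp (- \<bar>Re z\<bar>)"
    and C: "C > 0"
  shows "norm (of_nat ((m x - 1) choose j) * (deriv ^^ (m x - 1 - j)) (hermite_factor a m P N x) (of_real x) / fact (m x - 1))
    \<le> C * exp 1 * exp (- \<bar>x\<bar>)"
proof -
  obtain n where n: "m x = Suc n" using x by (cases "m x") auto
  define G where "G = hermite_factor a m P N x"
  define B where "B = C * exp 1 * exp (- \<bar>x\<bar>) * \<rho> ^ Suc n"
  have sub: "cball (of_real x) \<rho> \<subseteq> {z. \<bar>Im z\<bar> < pi / (2 * a)} - of_real ` (P - {x})"
  proof
    fix z assume z: "z \<in> cball (complex_of_real x) \<rho>"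
    then have "z \<in> cball (of_real x) (pi / (3 * a))" using \<rho> by auto
    then have "\<bar>Im z\<bar> < pi / (2 * a)" using cball_subset_strip[OF a] by blast
    moreover have "z \<notin> of_real ` (P - {x})"
    proof
      assume "z \<in> of_real ` (P - {x})"
      then obtain y where y: "y \<in> P" "y \<noteq> x" "z = of_real y" by auto
      then have "\<delta> \<le> \<bar>x - y\<bar>" using separated_byD[OF P(2) x(1) y(1)] by simp
      moreover have "\<bar>x - y\<bar> \<le> \<rho>" using z y by (simp add: dist_norm flip: of_real_diff)
      ultimately show False using \<rho> \<delta> by simp
    qed
    ultimately show "z \<in> {z. \<bar>Im z\<bar> < pi / (2 * a)} - of_real ` (P - {x})" by simp
  qed
  have hol: "G holomorphic_on cball (of_real x) \<rho>"
    unfolding G_def by (rule holomorphic_on_subset[OF hermite_factor_holomorphic[OF a P(1)] sub])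
  have B: "norm (G z) \<le> B" if z: "norm (of_real x - z) = \<rho>" for z
  proof -
    have z': "norm (z - of_real x) = \<rho>" using z by (simp add: norm_minus_commute)
    have re: "\<bar>Re z - x\<bar> \<le> \<rho>" using abs_Re_le_cmod[of "z - of_real x"] z' by simp
    have "\<forall>l\<in>P. regular_point a (\<delta> / 2) \<rho> (z - of_real l)"
    proof
      fix l assume l: "l \<in> P"
      show "regular_point a (\<delta> / 2) \<rho> (z - of_real l)"
      proof (cases "l = x")
        case True then show ?thesis using z' by (simp add: regular_point_def)
      next
        case False
        then have "\<delta> \<le> \<bar>l - x\<bar>" by (rule separated_byD[OF P(2) l x(1)])
        then have "\<delta> / 2 \<le> \<bar>Re z - l\<bar>" using re \<rho> by linarith
        then show ?thesis by (simp add: regular_point_def)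
      qed
    qed
    then have "norm (kern a m P N z) \<le> C * exp (- \<bar>Re z\<bar>)" by (rule K)
    also have "\<dots> \<le> C * exp (1 + - \<bar>x\<bar>)" using re \<rho> C by simp
    also have "\<dots> = C * exp 1 * exp (- \<bar>x\<bar>)" unfolding exp_add by simp
    finally have k: "norm (kern a m P N z) \<le> C * exp 1 * exp (- \<bar>x\<bar>)" .
    have "z \<noteq> of_real x" using z' \<rho> by auto
    then have "G z = kern a m P N z * (z - of_real x) ^ Suc n"
      by (simp add: kern_hermite_factor[OF P(1) x(1)] n G_def)
    then have "norm (G z) = norm (kern a m P N z) * \<rho> ^ Suc n"
      using z' by (simp add: norm_mult norm_power)
    also have "\<dots> \<le> B" unfolding B_def using k \<rho> by (intro mult_right_mono) auto
    finally show ?thesis .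
  qed
  have d: "norm ((deriv ^^ (n - j)) G (of_real x)) \<le> fact (n - j) * B / \<rho> ^ (n - j)"
    by (rule Cauchy_inequality)
       (use hol \<rho> B in \<open>auto intro: holomorphic_on_imp_continuous_on elim: holomorphic_on_subset\<close>)
  have jn: "j \<le> n" using x n by simp
  have "norm (of_nat (n choose j) * (deriv ^^ (n - j)) G (of_real x) / fact n)
      = real (n choose j) * norm ((deriv ^^ (n - j)) G (of_real x)) / fact n"
    by (simp add: norm_mult norm_divide)
  also have "\<dots> \<le> real (n choose j) * (fact (n - j) * B / \<rho> ^ (n - j)) / fact n"
    using d by (intro divide_right_mono mult_left_mono) auto
  also have "\<dots> = (real (n choose j) * fact (n - j)) / fact n * (B / \<rho> ^ (n - j))"
    by (simp add: mult_ac)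
  also have "\<dots> \<le> 1 * (B / \<rho> ^ (n - j))"
    using choose_fact_le[of n j] C \<rho> by (intro mult_right_mono) (auto simp: B_def)
  also have "\<dots> = C * exp 1 * exp (- \<bar>x\<bar>) * \<rho> ^ Suc j"
  proof -
    have "\<rho> ^ Suc n = \<rho> ^ Suc j * \<rho> ^ (n - j)" using jn by (simp flip: power_add)
    then show ?thesis using \<rho> by (simp add: B_def)
  qed
  also have "\<dots> \<le> C * exp 1 * exp (- \<bar>x\<bar>) * 1"
    using \<rho> C by (intro mult_left_mono power_le_one) auto
  finally show ?thesis by (simp add: n G_def)
qed

lemma kern_at_pole_eq_0:
  fixes l :: int
  assumes a: "a > 0" and l: "l \<noteq> 0" "\<bar>l\<bar> \<le> int N"
  shows "kern a m P N (of_int l + Complex 0 (pi / (2 * a))) = 0"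
proof -
  have "l \<in> {- int N..int N} - {0}" using l by auto
  moreover have "phi a (side (real_of_int l)) (of_int l + Complex 0 (pi / (2 * a)) - of_int l - Complex 0 (pi / (2 * a))) = 0"
    by (simp add: phi_def)
  ultimately have "\<exists>k\<in>{- int N..int N} - {0}. phi a (side (real_of_int k))
      (of_int l + Complex 0 (pi / (2 * a)) - of_int k - Complex 0 (pi / (2 * a))) = 0"
    by (rule bexI[rotated])
  then have "(\<Prod>k\<in>{- int N..int N} - {0}. phi a (side (real_of_int k))
      (of_int l + Complex 0 (pi / (2 * a)) - of_int k - Complex 0 (pi / (2 * a)))) = 0"
    by (intro prod_zero) simp_all
  then show ?thesis unfolding kern_def by simp
qed

text \<open>The residue identity divided by its value for \<open>l = 0\<close>, so that
  \<open>r l\<close> is a quotient of kernel values at two poles. It vanishes for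
  \<open>0 < |l| \<le> J * L\<close>; beyond this range the decay \<open>exp (- |l|)\<close> is
  split into two halves, one small in terms of \<open>J\<close>, the other still summable in
  \<open>l\<close>.\<close>

lemma dual_functional_at_0:
  fixes a \<delta> :: real and M L :: nat
  assumes a: "a > 0" and \<delta>: "0 < \<delta>" "\<delta> \<le> 1"
  obtains C J0 where "C > 0"
    "\<And>P m J. finite P \<Longrightarrow> separated_by \<delta> P \<Longrightarrow> (\<forall>l\<in>P. 1 \<le> m l \<and> m l \<le> M) \<Longrightarrow>
       P \<subseteq> {- real (J * L)..real (J * L)} \<Longrightarrow> dense_blocks L J P m \<Longrightarrow> J0 \<le> J \<Longrightarrow>
       \<exists>\<kappa> r. (\<forall>x\<in>P. \<forall>j<m x. norm (\<kappa> x j) \<le> C * exp (- \<bar>x\<bar>)) \<and>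
         (\<forall>l. (\<Sum>x\<in>P. \<Sum>j<m x. \<kappa> x j * dsech a j (x - real_of_int l)) = r l) \<and> r 0 = 1 \<and>
         (\<forall>l. l \<noteq> 0 \<longrightarrow> norm (r l) \<le> C * exp (- real (J * L) / 2) * exp (- \<bar>real_of_int l\<bar> / 2))"
proof -
  define \<rho> where "\<rho> = min (\<delta> / 2) (pi / (3 * a))"
  have \<rho>: "0 < \<rho>" "\<rho> \<le> 1" "\<rho> \<le> \<delta> / 2" "\<rho> \<le> pi / (3 * a)" using a \<delta> by (auto simp: \<rho>_def)
  have "\<rho> < pi / a"
  proof -
    have "pi / (3 * a) < pi / a" using a by (simp add: field_simps)
    then show ?thesis using \<rho> by linarith
  qed
  then obtain C J0 where C: "C > 0" and up:
    "\<And>P m J z. finite P \<Longrightarrow> separated_by \<delta> P \<Longrightarrow> (\<forall>l\<in>P. m l \<le> M) \<Longrightarrow> dense_blocks L J P m \<Longrightarrow> J0 \<le> J \<Longrightarrow>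
       (\<forall>l\<in>P. regular_point a (\<delta> / 2) \<rho> (z - of_real l)) \<Longrightarrow> norm (kern a m P (J * L) z) \<le> C * exp (- \<bar>Re z\<bar>)"
    and low: "\<And>P m J. finite P \<Longrightarrow> separated_by \<delta> P \<Longrightarrow> (\<forall>l\<in>P. m l \<le> M) \<Longrightarrow>
       1 / C \<le> norm (kern a m P (J * L) (Complex 0 (pi / (2 * a))))"
    using kern_bounds[OF a \<delta> \<rho>(1), where M = M and L = L] by metis
  \<comment> \<open>The first entry bounds the coefficients of the samples, the second the remainder
    \<open>r\<close>; in each, one \<open>C\<close> comes from the upper bound on the kernel and one
    from the lower bound on \<open>k (p 0)\<close>.\<close>
  define D where "D = max (a * C * (C * exp 1)) (C * C)"
  show thesis
  proof (rule that[of D J0])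
    show "D > 0" using C by (simp add: D_def less_max_iff_disj)
    fix P m J
    assume P: "finite P" "separated_by \<delta> P" and m: "\<forall>l\<in>P. 1 \<le> m l \<and> m l \<le> M"
      and sub: "P \<subseteq> {- real (J * L)..real (J * L)}" and blk: "dense_blocks L J P m" and J: "J0 \<le> J"
    define k where "k = kern a m P (J * L)"
    define p where "p l = of_int l + Complex 0 (pi / (2 * a))" for l
    define A where "A x j = of_nat ((m x - 1) choose j) * (deriv ^^ (m x - 1 - j)) (hermite_factor a m P (J * L) x) (of_real x) / fact (m x - 1)" for x j
    have up': "norm (k z) \<le> C * exp (- \<bar>Re z\<bar>)" if "\<forall>l\<in>P. regular_point a (\<delta> / 2) \<rho> (z - of_real l)" for z
      unfolding k_def using m by (intro up P blk J that) auto
    have k0: "1 / C \<le> norm (k (p 0))" unfolding k_def p_def using low[OF P, of m J] m by simp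
    have k0': "k (p 0) \<noteq> 0"
    proof
      assume "k (p 0) = 0"
      then have "1 / C \<le> 0" using k0 by simp
      then show False using C by simp
    qed
    have inv_le: "1 / norm (k (p 0)) \<le> C" using k0 k0' C by (simp add: field_simps)
    have id: "(\<Sum>x\<in>P. \<Sum>j<m x. A x j * dsech a j (x - real_of_int l)) = \<i> / of_real a * k (p l)" for l
    proof -
      have "(\<Sum>x\<in>P. \<Sum>j<m x. A x j * dsech a j (x - real_of_int l))
          = (\<Sum>x\<in>P. residue (\<lambda>z. csech a (z - of_int l) * kern a m P (J * L) z) (of_real x))"
        unfolding A_def using m by (intro sum.cong refl residue_kern_node[symmetric] a P) auto
      also have "\<dots> = \<i> / of_real a * k (p l)"
        unfolding k_def p_def
      proof (rule sum_residues_kern[OF a P(1)])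
        \<comment> \<open>The nodes lie within \<open>J * L\<close> of 0, so from one unit further
          out every point is regular.\<close>
        fix z assume z: "\<bar>Re z\<bar> \<ge> real (J * L) + 1"
        have "regular_point a (\<delta> / 2) \<rho> (z - of_real l)" if "l \<in> P" for l
        proof -
          have "\<bar>l\<bar> \<le> real (J * L)" using sub that by (auto simp: abs_le_iff simp del: of_nat_mult)
          then have "1 \<le> \<bar>Re z - l\<bar>" using z by linarith
          then show ?thesis using \<delta> by (simp add: regular_point_def)
        qed
        then show "norm (kern a m P (J * L) z) \<le> C * exp (- \<bar>Re z\<bar>)" using up' unfolding k_def by blast
      qed
      finally show ?thesis .
    qed
    define \<kappa> where "\<kappa> x j = A x j * (of_real a / (\<i> * k (p 0)))" for x j
    define r where "r l = k (p l) / k (p 0)" for l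
    have "norm (\<kappa> x j) \<le> D * exp (- \<bar>x\<bar>)" if "x \<in> P" "j < m x" for x j
    proof -
      have "norm (A x j) \<le> C * exp 1 * exp (- \<bar>x\<bar>)" unfolding A_def
        using m that up' C unfolding k_def
        by (intro hermite_coefficient_bound[where \<rho> = \<rho> and \<delta> = \<delta>] a P \<delta> \<rho>) auto
      then have "norm (A x j) * (a * (1 / norm (k (p 0)))) \<le> (C * exp 1 * exp (- \<bar>x\<bar>)) * (a * C)"
        using inv_le a C by (intro mult_mono mult_left_mono) auto
      also have "\<dots> \<le> D * exp (- \<bar>x\<bar>)"
      proof -
        have "a * C * (C * exp 1) * exp (- \<bar>x\<bar>) \<le> D * exp (- \<bar>x\<bar>)"
          by (intro mult_right_mono) (auto simp: D_def)
        then show ?thesis by (simp add: mult_ac)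
      qed
      finally show ?thesis using a by (simp add: \<kappa>_def norm_mult norm_divide)
    qed
    moreover have "(\<Sum>x\<in>P. \<Sum>j<m x. \<kappa> x j * dsech a j (x - real_of_int l)) = r l" for l
    proof -
      have "(\<Sum>x\<in>P. \<Sum>j<m x. \<kappa> x j * dsech a j (x - real_of_int l))
          = (of_real a / (\<i> * k (p 0))) * (\<Sum>x\<in>P. \<Sum>j<m x. A x j * dsech a j (x - real_of_int l))"
        unfolding sum_distrib_left \<kappa>_def by (intro sum.cong refl) (simp add: mult_ac)
      also have "\<dots> = r l" unfolding id r_def using a k0' by (simp add: field_simps)
      finally show ?thesis .
    qed
    moreover have "r 0 = 1" using k0' by (simp add: r_def)
    moreover have "norm (r l) \<le> D * exp (- real (J * L) / 2) * exp (- \<bar>real_of_int l\<bar> / 2)" if "l \<noteq> 0" for l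
    proof (cases "\<bar>l\<bar> \<le> int (J * L)")
      case True
      then have "r l = 0" using kern_at_pole_eq_0[OF a that] by (simp add: r_def k_def p_def)
      moreover have "D \<ge> 0" using C by (simp add: D_def le_max_iff_disj)
      ultimately show ?thesis by simp
    next
      case False
      then have l: "real (J * L) \<le> \<bar>real_of_int l\<bar>" by linarith
      have "norm (k (p l)) \<le> C * exp (- \<bar>Re (p l)\<bar>)"
        by (rule up') (auto simp: regular_point_def p_def)
      then have "norm (k (p l)) * (1 / norm (k (p 0))) \<le> (C * exp (- \<bar>real_of_int l\<bar>)) * C"
        using inv_le C by (intro mult_mono) (auto simp: p_def)
      also have "\<dots> = C * C * exp (- \<bar>real_of_int l\<bar>)" by simp
      also have "\<dots> \<le> D * exp (- real (J * L) / 2 + - \<bar>real_of_int l\<bar> / 2)"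
        using C l by (intro mult_mono) (auto simp: D_def le_max_iff_disj simp del: of_nat_mult)
      finally show ?thesis unfolding exp_add by (simp add: r_def norm_divide)
    qed
    ultimately show "\<exists>\<kappa> r. (\<forall>x\<in>P. \<forall>j<m x. norm (\<kappa> x j) \<le> D * exp (- \<bar>x\<bar>)) \<and>
         (\<forall>l. (\<Sum>x\<in>P. \<Sum>j<m x. \<kappa> x j * dsech a j (x - real_of_int l)) = r l) \<and> r 0 = 1 \<and>
         (\<forall>l. l \<noteq> 0 \<longrightarrow> norm (r l) \<le> D * exp (- real (J * L) / 2) * exp (- \<bar>real_of_int l\<bar> / 2))"
      by blast
  qed
qed

text \<open>Closed windows of length \<open>L - 1\<close> fit into the half-open blocks of length
  \<open>L\<close>, and the weight \<open>L + 1\<close> exceeds by one the number of integers in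
  such a block.\<close>

definition uniformly_dense :: "nat \<Rightarrow> real set \<Rightarrow> (real \<Rightarrow> nat) \<Rightarrow> bool" where
  "uniformly_dense L A m \<longleftrightarrow> (\<forall>y. real L + 1 \<le> (\<Sum>l\<in>A \<inter> {y..y + real L - 1}. real (m l)))"

text \<open>Translation of the case \<open>k = 0\<close>: an integer shift permutes the shifts of
  sech and moves only the nodes, while separation and uniform density are translation invariant, so
  the constants stay the same.\<close>

lemma dual_functional:
  fixes a \<delta> :: real and M L :: nat
  assumes a: "a > 0" and \<delta>: "0 < \<delta>" "\<delta> \<le> 1"
  obtains C J0 where "C > 0"
    "\<And>A m k J. separated_by \<delta> A \<Longrightarrow> (\<forall>l\<in>A. 1 \<le> m l \<and> m l \<le> M) \<Longrightarrow> uniformly_dense L A m \<Longrightarrow> J0 \<le> J \<Longrightarrow>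
       \<exists>P \<kappa> r. finite P \<and> P \<subseteq> A \<and> (\<forall>x\<in>P. \<forall>j<m x. norm (\<kappa> x j) \<le> C * exp (- \<bar>real_of_int k - x\<bar>)) \<and>
         (\<forall>l. (\<Sum>x\<in>P. \<Sum>j<m x. \<kappa> x j * dsech a j (x - real_of_int l)) = r l) \<and> r k = 1 \<and>
         (\<forall>l. l \<noteq> k \<longrightarrow> norm (r l) \<le> C * exp (- real (J * L) / 2) * exp (- (1 / 2) * \<bar>real_of_int k - real_of_int l\<bar>))"
proof (rule dual_functional_at_0[OF a \<delta>, where M = M and L = L])
  fix C :: real and J0 :: nat
  assume C: "C > 0" and dual:
    "\<And>P m J. finite P \<Longrightarrow> separated_by \<delta> P \<Longrightarrow> (\<forall>l\<in>P. 1 \<le> m l \<and> m l \<le> M) \<Longrightarrow>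
       P \<subseteq> {- real (J * L)..real (J * L)} \<Longrightarrow> dense_blocks L J P m \<Longrightarrow> J0 \<le> J \<Longrightarrow>
       \<exists>\<kappa> r. (\<forall>x\<in>P. \<forall>j<m x. norm (\<kappa> x j) \<le> C * exp (- \<bar>x\<bar>)) \<and>
         (\<forall>l. (\<Sum>x\<in>P. \<Sum>j<m x. \<kappa> x j * dsech a j (x - real_of_int l)) = r l) \<and> r 0 = 1 \<and>
         (\<forall>l. l \<noteq> 0 \<longrightarrow> norm (r l) \<le> C * exp (- real (J * L) / 2) * exp (- \<bar>real_of_int l\<bar> / 2))"
  show thesis
  proof (rule that[OF C])
    fix A m J and k :: int
    assume A: "separated_by \<delta> A" "\<forall>l\<in>A. 1 \<le> m l \<and> m l \<le> M" and dense: "uniformly_dense L A m" and J: "J0 \<le> J"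
    define t where "t = real_of_int k"
    define R where "R = real (J * L)"
    define P where "P = A \<inter> {t - R..t + R}"
    define Q where "Q = (\<lambda>x. x - t) ` P"
    define n where "n x = m (x + t)" for x
    have P: "finite P" "separated_by \<delta> P"
      using finite_separated_Int_Icc[OF \<delta>(1) A(1)] separated_by_subset[OF A(1)] by (auto simp: P_def)
    have Q: "finite Q" "separated_by \<delta> Q" using P unfolding Q_def separated_by_def by auto
    have blk: "real L + 1 \<le> (\<Sum>x\<in>Q \<inter> D. real (n x))"
      if D: "{y - t..y - t + real L - 1} \<subseteq> D" "D \<subseteq> {- R..R}" for y D
    proof -
      have "real L + 1 \<le> (\<Sum>l\<in>A \<inter> {y..y + real L - 1}. real (m l))"
        using dense unfolding uniformly_dense_def by blast
      also have "\<dots> \<le> (\<Sum>l\<in>P \<inter> (\<lambda>x. x + t) ` D. real (m l))"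
      proof (rule sum_mono2)
        show "A \<inter> {y..y + real L - 1} \<subseteq> P \<inter> (\<lambda>x. x + t) ` D"
        proof
          fix l assume l: "l \<in> A \<inter> {y..y + real L - 1}"
          then have "l - t \<in> D" using D(1) by (auto simp: subset_iff)
          moreover from this have "l - t \<in> {- R..R}" using D(2) by blast
          ultimately show "l \<in> P \<inter> (\<lambda>x. x + t) ` D"
            using l by (auto simp: P_def intro!: image_eqI[of _ _ "l - t"])
        qed
      qed (use P in auto)
      also have "\<dots> = (\<Sum>x\<in>Q \<inter> D. real (n x))"
        by (rule sum.reindex_bij_witness[of _ "\<lambda>x. x + t" "\<lambda>x. x - t"]) (auto simp: Q_def n_def)
      finally show ?thesis .
    qed
    have "dense_blocks L J Q n"
      unfolding dense_blocks_def
    proof (intro allI impI conjI)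
      fix j assume j: "j < J"
      have "(j + 1) * L \<le> J * L" using j by (intro mult_right_mono) auto
      then have R: "real ((j + 1) * L) \<le> R" unfolding R_def by (rule of_nat_mono)
      have s: "real ((j + 1) * L) = real (j * L) + real L" by (simp add: algebra_simps)
      have nn: "0 \<le> real (j * L)" "0 \<le> real L" by simp_all
      show "real L + 1 \<le> (\<Sum>l\<in>Q \<inter> {real (j * L)<..real ((j + 1) * L)}. real (n l))"
        \<comment> \<open>The window starts one unit after the excluded left end
          \<open>j * L\<close>; in the mirrored block below it stops one unit before the excluded
          right end.\<close>
        by (rule blk[of "t + real (j * L) + 1"]) (use R s nn in \<open>auto simp del: of_nat_mult\<close>)
      show "real L + 1 \<le> (\<Sum>l\<in>Q \<inter> {- real ((j + 1) * L)..<- real (j * L)}. real (n l))"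
        by (rule blk[of "t - real ((j + 1) * L)"]) (use R s nn in \<open>auto simp del: of_nat_mult\<close>)
    qed
    moreover have "\<forall>l\<in>Q. 1 \<le> n l \<and> n l \<le> M" using A by (auto simp: Q_def P_def n_def)
    moreover have "Q \<subseteq> {- real (J * L)..real (J * L)}" by (auto simp: Q_def P_def R_def)
    ultimately have "\<exists>\<kappa> r. (\<forall>x\<in>Q. \<forall>j<n x. norm (\<kappa> x j) \<le> C * exp (- \<bar>x\<bar>)) \<and>
         (\<forall>l. (\<Sum>x\<in>Q. \<Sum>j<n x. \<kappa> x j * dsech a j (x - real_of_int l)) = r l) \<and> r 0 = 1 \<and>
         (\<forall>l. l \<noteq> 0 \<longrightarrow> norm (r l) \<le> C * exp (- real (J * L) / 2) * exp (- \<bar>real_of_int l\<bar> / 2))"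
      by (intro dual Q J)
    then obtain \<kappa> r where
      1: "\<forall>x\<in>Q. \<forall>j<n x. norm (\<kappa> x j) \<le> C * exp (- \<bar>x\<bar>)" and
      2: "\<forall>l. (\<Sum>x\<in>Q. \<Sum>j<n x. \<kappa> x j * dsech a j (x - real_of_int l)) = r l" and 3: "r 0 = 1" and
      4: "\<forall>l. l \<noteq> 0 \<longrightarrow> norm (r l) \<le> C * exp (- real (J * L) / 2) * exp (- \<bar>real_of_int l\<bar> / 2)"
      by (elim exE conjE) (rule that)
    have "(\<Sum>x\<in>P. \<Sum>j<m x. \<kappa> (x - t) j * dsech a j (x - real_of_int l)) = r (l - k)" for l
    proof -
      have "(\<Sum>x\<in>P. \<Sum>j<m x. \<kappa> (x - t) j * dsech a j (x - real_of_int l))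
          = (\<Sum>x\<in>Q. \<Sum>j<n x. \<kappa> x j * dsech a j (x - real_of_int (l - k)))"
        by (rule sum.reindex_bij_witness[of _ "\<lambda>x. x + t" "\<lambda>x. x - t"]) (auto simp: Q_def n_def t_def)
      then show ?thesis using spec[OF 2, of "l - k"] by simp
    qed
    moreover have "\<forall>x\<in>P. \<forall>j<m x. norm (\<kappa> (x - t) j) \<le> C * exp (- \<bar>real_of_int k - x\<bar>)"
    proof (intro ballI allI impI)
      fix x j assume "x \<in> P" "j < m x"
      then show "norm (\<kappa> (x - t) j) \<le> C * exp (- \<bar>real_of_int k - x\<bar>)"
        using bspec[OF 1, of "x - t"] by (simp add: Q_def n_def t_def abs_minus_commute)
    qed
    moreover have "\<forall>l. l \<noteq> k \<longrightarrow> norm (r (l - k)) \<le> C * exp (- real (J * L) / 2) * exp (- (1 / 2) * \<bar>real_of_int k - real_of_int l\<bar>)"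
    proof (intro allI impI)
      fix l assume "l \<noteq> k"
      then show "norm (r (l - k)) \<le> C * exp (- real (J * L) / 2) * exp (- (1 / 2) * \<bar>real_of_int k - real_of_int l\<bar>)"
        using spec[OF 4, of "l - k"] by (simp add: abs_minus_commute)
    qed
    ultimately show "\<exists>P \<kappa> r. finite P \<and> P \<subseteq> A \<and> (\<forall>x\<in>P. \<forall>j<m x. norm (\<kappa> x j) \<le> C * exp (- \<bar>real_of_int k - x\<bar>)) \<and>
         (\<forall>l. (\<Sum>x\<in>P. \<Sum>j<m x. \<kappa> x j * dsech a j (x - real_of_int l)) = r l) \<and> r k = 1 \<and>
         (\<forall>l. l \<noteq> k \<longrightarrow> norm (r l) \<le> C * exp (- real (J * L) / 2) * exp (- (1 / 2) * \<bar>real_of_int k - real_of_int l\<bar>))"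
      using P 3
      by (intro exI[of _ P] exI[of _ "\<lambda>x. \<kappa> (x - t)"] exI[of _ "\<lambda>l. r (l - k)"]) (auto simp: P_def)
  qed
qed

lemma has_sum_sum:
  fixes f :: "'i \<Rightarrow> 'a \<Rightarrow> 'b :: {topological_comm_monoid_add, comm_monoid_add}"
  assumes "\<And>i. i \<in> I \<Longrightarrow> (f i has_sum s i) A"
  shows "((\<lambda>x. \<Sum>i\<in>I. f i x) has_sum (\<Sum>i\<in>I. s i)) A"
  using assms by (induction I rule: infinite_finite_induct) (auto intro!: has_sum_add)

lemma hderiv_bounded:
  assumes a: "a > 0"
  obtains C where "C > 0"
    "\<And>c f B j x. (\<And>l. norm (c l) \<le> B) \<Longrightarrow> generated_by (sech_a a) c f \<Longrightarrow> j < M \<Longrightarrow> norm (hderiv j f x) \<le> C * B"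
proof -
  obtain D where D: "D > 0" "\<And>j x. j < M \<Longrightarrow> norm (dsech a j x) \<le> D * exp (- a * \<bar>x\<bar>)"
    using dsech_bounded[OF a] by blast
  obtain E where E: "E > 0" "\<And>F x. finite F \<Longrightarrow> (\<Sum>l\<in>F. exp (- a * \<bar>x - real_of_int l\<bar>)) \<le> E"
    using int_exp_sum_bounded[OF a] by blast
  show thesis
  proof (rule that[of "D * E"])
    show "D * E > 0" using D E by simp
    fix c :: "int \<Rightarrow> complex" and f B j x
    assume c: "\<And>l. norm (c l) \<le> B" and f: "generated_by (sech_a a) c f" and j: "j < M"
    have B: "B \<ge> 0" using c[of 0] norm_ge_zero order_trans by blast
    have "bounded (range c)" using c by (auto simp: bounded_iff)
    then have hs: "((\<lambda>l. c l * dsech a j (x - real_of_int l)) has_sum hderiv j f x) UNIV"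
      by (rule hderiv_has_sum[OF a _ f])
    have "norm (hderiv j f x) \<le> (\<Sum>\<^sub>\<infinity>l. B * D * exp (- a * \<bar>x - real_of_int l\<bar>))"
    proof (rule norm_infsum_le[OF hs])
      show "((\<lambda>l. B * D * exp (- a * \<bar>x - real_of_int l\<bar>)) has_sum (\<Sum>\<^sub>\<infinity>l. B * D * exp (- a * \<bar>x - real_of_int l\<bar>))) UNIV"
        by (intro has_sum_infsum summable_on_cmult_right int_exp_summable a)
      show "norm (c l * dsech a j (x - real_of_int l)) \<le> B * D * exp (- a * \<bar>x - real_of_int l\<bar>)" for l
        using mult_mono[OF c[of l] D(2)[OF j, of "x - real_of_int l"] B] by (simp add: norm_mult mult.assoc)
    qed
    also have "\<dots> = B * D * (\<Sum>\<^sub>\<infinity>l. exp (- a * \<bar>x - real_of_int l\<bar>))"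
      by (rule infsum_cmult_right') 
    also have "\<dots> \<le> B * D * E"
      using B D E by (intro mult_left_mono infsum_le_finite_sums int_exp_summable a) auto
    finally show "norm (hderiv j f x) \<le> D * E * B" by (simp add: mult_ac)
  qed
qed

lemma separated_exp_summable:
  fixes \<epsilon> \<delta> :: real
  assumes "\<epsilon> > 0" "\<delta> > 0" "separated_by \<delta> A"
  shows "(\<lambda>x. exp (- \<epsilon> * \<bar>y - x\<bar>)) summable_on A"
proof -
  obtain E where "E > 0" and E: "\<And>F x. finite F \<Longrightarrow> separated_by \<delta> F \<Longrightarrow> (\<Sum>l\<in>F. exp (- \<epsilon> * \<bar>x - l\<bar>)) \<le> E"
    using separated_exp_sum_bounded[OF assms(1,2)] by blast
  show ?thesis
  proof (rule nonneg_bdd_above_summable_on)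
    show "bdd_above (sum (\<lambda>x. exp (- \<epsilon> * \<bar>y - x\<bar>)) ` {F. F \<subseteq> A \<and> finite F})"
      by (rule bdd_aboveI2, rule E[OF _ separated_by_subset[OF assms(3)]]) auto
  qed simp
qed

text \<open>Applied to \<open>f\<close>, the functional yields \<open>c k\<close> plus the sum of
  \<open>c l * r l\<close> over \<open>l \<noteq> k\<close>. Boundedness of \<open>c\<close> makes
  this remainder at most a constant times \<open>exp (- real (J * L) / 2)\<close>, which disappears
  as \<open>J\<close> grows while \<open>C\<close> stays fixed. So the final estimate contains no
  bound on \<open>c\<close>.\<close>

lemma coefficient_bound:
  fixes a \<delta> :: real and M L :: nat
  assumes a: "a > 0" and \<delta>: "0 < \<delta>" "\<delta> \<le> 1" and L: "L \<ge> 1"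
  obtains C where "C > 0"
    "\<And>A m c f k. separated_by \<delta> A \<Longrightarrow> (\<forall>l\<in>A. 1 \<le> m l \<and> m l \<le> M) \<Longrightarrow> uniformly_dense L A m \<Longrightarrow>
      bounded (range c) \<Longrightarrow> generated_by (sech_a a) c f \<Longrightarrow>
      (\<lambda>x. exp (- 1 * \<bar>real_of_int k - x\<bar>) * (\<Sum>j<m x. norm (hderiv j f x))) summable_on A \<and>
      norm (c k) \<le> C * (\<Sum>\<^sub>\<infinity>x\<in>A. exp (- 1 * \<bar>real_of_int k - x\<bar>) * (\<Sum>j<m x. norm (hderiv j f x)))"
proof (rule dual_functional[OF a \<delta>, where M = M and L = L], rule hderiv_bounded[OF a, where M = M])
  fix C :: real and J0 :: nat
  assume C: "C > 0" and dual:
    "\<And>A m k J. separated_by \<delta> A \<Longrightarrow> (\<forall>l\<in>A. 1 \<le> m l \<and> m l \<le> M) \<Longrightarrow> uniformly_dense L A m \<Longrightarrow> J0 \<le> J \<Longrightarrow>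
       \<exists>P \<kappa> r. finite P \<and> P \<subseteq> A \<and> (\<forall>x\<in>P. \<forall>j<m x. norm (\<kappa> x j) \<le> C * exp (- \<bar>real_of_int k - x\<bar>)) \<and>
         (\<forall>l. (\<Sum>x\<in>P. \<Sum>j<m x. \<kappa> x j * dsech a j (x - real_of_int l)) = r l) \<and> r k = 1 \<and>
         (\<forall>l. l \<noteq> k \<longrightarrow> norm (r l) \<le> C * exp (- real (J * L) / 2) * exp (- (1 / 2) * \<bar>real_of_int k - real_of_int l\<bar>))"
  fix H :: real
  assume H: "H > 0"
    "\<And>c f B j x. (\<And>l. norm (c l) \<le> B) \<Longrightarrow> generated_by (sech_a a) c f \<Longrightarrow> j < M \<Longrightarrow> norm (hderiv j f x) \<le> H * B"
  show thesis
  proof (rule that[OF C])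
    fix A m c f and k :: int
    assume A: "separated_by \<delta> A" and m: "\<forall>l\<in>A. 1 \<le> m l \<and> m l \<le> M" and dense: "uniformly_dense L A m"
      and c: "bounded (range c)" and f: "generated_by (sech_a a) c f"
    obtain B where B: "\<And>l. norm (c l) \<le> B" using c by (auto simp: bounded_iff)
    have B0: "B \<ge> 0" using B[of 0] norm_ge_zero order_trans by blast
    define Y where "Y x = (\<Sum>j<m x. norm (hderiv j f x))" for x
    define w where "w x = exp (- 1 * \<bar>real_of_int k - x\<bar>)" for x
    have Y0: "Y x \<ge> 0" for x unfolding Y_def by (intro sum_nonneg) auto
    have Yb: "Y x \<le> real M * (H * B)" if "x \<in> A" for x
    proof -
      have "Y x \<le> (\<Sum>j<m x. H * B)" unfolding Y_def
        using m that by (intro sum_mono H(2)[OF B f]) auto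
      also have "\<dots> = real (m x) * (H * B)" by simp
      also have "\<dots> \<le> real M * (H * B)" using m that H B0 by (intro mult_right_mono) auto
      finally show ?thesis .
    qed
    have sm: "(\<lambda>x. w x * Y x) summable_on A"
    proof (rule summable_on_comparison_test)
      show "(\<lambda>x. w x * (real M * (H * B))) summable_on A" unfolding w_def
        by (intro summable_on_cmult_left separated_exp_summable[OF _ \<delta>(1) A]) simp
      show "w x * Y x \<le> w x * (real M * (H * B))" if "x \<in> A" for x
        using Yb[OF that] by (intro mult_left_mono) (auto simp: w_def)
      show "0 \<le> w x * Y x" for x using Y0 by (simp add: w_def)
    qed
    define I where "I = (\<Sum>\<^sub>\<infinity>x\<in>A. w x * Y x)"
    define E where "E = (\<Sum>\<^sub>\<infinity>l. exp (- (1 / 2) * \<bar>real_of_int k - real_of_int l\<bar>))"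
    have E: "((\<lambda>l. exp (- (1 / 2) * \<bar>real_of_int k - real_of_int l\<bar>)) has_sum E) UNIV"
      unfolding E_def by (intro has_sum_infsum int_exp_summable) simp
    have le: "norm (c k) \<le> C * I + B * C * E * exp (- real (J * L) / 2)" if J: "J0 \<le> J" for J
    proof -
      obtain P \<kappa> r where P: "finite P" "P \<subseteq> A"
        and \<kappa>: "\<forall>x\<in>P. \<forall>j<m x. norm (\<kappa> x j) \<le> C * exp (- \<bar>real_of_int k - x\<bar>)"
        and eq: "\<forall>l. (\<Sum>x\<in>P. \<Sum>j<m x. \<kappa> x j * dsech a j (x - real_of_int l)) = r l" and rk: "r k = 1"
        and r: "\<forall>l. l \<noteq> k \<longrightarrow> norm (r l) \<le> C * exp (- real (J * L) / 2) * exp (- (1 / 2) * \<bar>real_of_int k - real_of_int l\<bar>)"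
        using dual[OF A m dense J, of k] by (elim exE conjE) (rule that)
      define V where "V = (\<Sum>x\<in>P. \<Sum>j<m x. \<kappa> x j * hderiv j f x)"
      have "((\<lambda>l. \<Sum>x\<in>P. \<Sum>j<m x. \<kappa> x j * (c l * dsech a j (x - real_of_int l))) has_sum V) UNIV"
        unfolding V_def by (intro has_sum_sum has_sum_cmult_right hderiv_has_sum a c f)
      moreover have "(\<Sum>x\<in>P. \<Sum>j<m x. \<kappa> x j * (c l * dsech a j (x - real_of_int l))) = c l * r l" for l
        unfolding spec[OF eq, symmetric] sum_distrib_left by (intro sum.cong refl) (simp add: mult_ac)
      ultimately have "((\<lambda>l. c l * r l) has_sum V) UNIV" by simp
      \<comment> \<open>Adding \<open>- c k\<close> at the index \<open>k\<close> cancels the main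
        term, since \<open>r k = 1\<close>.\<close>
      moreover have "((\<lambda>l. if l = k then - c k else 0) has_sum - c k) UNIV"
        by (rule has_sum_finite_neutralI[of "{k}"]) auto
      ultimately have "((\<lambda>l. c l * r l + (if l = k then - c k else 0)) has_sum (V + - c k)) UNIV"
        by (rule has_sum_add)
      then have "norm (V + - c k) \<le> B * C * exp (- real (J * L) / 2) * E"
      proof (rule norm_infsum_le)
        show "((\<lambda>l. B * C * exp (- real (J * L) / 2) * exp (- (1 / 2) * \<bar>real_of_int k - real_of_int l\<bar>)) has_sum
          B * C * exp (- real (J * L) / 2) * E) UNIV" by (rule has_sum_cmult_right[OF E])
        show "norm (c l * r l + (if l = k then - c k else 0))
            \<le> B * C * exp (- real (J * L) / 2) * exp (- (1 / 2) * \<bar>real_of_int k - real_of_int l\<bar>)" for l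
        proof (cases "l = k")
          case True then show ?thesis using rk B0 C by simp
        next
          case False
          then show ?thesis using mult_mono[OF B[of l] mp[OF spec[OF r] False] B0] by (simp add: norm_mult mult.assoc)
        qed
      qed
      moreover have "norm V \<le> C * I"
      proof -
        have "norm V \<le> (\<Sum>x\<in>P. \<Sum>j<m x. C * w x * norm (hderiv j f x))"
          unfolding V_def
        proof (intro order_trans[OF norm_sum] sum_mono)
          fix x j assume "x \<in> P" "j \<in> {..<m x}"
          then show "norm (\<kappa> x j * hderiv j f x) \<le> C * w x * norm (hderiv j f x)"
            unfolding norm_mult using \<kappa> by (intro mult_right_mono) (auto simp: w_def)
        qed
        also have "\<dots> = C * (\<Sum>x\<in>P. w x * Y x)"
          unfolding Y_def sum_distrib_left by (intro sum.cong refl) simp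
        also have "\<dots> \<le> C * I" unfolding I_def
          using C P sm Y0 by (intro mult_left_mono finite_sum_le_infsum) (auto simp: w_def)
        finally show ?thesis .
      qed
      moreover have "norm (c k) \<le> norm V + norm (V - c k)"
        using norm_triangle_ineq4[of V "V - c k"] by simp
      ultimately show ?thesis by (simp add: mult_ac)
    qed
    have "norm (c k) \<le> C * I + B * C * E * 0"
    proof (rule tendsto_lowerbound)
      have "filterlim (\<lambda>J. real (J * L)) at_top at_top"
      proof (rule filterlim_at_top_mono[OF filterlim_real_sequentially])
        show "\<forall>\<^sub>F J in at_top. real J \<le> real (J * L)" using L by (intro always_eventually) (auto simp del: of_nat_mult)
      qed
      then have "filterlim (\<lambda>J. real (J * L) * (1 / 2)) at_top at_top"
        by (subst mult.commute, intro filterlim_tendsto_pos_mult_at_top[OF tendsto_const]) auto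
      then have "((\<lambda>J. exp (- (real (J * L) * (1 / 2)))) \<longlongrightarrow> 0) at_top"
        by (intro filterlim_compose[OF exp_at_bot]) (simp only: filterlim_uminus_at_bot minus_minus)
      then show "((\<lambda>J. C * I + B * C * E * exp (- real (J * L) / 2)) \<longlongrightarrow> C * I + B * C * E * 0) at_top"
        by (intro tendsto_intros) (simp del: of_nat_mult)
      show "\<forall>\<^sub>F J in at_top. norm (c k) \<le> C * I + B * C * E * exp (- real (J * L) / 2)"
        using eventually_ge_at_top[of J0] by eventually_elim (rule le)
    qed simp
    then show "(\<lambda>x. exp (- 1 * \<bar>real_of_int k - x\<bar>) * (\<Sum>j<m x. norm (hderiv j f x))) summable_on A \<and>
      norm (c k) \<le> C * (\<Sum>\<^sub>\<infinity>x\<in>A. exp (- 1 * \<bar>real_of_int k - x\<bar>) * (\<Sum>j<m x. norm (hderiv j f x)))"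
      using sm by (simp add: I_def w_def Y_def)
  qed
qed

section \<open>Norm estimates\<close>

lemma lp_seq_bounded:
  assumes "p \<ge> 1" "lp_seq p c"
  shows "bounded (range c)"
proof -
  have sm: "(\<lambda>k. norm (c k) powr p) summable_on UNIV" using assms by (simp add: lp_seq_def)
  define S where "S = (\<Sum>\<^sub>\<infinity>k. norm (c k) powr p)"
  have "norm (c k) \<le> S powr (1 / p)" for k
  proof -
    have "(\<Sum>k\<in>{k}. norm (c k) powr p) \<le> S"
      unfolding S_def by (rule finite_sum_le_infsum[OF sm]) auto
    then have "(norm (c k) powr p) powr (1 / p) \<le> S powr (1 / p)" using assms by (intro powr_mono2) auto
    then show ?thesis using assms by (simp add: powr_powr)
  qed
  then show ?thesis by (auto simp: bounded_iff)
qed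

text \<open>Schur's test for the kernel \<open>exp (- \<epsilon> * |x - l|)\<close>: rows are sums
  over integers, columns sums over a separated set. The rate is left free because the upper sampling
  estimate uses \<open>a\<close> and the necessity argument \<open>a / 2\<close>.\<close>

lemma exp_kernel_schur:
  fixes \<epsilon> \<delta> p :: real
  assumes \<epsilon>: "\<epsilon> > 0" and \<delta>: "\<delta> > 0" and p: "p \<ge> 1"
  obtains B where "B > 0"
    "\<And>A c. separated_by \<delta> A \<Longrightarrow> lp_seq p c \<Longrightarrow>
      (\<lambda>x. (\<Sum>\<^sub>\<infinity>l. exp (- \<epsilon> * \<bar>x - real_of_int l\<bar>) * norm (c l)) powr p) summable_on A \<and>
      (\<Sum>\<^sub>\<infinity>x\<in>A. (\<Sum>\<^sub>\<infinity>l. exp (- \<epsilon> * \<bar>x - real_of_int l\<bar>) * norm (c l)) powr p) \<le> B * (\<Sum>\<^sub>\<infinity>l. norm (c l) powr p)"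
    "\<And>(c :: int \<Rightarrow> complex) x. bounded (range c) \<Longrightarrow> (\<lambda>l. exp (- \<epsilon> * \<bar>x - real_of_int l\<bar>) * norm (c l)) summable_on UNIV"
proof -
  obtain E where E: "E > 0" "\<And>F x. finite F \<Longrightarrow> (\<Sum>l\<in>F. exp (- \<epsilon> * \<bar>x - real_of_int l\<bar>)) \<le> E"
    using int_exp_sum_bounded[OF \<epsilon>] by blast
  obtain E' where E': "E' > 0" "\<And>F x. finite F \<Longrightarrow> separated_by \<delta> F \<Longrightarrow> (\<Sum>l\<in>F. exp (- \<epsilon> * \<bar>x - l\<bar>)) \<le> E'"
    using separated_exp_sum_bounded[OF \<epsilon> \<delta>] by blast
  have sm: "(\<lambda>l. exp (- \<epsilon> * \<bar>x - real_of_int l\<bar>) * norm (c l)) summable_on UNIV"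
    if c: "bounded (range c)" for c :: "int \<Rightarrow> complex" and x
  proof -
    obtain B where B: "\<And>l. norm (c l) \<le> B" using c by (auto simp: bounded_iff)
    show ?thesis
    proof (rule summable_on_comparison_test)
      show "(\<lambda>l. exp (- \<epsilon> * \<bar>x - real_of_int l\<bar>) * B) summable_on UNIV"
        by (intro summable_on_cmult_left int_exp_summable \<epsilon>)
      show "exp (- \<epsilon> * \<bar>x - real_of_int l\<bar>) * norm (c l) \<le> exp (- \<epsilon> * \<bar>x - real_of_int l\<bar>) * B" for l
        using B by (intro mult_left_mono) auto
    qed simp
  qed
  show thesis
  proof (rule that[of "E powr (p - 1) * E'"])
    show "E powr (p - 1) * E' > 0" using E E' by simp
  next
    fix A and c :: "int \<Rightarrow> complex" assume A: "separated_by \<delta> A" and c: "lp_seq p c"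
    have col: "(\<Sum>x\<in>F. exp (- \<epsilon> * \<bar>x - real_of_int l\<bar>)) \<le> E'" if "finite F" "F \<subseteq> A" for F l
      using E'(2)[OF that(1) separated_by_subset[OF A that(2)], of "real_of_int l"] by (simp add: abs_minus_commute)
    note schur = schur_test[where A = A and B = UNIV and g = "\<lambda>x l. exp (- \<epsilon> * \<bar>x - real_of_int l\<bar>)"
        and y = "\<lambda>l. norm (c l)" and E = E and E' = E' and p = p
        and b = "\<lambda>x. \<Sum>\<^sub>\<infinity>l. exp (- \<epsilon> * \<bar>x - real_of_int l\<bar>) * norm (c l)"]
    have cs: "(\<lambda>l. norm (c l) powr p) summable_on UNIV" using c by (simp add: lp_seq_def)
    have hs: "((\<lambda>l. exp (- \<epsilon> * \<bar>x - real_of_int l\<bar>) * norm (c l)) has_sum (\<Sum>\<^sub>\<infinity>l. exp (- \<epsilon> * \<bar>x - real_of_int l\<bar>) * norm (c l))) UNIV" for x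
      by (intro has_sum_infsum sm lp_seq_bounded[OF p c])
    show "(\<lambda>x. (\<Sum>\<^sub>\<infinity>l. exp (- \<epsilon> * \<bar>x - real_of_int l\<bar>) * norm (c l)) powr p) summable_on A \<and>
      (\<Sum>\<^sub>\<infinity>x\<in>A. (\<Sum>\<^sub>\<infinity>l. exp (- \<epsilon> * \<bar>x - real_of_int l\<bar>) * norm (c l)) powr p)
        \<le> E powr (p - 1) * E' * (\<Sum>\<^sub>\<infinity>l. norm (c l) powr p)"
      using E' by (intro conjI schur p E(2) col cs hs) auto
  qed (rule sm)
qed

lemma samples_le_coefficients:
  fixes a \<delta> p :: real and M :: nat
  assumes a: "a > 0" and \<delta>: "\<delta> > 0" and p: "p \<ge> 1"
  obtains B where "B > 0"
    "\<And>A m c f. separated_by \<delta> A \<Longrightarrow> (\<forall>l\<in>A. m l \<le> M) \<Longrightarrow> lp_seq p c \<Longrightarrow> generated_by (sech_a a) c f \<Longrightarrow>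
      (\<lambda>x. \<Sum>j<m x. norm (hderiv j f x) powr p) summable_on A \<and>
      (\<Sum>\<^sub>\<infinity>x\<in>A. \<Sum>j<m x. norm (hderiv j f x) powr p) \<le> B * (\<Sum>\<^sub>\<infinity>l. norm (c l) powr p)"
proof (rule exp_kernel_schur[OF a \<delta> p])
  fix B assume B: "B > 0" and schur:
    "\<And>A c. separated_by \<delta> A \<Longrightarrow> lp_seq p c \<Longrightarrow>
      (\<lambda>x. (\<Sum>\<^sub>\<infinity>l. exp (- a * \<bar>x - real_of_int l\<bar>) * norm (c l)) powr p) summable_on A \<and>
      (\<Sum>\<^sub>\<infinity>x\<in>A. (\<Sum>\<^sub>\<infinity>l. exp (- a * \<bar>x - real_of_int l\<bar>) * norm (c l)) powr p) \<le> B * (\<Sum>\<^sub>\<infinity>l. norm (c l) powr p)"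
    and sm: "\<And>(c :: int \<Rightarrow> complex) x. bounded (range c) \<Longrightarrow> (\<lambda>l. exp (- a * \<bar>x - real_of_int l\<bar>) * norm (c l)) summable_on UNIV"
  obtain D where D: "D > 0" "\<And>j x. j < M \<Longrightarrow> norm (dsech a j x) \<le> D * exp (- a * \<bar>x\<bar>)"
    using dsech_bounded[OF a] by blast
  show thesis
  proof (rule that[of "(real M + 1) * D powr p * B"])
    show "(real M + 1) * D powr p * B > 0" using D B by simp
    fix A m c f
    assume A: "separated_by \<delta> A" and m: "\<forall>l\<in>A. m l \<le> M" and c: "lp_seq p c" and f: "generated_by (sech_a a) c f"
    define b where "b x = (\<Sum>\<^sub>\<infinity>l. exp (- a * \<bar>x - real_of_int l\<bar>) * norm (c l))" for x
    have b0: "b x \<ge> 0" for x unfolding b_def by (intro infsum_nonneg) auto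
    note bd = lp_seq_bounded[OF p c]
    have le: "norm (hderiv j f x) \<le> D * b x" if "j < M" for j x
    proof (rule norm_infsum_le[OF hderiv_has_sum[OF a bd f]])
      show "((\<lambda>l. D * (exp (- a * \<bar>x - real_of_int l\<bar>) * norm (c l))) has_sum D * b x) UNIV"
        unfolding b_def by (intro has_sum_cmult_right has_sum_infsum sm bd)
      show "norm (c l * dsech a j (x - real_of_int l)) \<le> D * (exp (- a * \<bar>x - real_of_int l\<bar>) * norm (c l))" for l
        using mult_left_mono[OF D(2)[OF that, of "x - real_of_int l"] norm_ge_zero[of "c l"]] by (simp add: norm_mult mult_ac)
    qed
    have le': "(\<Sum>j<m x. norm (hderiv j f x) powr p) \<le> (real M + 1) * D powr p * b x powr p" if "x \<in> A" for x
    proof -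
      have "(\<Sum>j<m x. norm (hderiv j f x) powr p) \<le> (\<Sum>j<m x. (D * b x) powr p)"
        using m that p by (intro sum_mono powr_mono2 le) auto
      also have "\<dots> = real (m x) * (D powr p * b x powr p)" using D b0 by (simp add: powr_mult)
      also have "\<dots> \<le> (real M + 1) * (D powr p * b x powr p)" using m that by (intro mult_right_mono) auto
      finally show ?thesis by (simp add: mult_ac)
    qed
    have bs: "(\<lambda>x. b x powr p) summable_on A" "(\<Sum>\<^sub>\<infinity>x\<in>A. b x powr p) \<le> B * (\<Sum>\<^sub>\<infinity>l. norm (c l) powr p)"
      using schur[OF A c] unfolding b_def by blast+
    have bs': "(\<lambda>x. (real M + 1) * D powr p * b x powr p) summable_on A"
      by (intro summable_on_cmult_right bs)
    have s: "(\<lambda>x. \<Sum>j<m x. norm (hderiv j f x) powr p) summable_on A"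
      by (rule summable_on_comparison_test[OF bs' le']) (auto intro: sum_nonneg)
    have "(\<Sum>\<^sub>\<infinity>x\<in>A. \<Sum>j<m x. norm (hderiv j f x) powr p) \<le> (\<Sum>\<^sub>\<infinity>x\<in>A. (real M + 1) * D powr p * b x powr p)"
      by (rule infsum_mono[OF s bs' le'])
    also have "\<dots> = (real M + 1) * D powr p * (\<Sum>\<^sub>\<infinity>x\<in>A. b x powr p)" by (rule infsum_cmult_right')
    also have "\<dots> \<le> (real M + 1) * D powr p * (B * (\<Sum>\<^sub>\<infinity>l. norm (c l) powr p))"
      using bs by (intro mult_left_mono) auto
    finally show "(\<lambda>x. \<Sum>j<m x. norm (hderiv j f x) powr p) summable_on A \<and>
      (\<Sum>\<^sub>\<infinity>x\<in>A. \<Sum>j<m x. norm (hderiv j f x) powr p) \<le> (real M + 1) * D powr p * B * (\<Sum>\<^sub>\<infinity>l. norm (c l) powr p)"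
      using s by (simp add: mult.assoc)
  qed
qed

text \<open>Schur's test with the roles exchanged: integers now index the rows and nodes the
  columns, applied to the pointwise estimate of \<open>coefficient_bound\<close>.\<close>

lemma coefficients_le_samples:
  fixes a \<delta> p :: real and M L :: nat
  assumes a: "a > 0" and \<delta>: "0 < \<delta>" "\<delta> \<le> 1" and p: "p \<ge> 1" and L: "L \<ge> 1"
  obtains B where "B > 0"
    "\<And>A m c f. separated_by \<delta> A \<Longrightarrow> (\<forall>l\<in>A. 1 \<le> m l \<and> m l \<le> M) \<Longrightarrow> uniformly_dense L A m \<Longrightarrow>
      lp_seq p c \<Longrightarrow> generated_by (sech_a a) c f \<Longrightarrow>
      (\<lambda>x. \<Sum>j<m x. norm (hderiv j f x) powr p) summable_on A \<Longrightarrow>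
      (\<Sum>\<^sub>\<infinity>l. norm (c l) powr p) \<le> B * (\<Sum>\<^sub>\<infinity>x\<in>A. \<Sum>j<m x. norm (hderiv j f x) powr p)"
proof (rule coefficient_bound[OF a \<delta> L, where M = M])
  fix C assume C: "C > 0" and coef:
    "\<And>A m c f k. separated_by \<delta> A \<Longrightarrow> (\<forall>l\<in>A. 1 \<le> m l \<and> m l \<le> M) \<Longrightarrow> uniformly_dense L A m \<Longrightarrow>
      bounded (range c) \<Longrightarrow> generated_by (sech_a a) c f \<Longrightarrow>
      (\<lambda>x. exp (- 1 * \<bar>real_of_int k - x\<bar>) * (\<Sum>j<m x. norm (hderiv j f x))) summable_on A \<and>
      norm (c k) \<le> C * (\<Sum>\<^sub>\<infinity>x\<in>A. exp (- 1 * \<bar>real_of_int k - x\<bar>) * (\<Sum>j<m x. norm (hderiv j f x)))"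
  obtain E where E: "E > 0" "\<And>F x. finite F \<Longrightarrow> (\<Sum>l\<in>F. exp (- 1 * \<bar>x - real_of_int l\<bar>)) \<le> E"
    using int_exp_sum_bounded[OF zero_less_one] by blast
  obtain E' where E': "E' > 0" "\<And>F x. finite F \<Longrightarrow> separated_by \<delta> F \<Longrightarrow> (\<Sum>l\<in>F. exp (- 1 * \<bar>x - l\<bar>)) \<le> E'"
    using separated_exp_sum_bounded[OF zero_less_one \<delta>(1)] by blast
  \<comment> \<open>The constant for passing from the power of a sum over \<open>j < m x\<close> to
    the sum of the powers; \<open>M + 1\<close> bounds the number of terms and is positive.\<close>
  define Q where "Q = (real M + 1) powr (p - 1)"
  show thesis
  proof (rule that[of "C powr p * (E' powr (p - 1) * E * Q)"])
    show "C powr p * (E' powr (p - 1) * E * Q) > 0" using C E E' by (simp add: Q_def)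
    fix A m c f
    assume A: "separated_by \<delta> A" and m: "\<forall>l\<in>A. 1 \<le> m l \<and> m l \<le> M" and dense: "uniformly_dense L A m"
      and c: "lp_seq p c" and f: "generated_by (sech_a a) c f"
      and s: "(\<lambda>x. \<Sum>j<m x. norm (hderiv j f x) powr p) summable_on A"
    define Y where "Y x = (\<Sum>j<m x. norm (hderiv j f x))" for x
    define b where "b k = (\<Sum>\<^sub>\<infinity>x\<in>A. exp (- 1 * \<bar>real_of_int k - x\<bar>) * Y x)" for k
    have Y0: "Y x \<ge> 0" for x unfolding Y_def by (intro sum_nonneg) auto
    have b0: "b k \<ge> 0" for k unfolding b_def using Y0 by (intro infsum_nonneg) auto
    note coef' = coef[OF A m dense lp_seq_bounded[OF p c] f, folded Y_def, folded b_def]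
    have Yp: "Y x powr p \<le> Q * (\<Sum>j<m x. norm (hderiv j f x) powr p)" if "x \<in> A" for x
      unfolding Y_def Q_def
      using powr_weighted_sum_le[OF p, of "{..<m x}" "\<lambda>_. 1" "\<lambda>j. norm (hderiv j f x)" "real M + 1"] m that
      by force
    have sQ: "(\<lambda>x. Q * (\<Sum>j<m x. norm (hderiv j f x) powr p)) summable_on A"
      by (intro summable_on_cmult_right s)
    have Ys: "(\<lambda>x. Y x powr p) summable_on A"
      by (rule summable_on_comparison_test[OF sQ Yp]) auto
    have hs: "((\<lambda>x. exp (- 1 * \<bar>real_of_int k - x\<bar>) * Y x) has_sum b k) A" for k
      unfolding b_def using coef' by (intro has_sum_infsum) blast
    have row: "(\<Sum>x\<in>F. exp (- 1 * \<bar>real_of_int k - x\<bar>)) \<le> E'" if "finite F" "F \<subseteq> A" for F k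
      by (rule E'(2)[OF that(1) separated_by_subset[OF A that(2)]])
    have col: "(\<Sum>k\<in>F. exp (- 1 * \<bar>real_of_int k - x\<bar>)) \<le> E" if "finite F" for F x
      using E(2)[OF that, of x] by (simp add: abs_minus_commute)
    note schur = schur_test[where A = UNIV and B = A and g = "\<lambda>k x. exp (- 1 * \<bar>real_of_int k - x\<bar>)"
        and y = Y and E = E' and E' = E and p = p and b = b]
    have bs: "(\<lambda>k. b k powr p) summable_on UNIV"
        "(\<Sum>\<^sub>\<infinity>k. b k powr p) \<le> E' powr (p - 1) * E * (\<Sum>\<^sub>\<infinity>x\<in>A. Y x powr p)"
      using E Y0 by (intro schur p row col Ys hs; simp)+
    have "(\<Sum>\<^sub>\<infinity>l. norm (c l) powr p) \<le> (\<Sum>\<^sub>\<infinity>k. C powr p * b k powr p)"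
    proof (rule infsum_mono)
      show "(\<lambda>l. norm (c l) powr p) summable_on UNIV" using c by (simp add: lp_seq_def)
      show "(\<lambda>k. C powr p * b k powr p) summable_on UNIV" by (intro summable_on_cmult_right bs)
      fix k
      have "norm (c k) \<le> C * b k" using coef' by blast
      then have "norm (c k) powr p \<le> (C * b k) powr p" using p by (intro powr_mono2) auto
      then show "norm (c k) powr p \<le> C powr p * b k powr p" using C b0 by (simp add: powr_mult)
    qed
    also have "\<dots> = C powr p * (\<Sum>\<^sub>\<infinity>k. b k powr p)" by (rule infsum_cmult_right')
    also have "\<dots> \<le> C powr p * (E' powr (p - 1) * E * (\<Sum>\<^sub>\<infinity>x\<in>A. Y x powr p))"
      using bs by (intro mult_left_mono) auto
    also have "(\<Sum>\<^sub>\<infinity>x\<in>A. Y x powr p) \<le> (\<Sum>\<^sub>\<infinity>x\<in>A. Q * (\<Sum>j<m x. norm (hderiv j f x) powr p))"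
      by (rule infsum_mono[OF Ys sQ Yp])
    also have "\<dots> = Q * (\<Sum>\<^sub>\<infinity>x\<in>A. \<Sum>j<m x. norm (hderiv j f x) powr p)" by (rule infsum_cmult_right')
    finally show "(\<Sum>\<^sub>\<infinity>l. norm (c l) powr p)
        \<le> C powr p * (E' powr (p - 1) * E * Q) * (\<Sum>\<^sub>\<infinity>x\<in>A. \<Sum>j<m x. norm (hderiv j f x) powr p)"
      using C E E' by (simp add: mult.assoc mult_left_mono)
  qed
qed

section \<open>Equivalence of function norm and coefficient norm\<close>

lemma nn_integral_periodize:
  fixes g :: "real \<Rightarrow> ennreal"
  assumes [measurable]: "g \<in> borel_measurable borel"
  shows "(\<integral>\<^sup>+x. g x \<partial>lborel)
    = (\<integral>\<^sup>+t. (\<integral>\<^sup>+n. g (t + real_of_int n / 2) \<partial>count_space UNIV) * indicator {0..<1/2} t \<partial>lborel)"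
proof -
  have "(\<integral>\<^sup>+t. (\<integral>\<^sup>+n. g (t + real_of_int n / 2) \<partial>count_space UNIV) * indicator {0..<1/2} t \<partial>lborel)
      = (\<integral>\<^sup>+t. (\<integral>\<^sup>+n. g (t + real_of_int n / 2) * indicator {0..<1/2} t \<partial>count_space UNIV) \<partial>lborel)"
    by (intro nn_integral_cong) (simp add: nn_integral_multc)
  also have "\<dots> = (\<integral>\<^sup>+n. (\<integral>\<^sup>+t. g (t + real_of_int n / 2) * indicator {0..<1/2} t \<partial>lborel) \<partial>count_space UNIV)"
    by (rule nn_integral_count_space_nn_integral) auto
  also have "\<dots> = (\<integral>\<^sup>+n. (\<integral>\<^sup>+x. g x * indicator {real_of_int n / 2..<real_of_int n / 2 + 1/2} x \<partial>lborel) \<partial>count_space UNIV)"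
  proof (rule nn_integral_cong)
    fix n :: int
    have "(\<integral>\<^sup>+x. g x * indicator {real_of_int n / 2..<real_of_int n / 2 + 1/2} x \<partial>lborel)
        = (\<integral>\<^sup>+t. g (real_of_int n / 2 + 1 * t) * indicator {real_of_int n / 2..<real_of_int n / 2 + 1/2} (real_of_int n / 2 + 1 * t) \<partial>lborel)"
      by (subst nn_integral_real_affine[where c = 1 and t = "real_of_int n / 2"]) auto
    also have "\<dots> = (\<integral>\<^sup>+t. g (t + real_of_int n / 2) * indicator {0..<1/2} t \<partial>lborel)"
      by (intro nn_integral_cong) (auto simp: add.commute split: split_indicator)
    finally show "(\<integral>\<^sup>+t. g (t + real_of_int n / 2) * indicator {0..<1/2} t \<partial>lborel)
        = (\<integral>\<^sup>+x. g x * indicator {real_of_int n / 2..<real_of_int n / 2 + 1/2} x \<partial>lborel)" ..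
  qed
  also have "\<dots> = (\<integral>\<^sup>+x. (\<integral>\<^sup>+n. g x * indicator {real_of_int n / 2..<real_of_int n / 2 + 1/2} x \<partial>count_space UNIV) \<partial>lborel)"
    by (rule nn_integral_count_space_nn_integral[symmetric]) auto
  also have "\<dots> = (\<integral>\<^sup>+x. g x \<partial>lborel)"
  proof (rule nn_integral_cong)
    fix x :: real
    have "(\<integral>\<^sup>+n. g x * indicator {real_of_int n / 2..<real_of_int n / 2 + 1/2} x \<partial>count_space UNIV)
        = (\<integral>\<^sup>+n. g x * indicator {\<lfloor>2 * x\<rfloor>} n \<partial>count_space UNIV)"
    proof (rule nn_integral_cong)
      fix n :: int
      \<comment> \<open>The half-open intervals of length 1/2 tile the line, so exactly one
        \<open>n\<close> contributes.\<close>
      have "x \<in> {real_of_int n / 2..<real_of_int n / 2 + 1/2} \<longleftrightarrow> n \<in> {\<lfloor>2 * x\<rfloor>}"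
        by (auto simp: floor_eq_iff intro!: floor_unique[symmetric]) linarith+
      then show "g x * indicator {real_of_int n / 2..<real_of_int n / 2 + 1/2} x = g x * indicator {\<lfloor>2 * x\<rfloor>} n"
        by (simp only: indicator_def)
    qed
    also have "\<dots> = g x" by (simp add: nn_integral_cmult)
    finally show "(\<integral>\<^sup>+n. g x * indicator {real_of_int n / 2..<real_of_int n / 2 + 1/2} x \<partial>count_space UNIV) = g x" .
  qed
  finally show ?thesis ..
qed

text \<open>
  Applying the sampling estimates to the lattices \<open>t + \<int> / 2\<close> of density 2 and integrating over \<open>t\<close>
  turns them into the equivalence of the norm of \<open>f\<close> and the norm of its coefficients.
\<close>

definition half_lattice :: "real \<Rightarrow> real set" where
  "half_lattice t = range (\<lambda>n::int. t + real_of_int n / 2)"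

lemma inj_half_lattice: "inj (\<lambda>n::int. t + real_of_int n / 2)"
  by (auto simp: inj_on_def)

lemma half_lattice_separated: "separated_by (1/2) (half_lattice t)"
  unfolding separated_by_def half_lattice_def
proof (safe)
  fix n k :: int assume "t + real_of_int n / 2 \<noteq> t + real_of_int k / 2"
  then have "1 \<le> \<bar>n - k\<bar>" by force
  then have "1 \<le> \<bar>real_of_int n - real_of_int k\<bar>" by linarith
  then show "1 / 2 \<le> \<bar>t + real_of_int n / 2 - (t + real_of_int k / 2)\<bar>" by linarith
qed

text \<open>The first lattice point at or after \<open>y\<close> is less than 1/2 away and three
  further steps take 3/2, so a closed window of length 2 contains four points. This is
  \<open>L + 1\<close> for \<open>L = 3\<close>.\<close>

lemma half_lattice_dense: "uniformly_dense 3 (half_lattice t) (\<lambda>_. 1)"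
  unfolding uniformly_dense_def
proof
  fix y :: real
  define n where "n = \<lceil>2 * (y - t)\<rceil>"
  have n: "2 * (y - t) \<le> real_of_int n" "real_of_int n < 2 * (y - t) + 1" unfolding n_def by linarith+
  define F where "F = (\<lambda>k::int. t + real_of_int k / 2) ` {n..n + 3}"
  have "card F = 4" unfolding F_def by (subst card_image) (auto simp: inj_on_def)
  moreover have "F \<subseteq> half_lattice t \<inter> {y..y + real 3 - 1}"
  proof
    fix x assume "x \<in> F"
    then obtain k where k: "x = t + real_of_int k / 2" "n \<le> k" "k \<le> n + 3" by (auto simp: F_def)
    then have "real_of_int n \<le> real_of_int k" "real_of_int k \<le> real_of_int n + 3" by linarith+
    then have "x \<in> {y..y + real 3 - 1}" using n k by auto
    then show "x \<in> half_lattice t \<inter> {y..y + real 3 - 1}" using k by (auto simp: half_lattice_def)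
  qed
  then have "card F \<le> card (half_lattice t \<inter> {y..y + real 3 - 1})"
    using finite_separated_Int_Icc[OF _ half_lattice_separated] by (intro card_mono) auto
  ultimately show "real 3 + 1 \<le> (\<Sum>l\<in>half_lattice t \<inter> {y..y + real 3 - 1}. real 1)" by simp
qed

text \<open>The sampling constants for the lattices do not depend on the shift \<open>t\<close>, so
  the estimates can be integrated over one cell. Values are taken in the extended nonnegative reals
  because integrability is itself deduced from this bound.\<close>

lemma nn_integral_norm_powr_bounds:
  fixes a p :: real
  assumes a: "a > 0" and p: "p \<ge> 1"
  obtains B where "B > 0"
    "\<And>c f. lp_seq p c \<Longrightarrow> generated_by (sech_a a) c f \<Longrightarrow> f \<in> borel_measurable borel \<Longrightarrow>
      (\<integral>\<^sup>+x. ennreal (norm (f x) powr p) \<partial>lborel) \<le> ennreal (B * (\<Sum>\<^sub>\<infinity>l. norm (c l) powr p)) \<and>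
      ennreal (\<Sum>\<^sub>\<infinity>l. norm (c l) powr p) \<le> ennreal B * (\<integral>\<^sup>+x. ennreal (norm (f x) powr p) \<partial>lborel)"
proof (rule samples_le_coefficients[OF a _ p, where \<delta> = "1/2" and M = 1],
       simp, rule coefficients_le_samples[OF a _ _ p, where \<delta> = "1/2" and M = 1 and L = 3], simp, simp, simp)
  fix B1 assume B1: "(B1::real) > 0" and up:
    "\<And>A m c f. separated_by (1/2) A \<Longrightarrow> (\<forall>l\<in>A. m l \<le> 1) \<Longrightarrow> lp_seq p c \<Longrightarrow> generated_by (sech_a a) c f \<Longrightarrow>
      (\<lambda>x. \<Sum>j<m x. norm (hderiv j f x) powr p) summable_on A \<and>
      (\<Sum>\<^sub>\<infinity>x\<in>A. \<Sum>j<m x. norm (hderiv j f x) powr p) \<le> B1 * (\<Sum>\<^sub>\<infinity>l. norm (c l) powr p)"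
  fix B2 assume B2: "(B2::real) > 0" and low:
    "\<And>A m c f. separated_by (1/2) A \<Longrightarrow> (\<forall>l\<in>A. 1 \<le> m l \<and> m l \<le> 1) \<Longrightarrow> uniformly_dense 3 A m \<Longrightarrow>
      lp_seq p c \<Longrightarrow> generated_by (sech_a a) c f \<Longrightarrow>
      (\<lambda>x. \<Sum>j<m x. norm (hderiv j f x) powr p) summable_on A \<Longrightarrow>
      (\<Sum>\<^sub>\<infinity>l. norm (c l) powr p) \<le> B2 * (\<Sum>\<^sub>\<infinity>x\<in>A. \<Sum>j<m x. norm (hderiv j f x) powr p)"
  show thesis
  \<comment> \<open>The cell has length 1/2, hence the factor 2 in front of
    \<open>B2\<close>.\<close>
  proof (rule that[of "max B1 (2 * B2)"])
    show "max B1 (2 * B2) > 0" using B1 by (simp add: less_max_iff_disj)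
    fix c f
    assume c: "lp_seq p c" and f: "generated_by (sech_a a) c f" and meas [measurable]: "f \<in> borel_measurable borel"
    define X where "X = (\<Sum>\<^sub>\<infinity>l. norm (c l) powr p)"
    have X0: "X \<ge> 0" unfolding X_def by (intro infsum_nonneg) auto
    define S where "S t = (\<Sum>\<^sub>\<infinity>n. norm (f (t + real_of_int n / 2)) powr p)" for t
    have S: "(\<lambda>n. norm (f (t + real_of_int n / 2)) powr p) summable_on UNIV" "S t \<le> B1 * X" "X \<le> B2 * S t" for t
    proof -
      have one: "(\<lambda>x. \<Sum>j<1. norm (hderiv j f x) powr p) = (\<lambda>x. norm (f x) powr p)"
        by (simp add: hderiv_def)
      have s: "(\<lambda>x. norm (f x) powr p) summable_on half_lattice t"
          "(\<Sum>\<^sub>\<infinity>x\<in>half_lattice t. norm (f x) powr p) \<le> B1 * X"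
        using up[OF half_lattice_separated, of t "\<lambda>_. 1" c f] c f unfolding one X_def by auto
      have "X \<le> B2 * (\<Sum>\<^sub>\<infinity>x\<in>half_lattice t. norm (f x) powr p)"
        using low[OF half_lattice_separated _ half_lattice_dense c f, of t] s(1) unfolding one X_def by auto
      moreover have "(\<lambda>x. norm (f x) powr p) summable_on half_lattice t
          \<longleftrightarrow> (\<lambda>n. norm (f (t + real_of_int n / 2)) powr p) summable_on UNIV"
        unfolding half_lattice_def by (subst summable_on_reindex[OF inj_half_lattice]) (simp add: o_def)
      moreover have "(\<Sum>\<^sub>\<infinity>x\<in>half_lattice t. norm (f x) powr p) = S t"
        unfolding half_lattice_def S_def by (subst infsum_reindex[OF inj_half_lattice]) (simp add: o_def)
      ultimately show "(\<lambda>n. norm (f (t + real_of_int n / 2)) powr p) summable_on UNIV" "S t \<le> B1 * X" "X \<le> B2 * S t"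
        using s by auto
    qed
    have cs: "(\<integral>\<^sup>+n. ennreal (norm (f (t + real_of_int n / 2)) powr p) \<partial>count_space UNIV) = ennreal (S t)" for t
    proof -
      have "Infinite_Sum.abs_summable_on (\<lambda>n. norm (f (t + real_of_int n / 2)) powr p) UNIV"
        using S(1)[of t] by simp
      then have abs: "Infinite_Set_Sum.abs_summable_on (\<lambda>n. norm (f (t + real_of_int n / 2)) powr p) UNIV"
        by (simp only: abs_summable_equivalent)
      then show ?thesis
        by (subst nn_integral_conv_infsetsum) (auto simp: S_def infsetsum_infsum)
    qed
    have I: "(\<integral>\<^sup>+x. ennreal (norm (f x) powr p) \<partial>lborel) = (\<integral>\<^sup>+t. ennreal (S t) * indicator {0..<1/2} t \<partial>lborel)"
      by (subst nn_integral_periodize) (simp_all add: cs)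
    have half: "(\<integral>\<^sup>+t. ennreal K * indicator {0..<1/2::real} t \<partial>lborel) = ennreal K * ennreal (1/2)" for K :: real
      by (subst nn_integral_cmult) simp_all
    have "(\<integral>\<^sup>+x. ennreal (norm (f x) powr p) \<partial>lborel) \<le> (\<integral>\<^sup>+t. ennreal (B1 * X) * indicator {0..<1/2::real} t \<partial>lborel)"
      unfolding I using S by (intro nn_integral_mono mult_right_mono ennreal_leI) auto
    also have "\<dots> = ennreal (B1 * X * (1/2))" unfolding half using B1 X0 by (intro ennreal_mult[symmetric]) auto
    also have "\<dots> \<le> ennreal (max B1 (2 * B2) * X)"
    proof (rule ennreal_leI)
      have "B1 * X * (1/2) \<le> B1 * X" using B1 X0 by simp
      also have "\<dots> \<le> max B1 (2 * B2) * X" using X0 by (intro mult_right_mono) auto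
      finally show "B1 * X * (1/2) \<le> max B1 (2 * B2) * X" .
    qed
    finally have 1: "(\<integral>\<^sup>+x. ennreal (norm (f x) powr p) \<partial>lborel) \<le> ennreal (max B1 (2 * B2) * X)" .
    have "ennreal (X / B2) * ennreal (1/2) = (\<integral>\<^sup>+t. ennreal (X / B2) * indicator {0..<1/2::real} t \<partial>lborel)"
      unfolding half ..
    also have "\<dots> \<le> (\<integral>\<^sup>+x. ennreal (norm (f x) powr p) \<partial>lborel)"
      unfolding I using S(3) B2 by (intro nn_integral_mono mult_right_mono ennreal_leI) (auto simp: field_simps)
    finally have "ennreal (2 * B2) * (ennreal (X / B2) * ennreal (1/2)) \<le> ennreal (2 * B2) * (\<integral>\<^sup>+x. ennreal (norm (f x) powr p) \<partial>lborel)"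
      by (rule mult_left_mono) simp
    also have "\<dots> \<le> ennreal (max B1 (2 * B2)) * (\<integral>\<^sup>+x. ennreal (norm (f x) powr p) \<partial>lborel)"
      by (intro mult_right_mono ennreal_leI) auto
    also have "ennreal (2 * B2) * (ennreal (X / B2) * ennreal (1/2)) = ennreal X"
    proof -
      have "ennreal (X / B2) * ennreal (1/2) = ennreal (X / B2 * (1/2))"
        using B2 X0 by (intro ennreal_mult[symmetric]) auto
      moreover have "ennreal (2 * B2) * ennreal (X / B2 * (1/2)) = ennreal (2 * B2 * (X / B2 * (1/2)))"
        using B2 X0 by (intro ennreal_mult[symmetric]) auto
      moreover have "2 * B2 * (X / B2 * (1/2)) = X" using B2 by simp
      ultimately show ?thesis by (simp only:)
    qed
    finally show "(\<integral>\<^sup>+x. ennreal (norm (f x) powr p) \<partial>lborel) \<le> ennreal (max B1 (2 * B2) * (\<Sum>\<^sub>\<infinity>l. norm (c l) powr p)) \<and>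
      ennreal (\<Sum>\<^sub>\<infinity>l. norm (c l) powr p) \<le> ennreal (max B1 (2 * B2)) * (\<integral>\<^sup>+x. ennreal (norm (f x) powr p) \<partial>lborel)"
      using 1 unfolding X_def by blast
  qed
qed

lemma Lp_norm_powr:
  assumes "p \<ge> 1"
  shows "Lp_norm p f powr p = (\<integral>x. norm (f x) powr p \<partial>lborel)"
proof -
  have "0 \<le> (\<integral>x. norm (f x) powr p \<partial>lborel)" by (rule Bochner_Integration.integral_nonneg) simp
  then show ?thesis using assms by (simp add: Lp_norm_def powr_powr)
qed

text \<open>Besides the equivalence of norms this shows that every p-summable sequence generates a
  function in \<open>Lp_fun\<close>. It therefore also supplies the test functions of the necessity
  argument, which are given by their coefficients.\<close>

lemma Lp_norm_coefficients:
  fixes a p :: real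
  assumes a: "a > 0" and p: "p \<ge> 1"
  obtains B where "B > 0"
    "\<And>c f. lp_seq p c \<Longrightarrow> generated_by (sech_a a) c f \<Longrightarrow> Lp_fun p f \<and>
      Lp_norm p f powr p \<le> B * (\<Sum>\<^sub>\<infinity>l. norm (c l) powr p) \<and> (\<Sum>\<^sub>\<infinity>l. norm (c l) powr p) \<le> B * Lp_norm p f powr p"
proof (rule nn_integral_norm_powr_bounds[OF a p])
  fix B :: real assume B: "B > 0" and bnd:
    "\<And>c f. lp_seq p c \<Longrightarrow> generated_by (sech_a a) c f \<Longrightarrow> f \<in> borel_measurable borel \<Longrightarrow>
      (\<integral>\<^sup>+x. ennreal (norm (f x) powr p) \<partial>lborel) \<le> ennreal (B * (\<Sum>\<^sub>\<infinity>l. norm (c l) powr p)) \<and>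
      ennreal (\<Sum>\<^sub>\<infinity>l. norm (c l) powr p) \<le> ennreal B * (\<integral>\<^sup>+x. ennreal (norm (f x) powr p) \<partial>lborel)"
  show thesis
  proof (rule that[OF B])
    fix c f assume c: "lp_seq p c" and f: "generated_by (sech_a a) c f"
    define X where "X = (\<Sum>\<^sub>\<infinity>l. norm (c l) powr p)"
    define I where "I = (\<integral>x. norm (f x) powr p \<partial>lborel)"
    have X0: "X \<ge> 0" unfolding X_def by (intro infsum_nonneg) auto
    have I0: "I \<ge> 0" unfolding I_def by (rule Bochner_Integration.integral_nonneg) simp
    have meas [measurable]: "f \<in> borel_measurable borel"
      by (intro borel_measurable_continuous_onI generated_by_continuous[OF a lp_seq_bounded[OF p c] f])
    note b = bnd[OF c f meas, folded X_def]
    have int: "integrable lborel (\<lambda>x. norm (f x) powr p)"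
    proof (rule integrableI_bounded)
      have "(\<integral>\<^sup>+x. ennreal (norm (norm (f x) powr p)) \<partial>lborel) \<le> ennreal (B * X)" using b by simp
      also have "\<dots> < \<infinity>" by simp
      finally show "(\<integral>\<^sup>+x. ennreal (norm (norm (f x) powr p)) \<partial>lborel) < \<infinity>" .
    qed measurable
    have nn: "(\<integral>\<^sup>+x. ennreal (norm (f x) powr p) \<partial>lborel) = ennreal I"
      unfolding I_def by (rule nn_integral_eq_integral[OF int]) simp
    have "I \<le> B * X" using b B X0 unfolding nn by (simp add: ennreal_le_iff)
    moreover have "ennreal X \<le> ennreal (B * I)" using b B I0 unfolding nn by (simp add: ennreal_mult)
    then have "X \<le> B * I" using B I0 by (simp add: ennreal_le_iff)
    ultimately show "Lp_fun p f \<and> Lp_norm p f powr p \<le> B * (\<Sum>\<^sub>\<infinity>l. norm (c l) powr p) \<and>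
        (\<Sum>\<^sub>\<infinity>l. norm (c l) powr p) \<le> B * Lp_norm p f powr p"
      using int meas by (simp add: Lp_fun_def Lp_norm_powr[OF p] X_def I_def)
  qed
qed

section \<open>Sufficiency of the density condition\<close>

lemma sampling_set_p_if_dense:
  fixes a \<delta> p :: real
  assumes a: "a > 0" and \<delta>: "0 < \<delta>" "\<delta> \<le> 1" and p: "p \<ge> 1" and L: "L \<ge> 1"
    and A: "separated_by \<delta> A" and m: "\<forall>l\<in>A. 1 \<le> m l \<and> m l \<le> M" and dense: "uniformly_dense L A m"
  shows "sampling_set_p p (sech_a a) A m"
proof (rule Lp_norm_coefficients[OF a p], rule samples_le_coefficients[OF a \<delta>(1) p, where M = M],
       rule coefficients_le_samples[OF a \<delta> p L, where M = M])
  fix B :: real assume B: "B > 0" and eq: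
    "\<And>c f. lp_seq p c \<Longrightarrow> generated_by (sech_a a) c f \<Longrightarrow> Lp_fun p f \<and>
      Lp_norm p f powr p \<le> B * (\<Sum>\<^sub>\<infinity>l. norm (c l) powr p) \<and> (\<Sum>\<^sub>\<infinity>l. norm (c l) powr p) \<le> B * Lp_norm p f powr p"
  fix B1 :: real assume B1: "B1 > 0" and up:
    "\<And>A m c f. separated_by \<delta> A \<Longrightarrow> (\<forall>l\<in>A. m l \<le> M) \<Longrightarrow> lp_seq p c \<Longrightarrow> generated_by (sech_a a) c f \<Longrightarrow>
      (\<lambda>x. \<Sum>j<m x. norm (hderiv j f x) powr p) summable_on A \<and>
      (\<Sum>\<^sub>\<infinity>x\<in>A. \<Sum>j<m x. norm (hderiv j f x) powr p) \<le> B1 * (\<Sum>\<^sub>\<infinity>l. norm (c l) powr p)"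
  fix B2 :: real assume B2: "B2 > 0" and low:
    "\<And>A m c f. separated_by \<delta> A \<Longrightarrow> (\<forall>l\<in>A. 1 \<le> m l \<and> m l \<le> M) \<Longrightarrow> uniformly_dense L A m \<Longrightarrow>
      lp_seq p c \<Longrightarrow> generated_by (sech_a a) c f \<Longrightarrow>
      (\<lambda>x. \<Sum>j<m x. norm (hderiv j f x) powr p) summable_on A \<Longrightarrow>
      (\<Sum>\<^sub>\<infinity>l. norm (c l) powr p) \<le> B2 * (\<Sum>\<^sub>\<infinity>x\<in>A. \<Sum>j<m x. norm (hderiv j f x) powr p)"
  have main: "(\<lambda>l. \<Sum>j<m l. norm (hderiv j f l) powr p) summable_on A \<and>
        1 / (B * B2) * Lp_norm p f powr p \<le> (\<Sum>\<^sub>\<infinity>l\<in>A. \<Sum>j<m l. norm (hderiv j f l) powr p) \<and>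
        (\<Sum>\<^sub>\<infinity>l\<in>A. \<Sum>j<m l. norm (hderiv j f l) powr p) \<le> B1 * B * Lp_norm p f powr p"
    if "f \<in> Vp p (sech_a a)" for f
  proof -
    obtain c where c: "lp_seq p c" and f: "generated_by (sech_a a) c f" using \<open>f \<in> _\<close> by (auto simp: Vp_def)
    define X where "X = (\<Sum>\<^sub>\<infinity>l. norm (c l) powr p)"
    define S where "S = (\<Sum>\<^sub>\<infinity>l\<in>A. \<Sum>j<m l. norm (hderiv j f l) powr p)"
    define N where "N = Lp_norm p f powr p"
    have m': "\<forall>l\<in>A. m l \<le> M" using m by blast
    note u = up[OF A m' c f, folded X_def, folded S_def]
    have l: "X \<le> B2 * S" using low[OF A m dense c f] u unfolding X_def S_def by blast
    have e: "N \<le> B * X" "X \<le> B * N" using eq[OF c f] unfolding X_def N_def by auto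
    have "N \<le> B * (B2 * S)" using e(1) mult_left_mono[OF l, of B] B by linarith
    then have "1 / (B * B2) * N \<le> S" using B B2 by (simp add: field_simps)
    moreover have "S \<le> B1 * B * N"
    proof -
      have "S \<le> B1 * X" using u by blast
      also have "\<dots> \<le> B1 * (B * N)" using e(2) B1 by (intro mult_left_mono) auto
      finally show ?thesis by (simp add: mult.assoc)
    qed
    ultimately show ?thesis using u unfolding N_def S_def by blast
  qed
  have pos: "0 < 1 / (B * B2)" "0 < B1 * B" using B B1 B2 by auto
  show "sampling_set_p p (sech_a a) A m"
    unfolding sampling_set_p_def
    by (rule exI[of _ "1 / (B * B2)"], rule conjI[OF pos(1)], rule exI[of _ "B1 * B"], rule conjI[OF pos(2)], rule ballI, rule main)
qed

text \<open>The exponential weights in \<open>coefficient_bound\<close> have a total over the nodes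
  that is bounded uniformly in \<open>k\<close>, so a common bound on the samples passes to the
  coefficients.\<close>

lemma coefficient_sup_bound:
  fixes a \<delta> :: real and M L :: nat
  assumes a: "a > 0" and \<delta>: "0 < \<delta>" "\<delta> \<le> 1" and L: "L \<ge> 1"
  obtains C where "C > 0"
    "\<And>A m c f k \<sigma>. separated_by \<delta> A \<Longrightarrow> (\<forall>l\<in>A. 1 \<le> m l \<and> m l \<le> M) \<Longrightarrow> uniformly_dense L A m \<Longrightarrow>
      bounded (range c) \<Longrightarrow> generated_by (sech_a a) c f \<Longrightarrow> 0 \<le> \<sigma> \<Longrightarrow>
      (\<And>x j. x \<in> A \<Longrightarrow> j < m x \<Longrightarrow> norm (hderiv j f x) \<le> \<sigma>) \<Longrightarrow> norm (c k) \<le> C * \<sigma>"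
proof (rule coefficient_bound[OF a \<delta> L, where M = M])
  fix C assume C: "C > 0" and coef:
    "\<And>A m c f k. separated_by \<delta> A \<Longrightarrow> (\<forall>l\<in>A. 1 \<le> m l \<and> m l \<le> M) \<Longrightarrow> uniformly_dense L A m \<Longrightarrow>
      bounded (range c) \<Longrightarrow> generated_by (sech_a a) c f \<Longrightarrow>
      (\<lambda>x. exp (- 1 * \<bar>real_of_int k - x\<bar>) * (\<Sum>j<m x. norm (hderiv j f x))) summable_on A \<and>
      norm (c k) \<le> C * (\<Sum>\<^sub>\<infinity>x\<in>A. exp (- 1 * \<bar>real_of_int k - x\<bar>) * (\<Sum>j<m x. norm (hderiv j f x)))"
  obtain E where E: "E > 0" "\<And>F x. finite F \<Longrightarrow> separated_by \<delta> F \<Longrightarrow> (\<Sum>l\<in>F. exp (- 1 * \<bar>x - l\<bar>)) \<le> E"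
    using separated_exp_sum_bounded[OF zero_less_one \<delta>(1)] by blast
  show thesis
  proof (rule that[of "C * (E * (real M + 1))"])
    show "C * (E * (real M + 1)) > 0" using C E by simp
    fix A m c f \<sigma> and k :: int
    assume A: "separated_by \<delta> A" and m: "\<forall>l\<in>A. 1 \<le> m l \<and> m l \<le> M" and dense: "uniformly_dense L A m"
      and c: "bounded (range c)" and f: "generated_by (sech_a a) c f" and \<sigma>0: "0 \<le> \<sigma>"
      and \<sigma>: "\<And>x j. x \<in> A \<Longrightarrow> j < m x \<Longrightarrow> norm (hderiv j f x) \<le> \<sigma>"
    define Y where "Y x = (\<Sum>j<m x. norm (hderiv j f x))" for x
    note co = coef[OF A m dense c f, of k, folded Y_def]
    have Y: "Y x \<le> (real M + 1) * \<sigma>" if "x \<in> A" for x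
    proof -
      have "Y x \<le> (\<Sum>j<m x. \<sigma>)" unfolding Y_def using \<sigma> that by (intro sum_mono) auto
      also have "\<dots> = real (m x) * \<sigma>" by simp
      also have "\<dots> \<le> (real M + 1) * \<sigma>" using m that \<sigma>0 by (intro mult_right_mono) auto
      finally show ?thesis .
    qed
    have "(\<Sum>\<^sub>\<infinity>x\<in>A. exp (- 1 * \<bar>real_of_int k - x\<bar>) * Y x) \<le> E * (real M + 1) * \<sigma>"
    proof (rule infsum_le_finite_sums)
      show "(\<lambda>x. exp (- 1 * \<bar>real_of_int k - x\<bar>) * Y x) summable_on A" using co by blast
      fix F assume F: "finite F" "F \<subseteq> A"
      have "(\<Sum>x\<in>F. exp (- 1 * \<bar>real_of_int k - x\<bar>) * Y x) \<le> (\<Sum>x\<in>F. exp (- 1 * \<bar>real_of_int k - x\<bar>) * ((real M + 1) * \<sigma>))"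
        using F Y by (intro sum_mono mult_left_mono) auto
      also have "\<dots> = (\<Sum>x\<in>F. exp (- 1 * \<bar>real_of_int k - x\<bar>)) * ((real M + 1) * \<sigma>)"
        by (simp add: sum_distrib_right)
      also have "\<dots> \<le> E * ((real M + 1) * \<sigma>)"
        using E(2)[OF F(1) separated_by_subset[OF A F(2)]] \<sigma>0 by (intro mult_right_mono) auto
      finally show "(\<Sum>x\<in>F. exp (- 1 * \<bar>real_of_int k - x\<bar>) * Y x) \<le> E * (real M + 1) * \<sigma>" by (simp add: mult.assoc)
    qed
    then have "C * (\<Sum>\<^sub>\<infinity>x\<in>A. exp (- 1 * \<bar>real_of_int k - x\<bar>) * Y x) \<le> C * (E * (real M + 1) * \<sigma>)"
      using C by (intro mult_left_mono) auto
    with conjunct2[OF co] show "norm (c k) \<le> C * (E * (real M + 1)) * \<sigma>" by (simp only: mult.assoc)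
  qed
qed

text \<open>By continuity the set where the norm exceeds \<open>N\<close> is open; being null, it
  contains no interval and is empty. The essential supremum is thus a bound at every single point,
  as sampling requires.\<close>

lemma norm_le_Linf_norm:
  assumes cont: "continuous_on UNIV f" and N: "Linf_norm f \<le> ereal N"
  shows "norm (f x) \<le> N"
proof (rule ccontr)
  assume "\<not> norm (f x) \<le> N"
  define U where "U = {x. N < norm (f x)}"
  have meas [measurable]: "f \<in> borel_measurable borel" by (rule borel_measurable_continuous_onI[OF cont])
  have "open U" unfolding U_def
    by (intro open_Collect_less continuous_on_const continuous_on_norm cont)
  moreover have "x \<in> U" using \<open>\<not> norm (f x) \<le> N\<close> by (simp add: U_def)
  moreover have "AE x in lborel. ereal (norm (f x)) \<le> Linf_norm f"
    unfolding Linf_norm_def by (rule esssup_AE)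
  then have "AE x in lborel. x \<notin> U"
  proof eventually_elim
    case (elim x)
    then have "ereal (norm (f x)) \<le> ereal N" using N by (rule order_trans)
    then show ?case by (simp add: U_def)
  qed
  ultimately obtain e where e: "e > 0" "ball x e \<subseteq> U" and ae: "AE x in lborel. x \<notin> U"
    by (meson open_contains_ball)
  have "AE y in lborel. y \<notin> {x - e<..<x + e}"
    using ae e(2) by (auto elim!: eventually_mono simp: ball_eq_greaterThanLessThan)
  then have "{x - e<..<x + e} \<in> null_sets lborel" by (subst AE_iff_null_sets) auto
  then show False using e(1) by (simp add: null_sets_def)
qed

text \<open>Both inequalities pass through the supremum of the coefficients. For the lower one the
  samples control \<open>c\<close> and \<open>c\<close> controls \<open>f\<close>; for the upper one
  the values of \<open>f\<close> on a half lattice control \<open>c\<close>, which controls the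
  derivatives. Taking \<open>M + 1\<close> in the derivative bound makes order 0 available in every
  case.\<close>

lemma sampling_set_inf_if_dense:
  fixes a \<delta> :: real
  assumes a: "a > 0" and \<delta>: "0 < \<delta>" "\<delta> \<le> 1" and L: "L \<ge> 1"
    and A: "separated_by \<delta> A" and m: "\<forall>l\<in>A. 1 \<le> m l \<and> m l \<le> M" and dense: "uniformly_dense L A m"
  shows "sampling_set_inf (sech_a a) A m"
proof (rule coefficient_sup_bound[OF a \<delta> L, where M = M], rule hderiv_bounded[OF a, where M = "M + 1"],
       rule coefficient_sup_bound[OF a, where M = 1 and \<delta> = "1/2" and L = 3], simp, simp, simp)
  fix C1 :: real assume C1: "C1 > 0" and low:
    "\<And>A m c f k \<sigma>. separated_by \<delta> A \<Longrightarrow> (\<forall>l\<in>A. 1 \<le> m l \<and> m l \<le> M) \<Longrightarrow> uniformly_dense L A m \<Longrightarrow>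
      bounded (range c) \<Longrightarrow> generated_by (sech_a a) c f \<Longrightarrow> 0 \<le> \<sigma> \<Longrightarrow>
      (\<And>x j. x \<in> A \<Longrightarrow> j < m x \<Longrightarrow> norm (hderiv j f x) \<le> \<sigma>) \<Longrightarrow> norm (c k) \<le> C1 * \<sigma>"
  fix H :: real assume H: "H > 0" and hd:
    "\<And>c f B j x. (\<And>l. norm (c l) \<le> B) \<Longrightarrow> generated_by (sech_a a) c f \<Longrightarrow> j < M + 1 \<Longrightarrow> norm (hderiv j f x) \<le> H * B"
  fix C2 :: real assume C2: "C2 > 0" and half:
    "\<And>A m c f k \<sigma>. separated_by (1/2) A \<Longrightarrow> (\<forall>l\<in>A. 1 \<le> m l \<and> m l \<le> 1) \<Longrightarrow> uniformly_dense 3 A m \<Longrightarrow>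
      bounded (range c) \<Longrightarrow> generated_by (sech_a a) c f \<Longrightarrow> 0 \<le> \<sigma> \<Longrightarrow>
      (\<And>x j. x \<in> A \<Longrightarrow> j < m x \<Longrightarrow> norm (hderiv j f x) \<le> \<sigma>) \<Longrightarrow> norm (c k) \<le> C2 * \<sigma>"
  \<comment> \<open>Existence of a node makes the supremum of the samples nonnegative; over an empty
    set it would be \<open>- \<infinity>\<close>.\<close>
  have "A \<noteq> {}"
  proof
    assume "A = {}"
    then have "real L + 1 \<le> 0" using dense unfolding uniformly_dense_def by simp
    then show False by simp
  qed
  then obtain x0 where x0: "x0 \<in> A" by blast
  have main: "ereal (1 / (H * C1)) * Linf_norm f \<le> (SUP l\<in>A. SUP j\<in>{..<m l}. ereal (norm (hderiv j f l))) \<and>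
        (SUP l\<in>A. SUP j\<in>{..<m l}. ereal (norm (hderiv j f l))) \<le> ereal (H * C2) * Linf_norm f"
    if "f \<in> Vinf (sech_a a)" for f
  proof
    obtain c where c: "bounded (range c)" and f: "generated_by (sech_a a) c f" and fin: "Linf_norm f < \<infinity>"
      using \<open>f \<in> _\<close> by (auto simp: Vinf_def linf_seq_def Linf_fun_def)
    have cont: "continuous_on UNIV f" by (rule generated_by_continuous[OF a c f])
    have f0: "hderiv 0 f x = f x" for x by (simp add: hderiv_def)
    define T where "T = (SUP l\<in>A. SUP j\<in>{..<m l}. ereal (norm (hderiv j f l)))"
    have T: "ereal (norm (hderiv j f l)) \<le> T" if "l \<in> A" "j < m l" for l j
      unfolding T_def using that by (intro SUP_upper2[of l] SUP_upper) auto
    have T0: "0 \<le> T"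
    proof -
      have "0 \<le> ereal (norm (hderiv 0 f x0))" by simp
      also have "\<dots> \<le> T" using T[OF x0, of 0] m x0 by force
      finally show ?thesis .
    qed
    have "ereal (1 / (H * C1)) * Linf_norm f \<le> T"
    proof (cases T)
      case (real \<sigma>)
      have "norm (hderiv j f l) \<le> \<sigma>" if "l \<in> A" "j < m l" for l j
        using T[OF that] real by simp
      then have ck: "norm (c k) \<le> C1 * \<sigma>" for k
        using T0 real by (intro low[OF A m dense c f]) auto
      have "norm (f x) \<le> H * (C1 * \<sigma>)" for x using hd[OF ck f, of 0 x] by (simp add: f0)
      then have "Linf_norm f \<le> ereal (H * (C1 * \<sigma>))"
        unfolding Linf_norm_def using borel_measurable_continuous_onI[OF cont] by (intro esssup_I) auto
      then have "ereal (1 / (H * C1)) * Linf_norm f \<le> ereal (1 / (H * C1)) * ereal (H * (C1 * \<sigma>))"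
        using H C1 by (intro ereal_mult_left_mono) auto
      also have "\<dots> = ereal \<sigma>" using H C1 by simp
      finally show ?thesis using real by simp
    qed (use T0 in auto)
    then show "ereal (1 / (H * C1)) * Linf_norm f \<le> (SUP l\<in>A. SUP j\<in>{..<m l}. ereal (norm (hderiv j f l)))"
      unfolding T_def .
    have "Linf_norm f \<noteq> - \<infinity>"
    proof
      assume "Linf_norm f = - \<infinity>"
      then have "norm (f 0) \<le> - 1" by (intro norm_le_Linf_norm[OF cont]) simp
      then show False using norm_ge_zero[of "f 0"] by linarith
    qed
    then obtain N where N: "Linf_norm f = ereal N" using fin by (cases "Linf_norm f") auto
    have fN: "norm (f x) \<le> N" for x using norm_le_Linf_norm[OF cont, of N x] N by simp
    then have N0: "0 \<le> N" using norm_ge_zero order_trans by blast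
    have ck: "norm (c k) \<le> C2 * N" for k
      by (rule half[OF half_lattice_separated _ half_lattice_dense c f N0, of 0]) (auto simp: f0 fN)
    show "(SUP l\<in>A. SUP j\<in>{..<m l}. ereal (norm (hderiv j f l))) \<le> ereal (H * C2) * Linf_norm f"
    proof (intro SUP_least)
      fix l j assume "l \<in> A" "j \<in> {..<m l}"
      then have "j < M + 1" using m by force
      from hd[OF ck f this, of l] show "ereal (norm (hderiv j f l)) \<le> ereal (H * C2) * Linf_norm f"
        by (simp add: N mult.assoc)
    qed
  qed
  have pos: "0 < 1 / (H * C1)" "0 < H * C2" using H C1 C2 by auto
  show "sampling_set_inf (sech_a a) A m"
    unfolding sampling_set_inf_def
    by (rule exI[of _ "1 / (H * C1)"], rule conjI[OF pos(1)], rule exI[of _ "H * C2"], rule conjI[OF pos(2)], rule ballI, rule main)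
qed

text \<open>With \<open>D\<close> strictly between 1 and the density, a long interval of length
  \<open>2 * r = L - 1\<close> has weight at least \<open>D * (L - 1)\<close>, and this reaches
  \<open>L + 1\<close> once \<open>L\<close> is large.\<close>

lemma uniformly_dense_if_lower_density:
  assumes "lower_density A m > 1"
  obtains L where "L \<ge> 1" "uniformly_dense L A m"
proof -
  obtain D where D: "1 < ereal D" "ereal D < lower_density A m"
    using ereal_dense2[OF assms] by blast
  have "\<forall>\<^sub>F r in at_top. ereal D < (INF x. ereal ((\<Sum>l\<in>A \<inter> {x - r..x + r}. real (m l)) / (2 * r)))"
    using D(2) unfolding lower_density_def by (rule less_LiminfD)
  then obtain r0 where r0: "\<And>r. r \<ge> r0 \<Longrightarrow> ereal D < (INF x. ereal ((\<Sum>l\<in>A \<inter> {x - r..x + r}. real (m l)) / (2 * r)))"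
    unfolding eventually_at_top_linorder by blast
  have D1: "D > 1" using D(1) by simp
  \<comment> \<open>The bound 2 makes \<open>r\<close> positive, \<open>2 * r0 + 1\<close> gives
    \<open>r \<ge> r0\<close>, and \<open>(D + 1) / (D - 1)\<close> is what
    \<open>L + 1 \<le> D * (L - 1)\<close> requires.\<close>
  obtain L :: nat where L: "real L \<ge> max (max 2 (2 * r0 + 1)) ((D + 1) / (D - 1))"
    using real_arch_simple by blast
  define r where "r = (real L - 1) / 2"
  have r: "r > 0" "r \<ge> r0" using L by (auto simp: r_def)
  have "real L + 1 \<le> D * (2 * r)"
  proof -
    have "(D + 1) / (D - 1) \<le> real L" using L by simp
    then have "D + 1 \<le> real L * (D - 1)" using D1 by (simp add: field_simps)
    then show ?thesis by (simp add: r_def algebra_simps)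
  qed
  have "uniformly_dense L A m"
    unfolding uniformly_dense_def
  proof
    fix y
    define x where "x = y + r"
    have "ereal D < ereal ((\<Sum>l\<in>A \<inter> {x - r..x + r}. real (m l)) / (2 * r))"
      by (rule less_le_trans[OF r0[OF r(2)] INF_lower]) simp
    then have "D * (2 * r) \<le> (\<Sum>l\<in>A \<inter> {x - r..x + r}. real (m l))"
      using r by (simp add: field_simps)
    moreover have "{x - r..x + r} = {y..y + real L - 1}" by (simp add: x_def r_def field_simps)
    ultimately show "real L + 1 \<le> (\<Sum>l\<in>A \<inter> {y..y + real L - 1}. real (m l))"
      using \<open>real L + 1 \<le> D * (2 * r)\<close> by simp
  qed
  moreover have "L \<ge> 1" using L by simp
  ultimately show thesis using that by blast
qed

section \<open>Necessity of the density condition\<close>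

text \<open>The decay \<open>exp (- a * |x - l|)\<close> is split into two halves: one becomes
  \<open>exp (- (a / 2) * d)\<close> through the distance from the support, the other remains as a
  weight for Schur's test.\<close>

lemma hderiv_off_support_le:
  assumes "a > 0" and D: "\<And>j x. j < M \<Longrightarrow> norm (dsech a j x) \<le> D * exp (- a * \<bar>x\<bar>)" and D0: "D > 0"
    and I: "finite I" "\<And>l. l \<notin> I \<Longrightarrow> c l = 0" and far: "\<And>l. l \<in> I \<Longrightarrow> d \<le> \<bar>x - real_of_int l\<bar>"
    and f: "generated_by (sech_a a) c f" and j: "j < M"
  shows "norm (hderiv j f x) \<le> D * exp (- (a / 2) * d) * (\<Sum>\<^sub>\<infinity>l. exp (- (a / 2) * \<bar>x - real_of_int l\<bar>) * norm (c l))"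
proof -
  have "range c \<subseteq> insert 0 (c ` I)" using I(2) by auto
  then have c: "bounded (range c)" using I(1) by (meson finite_imageI finite_imp_bounded finite_insert finite_subset)
  have s: "((\<lambda>l. exp (- (a / 2) * \<bar>x - real_of_int l\<bar>) * norm (c l)) has_sum
      (\<Sum>l\<in>I. exp (- (a / 2) * \<bar>x - real_of_int l\<bar>) * norm (c l))) UNIV"
    by (rule has_sum_finite_neutralI[of I]) (use I in auto)
  have "norm (hderiv j f x) \<le> D * exp (- (a / 2) * d) * (\<Sum>l\<in>I. exp (- (a / 2) * \<bar>x - real_of_int l\<bar>) * norm (c l))"
  proof (rule norm_infsum_le[OF hderiv_has_sum[OF assms(1) c f] has_sum_cmult_right[OF s]])
    fix l
    show "norm (c l * dsech a j (x - real_of_int l))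
        \<le> D * exp (- (a / 2) * d) * (exp (- (a / 2) * \<bar>x - real_of_int l\<bar>) * norm (c l))"
    proof (cases "l \<in> I")
      case True
      have "a / 2 * d \<le> a / 2 * \<bar>x - real_of_int l\<bar>" using far[OF True] assms(1) by (intro mult_left_mono) auto
      then have "exp (- a * \<bar>x - real_of_int l\<bar>) \<le> exp (- (a / 2) * d + - (a / 2) * \<bar>x - real_of_int l\<bar>)" by simp
      then have e: "exp (- a * \<bar>x - real_of_int l\<bar>) \<le> exp (- (a / 2) * d) * exp (- (a / 2) * \<bar>x - real_of_int l\<bar>)"
        by (simp only: exp_add)
      have "norm (dsech a j (x - real_of_int l)) \<le> D * exp (- a * \<bar>x - real_of_int l\<bar>)" by (rule D[OF j])
      also have "\<dots> \<le> D * (exp (- (a / 2) * d) * exp (- (a / 2) * \<bar>x - real_of_int l\<bar>))"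
        using e D0 by (intro mult_left_mono) auto
      finally have "norm (c l) * norm (dsech a j (x - real_of_int l))
          \<le> norm (c l) * (D * (exp (- (a / 2) * d) * exp (- (a / 2) * \<bar>x - real_of_int l\<bar>)))"
        by (rule mult_left_mono) simp
      then show ?thesis by (simp only: norm_mult mult_ac)
    qed (simp add: I)
  qed
  then show ?thesis using infsumI[OF s] by simp
qed

lemma card_int_interval_ge:
  fixes x s :: real
  assumes "s \<ge> 0"
  shows "2 * s - 1 \<le> real (card {l::int. \<bar>x - real_of_int l\<bar> \<le> s})" "finite {l::int. \<bar>x - real_of_int l\<bar> \<le> s}"
proof -
  have eq: "{l::int. \<bar>x - real_of_int l\<bar> \<le> s} = {\<lceil>x - s\<rceil>..\<lfloor>x + s\<rfloor>}"
    by (auto simp: ceiling_le_iff le_floor_iff abs_le_iff)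
  show "finite {l::int. \<bar>x - real_of_int l\<bar> \<le> s}" unfolding eq by simp
  show "2 * s - 1 \<le> real (card {l::int. \<bar>x - real_of_int l\<bar> \<le> s})"
    unfolding eq card_atLeastAtMost_int by linarith
qed

lemma lower_density_ge_1_if_sampling:
  assumes a: "a > 0" and \<delta>: "\<delta> > 0" and A: "separated_by \<delta> A" and m: "\<forall>l\<in>A. m l \<le> M"
    and sampling: "sampling_set_p 2 (sech_a a) A m"
  shows "lower_density A m \<ge> 1"
proof (rule ccontr)
  assume "\<not> lower_density A m \<ge> 1"
  then have "lower_density A m < 1" by simp
  then obtain \<theta> where \<theta>: "lower_density A m < ereal \<theta>" "ereal \<theta> < 1"
    using ereal_dense2 by blast
  have \<theta>1: "\<theta> < 1" using \<theta>(2) by simp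
  \<comment> \<open>Otherwise the lower limit would be at least \<open>\<theta>\<close>. The radius
    of a sparse interval can thus be taken as large as desired.\<close>
  have sparse: "\<exists>r x. r \<ge> r0 \<and> r > 0 \<and> (\<Sum>l\<in>A \<inter> {x - r..x + r}. real (m l)) < \<theta> * (2 * r)" for r0
  proof (rule ccontr)
    assume neg: "\<not> ?thesis"
    have "\<forall>\<^sub>F r in at_top. ereal \<theta> \<le> (INF x. ereal ((\<Sum>l\<in>A \<inter> {x - r..x + r}. real (m l)) / (2 * r)))"
      using eventually_ge_at_top[of "max r0 1"]
    proof eventually_elim
      case (elim r)
      show ?case
      proof (rule INF_greatest)
        fix x
        have "\<not> (\<Sum>l\<in>A \<inter> {x - r..x + r}. real (m l)) < \<theta> * (2 * r)" using neg elim by auto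
        then show "ereal \<theta> \<le> ereal ((\<Sum>l\<in>A \<inter> {x - r..x + r}. real (m l)) / (2 * r))"
          using elim by (simp add: field_simps)
      qed
    qed
    then have "ereal \<theta> \<le> lower_density A m" unfolding lower_density_def by (rule Liminf_bounded)
    then show False using \<theta>(1) by simp
  qed
  have \<theta>0: "\<theta> > 0"
  proof -
    obtain r x where r: "r > 0" "(\<Sum>l\<in>A \<inter> {x - r..x + r}. real (m l)) < \<theta> * (2 * r)"
      using sparse[of 0] by blast
    moreover have "0 \<le> (\<Sum>l\<in>A \<inter> {x - r..x + r}. real (m l))" by (intro sum_nonneg) simp
    ultimately have "0 < \<theta> * (2 * r)" by linarith
    then show ?thesis using r(1) by (simp add: zero_less_mult_iff)
  qed
  obtain K1 K2 where K: "K1 > 0" and samp: "\<forall>f\<in>Vp 2 (sech_a a).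
        (\<lambda>l. \<Sum>j<m l. norm (hderiv j f l) powr 2) summable_on A \<and>
        K1 * Lp_norm 2 f powr 2 \<le> (\<Sum>\<^sub>\<infinity>l\<in>A. \<Sum>j<m l. norm (hderiv j f l) powr 2) \<and>
        (\<Sum>\<^sub>\<infinity>l\<in>A. \<Sum>j<m l. norm (hderiv j f l) powr 2) \<le> K2 * Lp_norm 2 f powr 2"
    using sampling unfolding sampling_set_p_def by blast
  obtain D where D0: "D > 0" and D: "\<And>j x. j < M \<Longrightarrow> norm (dsech a j x) \<le> D * exp (- a * \<bar>x\<bar>)"
    using dsech_bounded[OF a] by blast
  have a2: "a / 2 > 0" using a by simp
  have p2: "(2::real) \<ge> 1" by simp
  show False
  proof (rule Lp_norm_coefficients[OF a p2], rule exp_kernel_schur[OF a2 \<delta> p2])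
    fix B :: real assume B: "B > 0" and eq:
      "\<And>c f. lp_seq 2 c \<Longrightarrow> generated_by (sech_a a) c f \<Longrightarrow> Lp_fun 2 f \<and>
        Lp_norm 2 f powr 2 \<le> B * (\<Sum>\<^sub>\<infinity>l. norm (c l) powr 2) \<and> (\<Sum>\<^sub>\<infinity>l. norm (c l) powr 2) \<le> B * Lp_norm 2 f powr 2"
    fix B' :: real assume B': "B' > 0" and schur:
      "\<And>A c. separated_by \<delta> A \<Longrightarrow> lp_seq 2 c \<Longrightarrow>
        (\<lambda>x. (\<Sum>\<^sub>\<infinity>l. exp (- (a / 2) * \<bar>x - real_of_int l\<bar>) * norm (c l)) powr 2) summable_on A \<and>
        (\<Sum>\<^sub>\<infinity>x\<in>A. (\<Sum>\<^sub>\<infinity>l. exp (- (a / 2) * \<bar>x - real_of_int l\<bar>) * norm (c l)) powr 2) \<le> B' * (\<Sum>\<^sub>\<infinity>l. norm (c l) powr 2)"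
    \<comment> \<open>The threshold for the contradiction: \<open>exp (- a * d) < \<eta>\<close>
      makes the upper estimate of the samples smaller than the lower sampling inequality
      permits.\<close>
    define \<eta> where "\<eta> = K1 / (B * ((real M + 1) * D powr 2 * B'))"
    have \<eta>: "\<eta> > 0" using K B B' D0 by (simp add: \<eta>_def)
    \<comment> \<open>The first bound gives \<open>1 \<le> (1 - \<theta>) * r\<close> for the
      dimension count, the second \<open>a * d \<ge> 1 - ln \<eta>\<close>.\<close>
    obtain r x where r: "r \<ge> max (1 / (1 - \<theta>)) (2 * (1 - ln \<eta>) / (a * (1 - \<theta>)))" "r > 0"
      and cnt: "(\<Sum>l\<in>A \<inter> {x - r..x + r}. real (m l)) < \<theta> * (2 * r)"
      using sparse by blast
    \<comment> \<open>\<open>s\<close> is halfway between \<open>\<theta> * r\<close> and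
      \<open>r\<close>: the integers within \<open>s\<close> of \<open>x\<close> still outnumber the
      conditions, and a margin \<open>d\<close> proportional to \<open>r\<close> separates them from
      the nodes outside the interval.\<close>
    define s where "s = (1 + \<theta>) / 2 * r"
    define d where "d = (1 - \<theta>) / 2 * r"
    have sd: "r = s + d" by (simp add: s_def d_def field_simps)
    have s0: "s \<ge> 0" using \<theta>0 r by (simp add: s_def)
    have r1: "1 \<le> (1 - \<theta>) * r" using r \<theta>1 by (simp add: field_simps)
    have small: "exp (- a * d) < \<eta>"
    proof -
      have "2 * (1 - ln \<eta>) / (a * (1 - \<theta>)) \<le> r" using r by simp
      then have "2 * (1 - ln \<eta>) \<le> r * (a * (1 - \<theta>))" using a \<theta>1 by (subst (asm) pos_divide_le_eq) auto
      also have "\<dots> = 2 * (a * d)" by (simp add: d_def)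
      finally have "- a * d < ln \<eta>" by simp
      then have "exp (- a * d) < exp (ln \<eta>)" by (simp only: exp_less_cancel_iff)
      then show ?thesis using \<eta> by simp
    qed
    define P where "P = A \<inter> {x - r..x + r}"
    define I where "I = {l::int. \<bar>x - real_of_int l\<bar> \<le> s}"
    \<comment> \<open>One linear condition for each node of the interval and each prescribed order
      of derivative.\<close>
    define J where "J = Sigma P (\<lambda>l. {..<m l})"
    have P: "finite P" unfolding P_def by (rule finite_separated_Int_Icc[OF \<delta> A])
    have I: "finite I" unfolding I_def by (rule card_int_interval_ge(2)[OF s0])
    have J: "finite J" using P by (simp add: J_def)
    have "real (card J) = (\<Sum>l\<in>P. real (m l))" unfolding J_def using P by simp
    also have "\<dots> < \<theta> * (2 * r)" unfolding P_def by (rule cnt)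
    also have "\<dots> \<le> 2 * s - 1" using r1 by (simp add: s_def algebra_simps)
    also have "\<dots> \<le> real (card I)" unfolding I_def by (rule card_int_interval_ge(1)[OF s0])
    finally have card: "card J < card I" by simp
    obtain c :: "int \<Rightarrow> complex" where c0: "\<forall>l. l \<notin> I \<longrightarrow> c l = 0" and cnz: "\<exists>l. c l \<noteq> 0"
      and ker: "\<forall>y\<in>J. (\<Sum>l\<in>I. dsech a (snd y) (fst y - real_of_int l) * c l) = 0"
      using nontrivial_kernel[OF J I card, of "\<lambda>y l. dsech a (snd y) (fst y - real_of_int l)"]
      by (elim exE conjE) (rule that, auto)
    define f where "f y = (\<Sum>l\<in>I. c l * complex_of_real (sech_a a (y - real_of_int l)))" for y
    have f: "generated_by (sech_a a) c f"
      unfolding generated_by_def f_def by (intro allI has_sum_finite_neutralI[OF I]) (use c0 in auto)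
    have c: "lp_seq 2 c" unfolding lp_seq_def
      by (rule has_sum_imp_summable, rule has_sum_finite_neutralI[OF I]) (use c0 in auto)
    define X where "X = (\<Sum>\<^sub>\<infinity>l. norm (c l) powr 2)"
    have X: "X > 0"
    proof -
      obtain l where l: "c l \<noteq> 0" using cnz by blast
      have "(\<Sum>l\<in>{l}. norm (c l) powr 2) \<le> X"
        unfolding X_def using c by (intro finite_sum_le_infsum) (auto simp: lp_seq_def)
      then have "norm (c l) powr 2 \<le> X" by simp
      moreover have "0 < norm (c l) powr 2" using l by simp
      ultimately show ?thesis by linarith
    qed
    define b where "b y = (\<Sum>\<^sub>\<infinity>l. exp (- (a / 2) * \<bar>y - real_of_int l\<bar>) * norm (c l))" for y
    have b0: "b y \<ge> 0" for y unfolding b_def by (intro infsum_nonneg) auto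
    define q where "q = D * exp (- (a / 2) * d)"
    have q0: "q \<ge> 0" using D0 by (simp add: q_def)
    have le: "norm (hderiv j f y) \<le> q * b y" if y: "y \<in> A" "j < m y" for y j
    proof (cases "y \<in> P")
      case True
      then have "(y, j) \<in> J" using y by (simp add: J_def)
      then have "(\<Sum>l\<in>I. c l * dsech a j (y - real_of_int l)) = 0" using ker by (auto simp: mult.commute)
      then have "((\<lambda>l. c l * dsech a j (y - real_of_int l)) has_sum 0) UNIV"
        by (intro has_sum_finite_neutralI[OF I]) (use c0 in auto)
      then have "hderiv j f y = 0"
        using hderiv_has_sum[OF a lp_seq_bounded[OF p2 c] f, of j y] by (rule has_sum_unique[rotated])
      then show ?thesis using q0 b0 by simp
    next
      case False
      have "d \<le> \<bar>y - real_of_int l\<bar>" if "l \<in> I" for l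
      proof -
        have "r < \<bar>x - y\<bar>" using False y by (auto simp: P_def)
        moreover have "\<bar>x - real_of_int l\<bar> \<le> s" using that by (simp add: I_def)
        ultimately show ?thesis using sd by linarith
      qed
      then show ?thesis unfolding q_def b_def
        using y m c0 by (intro hderiv_off_support_le[OF a D D0 I _ _ f]) auto
    qed
    have le': "(\<Sum>j<m y. norm (hderiv j f y) powr 2) \<le> (real M + 1) * q powr 2 * b y powr 2" if "y \<in> A" for y
    proof -
      have "(\<Sum>j<m y. norm (hderiv j f y) powr 2) \<le> (\<Sum>j<m y. (q * b y) powr 2)"
        using that by (intro sum_mono powr_mono2 le) auto
      also have "\<dots> = real (m y) * (q powr 2 * b y powr 2)" using q0 b0 by (simp add: powr_mult)
      also have "\<dots> \<le> (real M + 1) * (q powr 2 * b y powr 2)" using m that by (intro mult_right_mono) auto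
      finally show ?thesis by (simp only: mult.assoc)
    qed
    have fV: "f \<in> Vp 2 (sech_a a)" unfolding Vp_def using eq[OF c f] c f by blast
    have bs: "(\<lambda>y. b y powr 2) summable_on A" "(\<Sum>\<^sub>\<infinity>y\<in>A. b y powr 2) \<le> B' * X"
      using schur[OF A c] unfolding b_def X_def by blast+
    \<comment> \<open>The chain from here leads from \<open>K1 * X\<close> back to
      \<open>K1 * X\<close>, with one strict inequality coming from the choice of
      \<open>\<eta>\<close>.\<close>
    have "X \<le> B * Lp_norm 2 f powr 2" using eq[OF c f] unfolding X_def by blast
    then have "K1 * X \<le> K1 * (B * Lp_norm 2 f powr 2)" using K by (intro mult_left_mono) auto
    also have "\<dots> = B * (K1 * Lp_norm 2 f powr 2)" by simp
    also have "\<dots> \<le> B * (\<Sum>\<^sub>\<infinity>l\<in>A. \<Sum>j<m l. norm (hderiv j f l) powr 2)"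
      using bspec[OF samp fV] B by (intro mult_left_mono) auto
    also have "\<dots> \<le> B * (\<Sum>\<^sub>\<infinity>y\<in>A. (real M + 1) * q powr 2 * b y powr 2)"
      using bspec[OF samp fV] B
      by (intro mult_left_mono infsum_mono summable_on_cmult_right bs le') auto
    also have "\<dots> = B * ((real M + 1) * q powr 2 * (\<Sum>\<^sub>\<infinity>y\<in>A. b y powr 2))"
      by (simp only: infsum_cmult_right')
    also have "\<dots> \<le> B * ((real M + 1) * q powr 2 * (B' * X))"
      using bs(2) B by (intro mult_left_mono) auto
    also have "q powr 2 = D powr 2 * exp (- a * d)"
      using D0 by (simp add: q_def powr_mult exp_powr_real)
    also have "B * ((real M + 1) * (D powr 2 * exp (- a * d)) * (B' * X))
        = B * ((real M + 1) * D powr 2 * B') * exp (- a * d) * X" by (simp only: mult_ac)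
    also have "\<dots> < B * ((real M + 1) * D powr 2 * B') * \<eta> * X"
      using small X B B' D0 by (intro mult_strict_right_mono mult_strict_left_mono) auto
    also have "\<dots> = K1 * X" using B B' D0 by (simp add: \<eta>_def)
    finally show False by simp
  qed
qed

theorem theorem1p2:
  fixes a :: real and \<Lambda> :: "real set" and m :: "real \<Rightarrow> nat"
  assumes "a > 0"
    and "separated \<Lambda>"
    and "\<forall>l\<in>\<Lambda>. m l \<ge> 1"
    and "bdd_above (m ` \<Lambda>)"
  shows "(lower_density \<Lambda> m > 1 \<longrightarrow>
            (\<forall>p::real. 1 \<le> p \<longrightarrow> sampling_set_p p (sech_a a) \<Lambda> m) \<and>
            sampling_set_inf (sech_a a) \<Lambda> m)
       \<and> (sampling_set_p 2 (sech_a a) \<Lambda> m \<longrightarrow> lower_density \<Lambda> m \<ge> 1)"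
proof -
  obtain \<delta>0 where \<delta>0: "\<delta>0 > 0" "separated_by \<delta>0 \<Lambda>"
    using assms(2) unfolding separated_def separated_by_def by blast
  \<comment> \<open>Capping at 1 makes the integers separated by the same constant.\<close>
  define \<delta> where "\<delta> = min \<delta>0 1"
  have \<delta>: "0 < \<delta>" "\<delta> \<le> 1" using \<delta>0 by (auto simp: \<delta>_def)
  have sep: "separated_by \<delta> \<Lambda>" by (rule separated_by_mono[OF \<delta>0(2)]) (simp add: \<delta>_def)
  obtain M where M: "\<And>l. l \<in> \<Lambda> \<Longrightarrow> m l \<le> M" using assms(4) by (auto simp: bdd_above_def)
  have m: "\<forall>l\<in>\<Lambda>. 1 \<le> m l \<and> m l \<le> M" and m': "\<forall>l\<in>\<Lambda>. m l \<le> M" using assms(3) M by auto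
  have "(\<forall>p::real. 1 \<le> p \<longrightarrow> sampling_set_p p (sech_a a) \<Lambda> m) \<and> sampling_set_inf (sech_a a) \<Lambda> m"
    if dens: "lower_density \<Lambda> m > 1"
  proof (rule uniformly_dense_if_lower_density[OF dens])
    fix L assume L: "1 \<le> L" "uniformly_dense L \<Lambda> m"
    show ?thesis
      by (intro conjI allI impI sampling_set_p_if_dense[OF assms(1) \<delta> _ L(1) sep m L(2)]
          sampling_set_inf_if_dense[OF assms(1) \<delta> L(1) sep m L(2)])
  qed
  moreover have "lower_density \<Lambda> m \<ge> 1" if "sampling_set_p 2 (sech_a a) \<Lambda> m"
    by (rule lower_density_ge_1_if_sampling[OF assms(1) \<delta>(1) sep m' that])
  ultimately show ?thesis by blast
qed

end
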